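(* Let $P$ be a right LCM semigroup and let $T:P\to\mathcal{B}(\mathcal{H})$ be a unital contractive representation on a Hilbert space $\mathcal{H}$. The following are equivalent: (1) $T$ has a $\ast$-regular dilation; (2) $T$ has a minimal isometric Nica-covariant dilation; (3) for every finite set $F\subset P$, $$Z(F)=\sum_{U\subseteq F}(-1)^{|U|}\,TT^*(\vee U)\ \ge\ 0.$$
   Context: A unital semigroup $P$ (identity $e$) is right LCM if it is left cancellative ($pa=pb\Rightarrow a=b$) and for all $p,q\in P$ either $pP\cap qP=\emptyset$ or $pP\cap qP=rP$ for some $r\in P$. $P^\ast$ is the set of invertible elements. For finite $F\subset P$, $\vee F=\{r\in P:\bigcap_{x\in F}xP=rP\}$ (a possibly empty set; for $F=\emptyset$ the intersection is $P$, so $\vee\emptyset=P^\ast$), and $p\vee q=\vee\{p,q\}$. If $s\in pP$, $p^{-1}s$ denotes the unique $t\in P$ with $pt=s$. A unital contractive representation is a map $T:P\to\mathcal{B}(\mathcal{H})$ with $T(e)=I$, $T(pq)=T(p)T(q)$, $\|T(p)\|\le1$. Write $TT^*(p)=T(p)T(p)^*$. For finite $U\subset P$, $TT^*(\vee U)=TT^*(r)$ for any $r\in\vee U$ (independent of $r$, since $T(u)$ is unitary for $u\in P^\ast$), and $TT^*(\vee U)=0$ if $\vee U=\emptyset$ (the empty set). In particular the term $U=\emptyset$ of $Z(F)$ is $I$. $T$ has a $\ast$-regular dilation if the kernel $K:P\times P\to\mathcal{B}(\mathcal{H})$ given by $K(p,q)=T(p^{-1}s)T(q^{-1}s)^*$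 for any $s\in p\vee q$ (independent of $s$), and $K(p,q)=0$ if $p\vee q=\emptyset$, is completely positive definite, i.e. the operator matrix $[K(p_i,p_j)]_{i,j}\ge0$ for all $p_1,\dots,p_n\in P$. A minimal isometric Nica-covariant dilation of $T$ is a representation $V:P\to\mathcal{B}(\mathcal{K})$ on a Hilbert space $\mathcal{K}\supset\mathcal{H}$ such that every $V(p)$ is an isometry; $T(p)=P_{\mathcal{H}}V(p)|_{\mathcal{H}}$ for all $p$ ($P_{\mathcal H}$ the orthogonal projection onto $\mathcal H$); $\mathcal{K}=\overline{\operatorname{span}}\{V(p)h:p\in P,h\in\mathcal{H}\}$; and for all $p,q\in P$, $V(p)V(p)^*V(q)V(q)^*=V(r)V(r)^*$ if $pP\cap qP=rP$, and $=0$ if $pP\cap qP=\emptyset$. *)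

theory Defs
  imports
    "HOL-Analysis.Analysis"
    "HOL-Library.Complex_Order"
    "HOL-Library.Function_Algebras"
begin

section \<open>Right LCM semigroups\<close>

definition (in times) principal_right_ideal :: "'a \<Rightarrow> 'a set" where
  "principal_right_ideal p = range (\<lambda>a. p * a)"

class right_lcm_semigroup = monoid_mult +
  assumes left_cancellative: "p * a = p * b \<Longrightarrow> a = b"
    and right_lcm: "principal_right_ideal p \<inter> principal_right_ideal q = {} \<or>
      (\<exists>r. principal_right_ideal p \<inter> principal_right_ideal q = principal_right_ideal r)"

text \<open>The set \<open>\<Or>F\<close>. The intersection over the empty family is \<^term>\<open>UNIV\<close>, so that
  \<open>lcms {}\<close> is the set of invertible elements.\<close>

definition lcms :: "'p::right_lcm_semigroup set \<Rightarrow> 'p set" where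
  "lcms F = {r. (\<Inter>x\<in>F. principal_right_ideal x) = principal_right_ideal r}"

definition left_quotient :: "'p::right_lcm_semigroup \<Rightarrow> 'p \<Rightarrow> 'p" where
  "left_quotient p s = (THE t. p * t = s)"


section \<open>Complex Hilbert spaces\<close>

text \<open>A Hilbert space is carried by a subset of a type, because the dilation space is
  existentially quantified. The inner product is linear in the first argument.\<close>

record 'a hspace =
  hcarrier :: "'a set"
  hscale :: "complex \<Rightarrow> 'a \<Rightarrow> 'a"
  hinner :: "'a \<Rightarrow> 'a \<Rightarrow> complex"

definition hnorm :: "'a hspace \<Rightarrow> 'a \<Rightarrow> real" where
  "hnorm H x = sqrt (Re (hinner H x x))"

text \<open>The value off the carrier is irrelevant; it makes \<open>hdist\<close> satisfy the axioms of
  \<^locale>\<open>Metric_space\<close>, some of which are not restricted to the carrier.\<close>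

definition hdist :: "'a::ab_group_add hspace \<Rightarrow> 'a \<Rightarrow> 'a \<Rightarrow> real" where
  "hdist H x y = (if x \<in> hcarrier H \<and> y \<in> hcarrier H then hnorm H (x - y) else 0)"

text \<open>The order on \<^typ>\<open>complex\<close> is the one for which \<open>0 \<le> z\<close> means that \<open>z\<close> is real and
  nonnegative.\<close>

locale hilbert_space = vector_space "hscale H" for H :: "'a::ab_group_add hspace" +
  assumes subspace_hcarrier: "subspace (hcarrier H)"
    and hinner_commute: "\<lbrakk>x \<in> hcarrier H; y \<in> hcarrier H\<rbrakk> \<Longrightarrow> hinner H x y = cnj (hinner H y x)"
    and hinner_add_left: "\<lbrakk>x \<in> hcarrier H; y \<in> hcarrier H; z \<in> hcarrier H\<rbrakk>
      \<Longrightarrow> hinner H (x + y) z = hinner H x z + hinner H y z"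
    and hinner_scale_left: "\<lbrakk>x \<in> hcarrier H; y \<in> hcarrier H\<rbrakk>
      \<Longrightarrow> hinner H (hscale H c x) y = c * hinner H x y"
    and hinner_ge_zero: "x \<in> hcarrier H \<Longrightarrow> 0 \<le> hinner H x x"
    and hinner_eq_zero: "\<lbrakk>x \<in> hcarrier H; hinner H x x = 0\<rbrakk> \<Longrightarrow> x = 0"
    and complete: "Metric_space.mcomplete (hcarrier H) (hdist H)"


section \<open>Operators\<close>

text \<open>Operators are functions on the underlying type; only their values on the carrier are
  meaningful.\<close>

definition bounded_op :: "'a::ab_group_add hspace \<Rightarrow> ('a \<Rightarrow> 'a) \<Rightarrow> bool" where
  "bounded_op H A \<longleftrightarrow>
    A \<in> hcarrier H \<rightarrow> hcarrier H \<and>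
    (\<forall>x\<in>hcarrier H. \<forall>y\<in>hcarrier H. A (x + y) = A x + A y) \<and>
    (\<forall>c. \<forall>x\<in>hcarrier H. A (hscale H c x) = hscale H c (A x)) \<and>
    (\<exists>C. \<forall>x\<in>hcarrier H. hnorm H (A x) \<le> C * hnorm H x)"

definition op_norm :: "'a hspace \<Rightarrow> ('a \<Rightarrow> 'a) \<Rightarrow> real" where
  "op_norm H A = (SUP x\<in>{x \<in> hcarrier H. hnorm H x \<le> 1}. hnorm H (A x))"

definition hadjoint :: "'a hspace \<Rightarrow> ('a \<Rightarrow> 'a) \<Rightarrow> 'a \<Rightarrow> 'a" where
  "hadjoint H A y = (THE z. z \<in> hcarrier H \<and> (\<forall>x\<in>hcarrier H. hinner H (A x) y = hinner H x z))"

definition positive_op :: "'a hspace \<Rightarrow> ('a \<Rightarrow> 'a) \<Rightarrow> bool" where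
  "positive_op H A \<longleftrightarrow> (\<forall>x\<in>hcarrier H. 0 \<le> hinner H (A x) x)"

text \<open>Positivity of the \<open>n \<times> n\<close> operator matrix \<open>A\<close> on the direct sum of \<open>n\<close> copies of \<open>H\<close>.\<close>

definition positive_op_matrix :: "'a hspace \<Rightarrow> nat \<Rightarrow> (nat \<Rightarrow> nat \<Rightarrow> 'a \<Rightarrow> 'a) \<Rightarrow> bool" where
  "positive_op_matrix H n A \<longleftrightarrow>
    (\<forall>x. (\<forall>i<n. x i \<in> hcarrier H) \<longrightarrow> 0 \<le> (\<Sum>i<n. \<Sum>j<n. hinner H (A i j (x j)) (x i)))"

definition orth_proj :: "'a::ab_group_add hspace \<Rightarrow> 'a set \<Rightarrow> 'a \<Rightarrow> 'a" where
  "orth_proj H M x = (THE y. y \<in> M \<and> (\<forall>m\<in>M. hinner H (x - y) m = 0))"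

definition isometric_embedding ::
  "'a::ab_group_add hspace \<Rightarrow> 'b::ab_group_add hspace \<Rightarrow> ('a \<Rightarrow> 'b) \<Rightarrow> bool" where
  "isometric_embedding H K J \<longleftrightarrow>
    J \<in> hcarrier H \<rightarrow> hcarrier K \<and>
    (\<forall>x\<in>hcarrier H. \<forall>y\<in>hcarrier H. J (x + y) = J x + J y) \<and>
    (\<forall>c. \<forall>x\<in>hcarrier H. J (hscale H c x) = hscale K c (J x)) \<and>
    (\<forall>x\<in>hcarrier H. \<forall>y\<in>hcarrier H. hinner K (J x) (J y) = hinner H x y)"


section \<open>Representations\<close>

definition unital_rep :: "'a::ab_group_add hspace \<Rightarrow> ('p::monoid_mult \<Rightarrow> 'a \<Rightarrow> 'a) \<Rightarrow> bool" where
  "unital_rep H T \<longleftrightarrow>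
    (\<forall>p. bounded_op H (T p)) \<and>
    (\<forall>x\<in>hcarrier H. T 1 x = x) \<and>
    (\<forall>p q. \<forall>x\<in>hcarrier H. T (p * q) x = T p (T q x))"

definition unital_contractive_rep ::
  "'a::ab_group_add hspace \<Rightarrow> ('p::monoid_mult \<Rightarrow> 'a \<Rightarrow> 'a) \<Rightarrow> bool" where
  "unital_contractive_rep H T \<longleftrightarrow> unital_rep H T \<and> (\<forall>p. op_norm H (T p) \<le> 1)"

definition range_op :: "'a hspace \<Rightarrow> ('p \<Rightarrow> 'a \<Rightarrow> 'a) \<Rightarrow> 'p \<Rightarrow> 'a \<Rightarrow> 'a" where
  "range_op H T p = T p \<circ> hadjoint H (T p)"

text \<open>The operators \<open>TT\<^sup>*(\<Or>U)\<close> and \<open>K(p,q)\<close> do not depend on the chosen element of the set of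
  least common multiples.\<close>

definition range_op_lcm ::
  "'a::ab_group_add hspace \<Rightarrow> ('p::right_lcm_semigroup \<Rightarrow> 'a \<Rightarrow> 'a) \<Rightarrow> 'p set \<Rightarrow> 'a \<Rightarrow> 'a" where
  "range_op_lcm H T U =
    (if lcms U = {} then (\<lambda>x. 0) else range_op H T (SOME r. r \<in> lcms U))"

definition Z_op ::
  "'a::ab_group_add hspace \<Rightarrow> ('p::right_lcm_semigroup \<Rightarrow> 'a \<Rightarrow> 'a) \<Rightarrow> 'p set \<Rightarrow> 'a \<Rightarrow> 'a" where
  "Z_op H T F x = (\<Sum>U\<in>Pow F. hscale H ((- 1) ^ card U) (range_op_lcm H T U x))"

definition regular_kernel ::
  "'a::ab_group_add hspace \<Rightarrow> ('p::right_lcm_semigroup \<Rightarrow> 'a \<Rightarrow> 'a) \<Rightarrow> 'p \<Rightarrow> 'p \<Rightarrow> 'a \<Rightarrow> 'a" where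
  "regular_kernel H T p q =
    (if lcms {p, q} = {} then (\<lambda>x. 0)
     else let s = (SOME s. s \<in> lcms {p, q})
          in T (left_quotient p s) \<circ> hadjoint H (T (left_quotient q s)))"

definition star_regular_dilation ::
  "'a::ab_group_add hspace \<Rightarrow> ('p::right_lcm_semigroup \<Rightarrow> 'a \<Rightarrow> 'a) \<Rightarrow> bool" where
  "star_regular_dilation H T \<longleftrightarrow>
    (\<forall>n (p :: nat \<Rightarrow> 'p). positive_op_matrix H n (\<lambda>i j. regular_kernel H T (p i) (p j)))"

definition nica_covariant ::
  "'a::ab_group_add hspace \<Rightarrow> ('p::right_lcm_semigroup \<Rightarrow> 'a \<Rightarrow> 'a) \<Rightarrow> bool" where
  "nica_covariant K V \<longleftrightarrow>
    (\<forall>p q.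
      (\<forall>r. principal_right_ideal p \<inter> principal_right_ideal q = principal_right_ideal r \<longrightarrow>
        (\<forall>x\<in>hcarrier K. range_op K V p (range_op K V q x) = range_op K V r x)) \<and>
      (principal_right_ideal p \<inter> principal_right_ideal q = {} \<longrightarrow>
        (\<forall>x\<in>hcarrier K. range_op K V p (range_op K V q x) = 0)))"

text \<open>The inclusion of \<open>H\<close> in the dilation space \<open>K\<close> is an isometric embedding \<open>J\<close>. The type
  argument is the type whose elements form the dilation space, since HOL cannot quantify over
  types inside a formula.\<close>

definition minimal_isometric_nica_dilation ::
  "'a::ab_group_add hspace \<Rightarrow> ('p::right_lcm_semigroup \<Rightarrow> 'a \<Rightarrow> 'a) \<Rightarrow>
   'k::ab_group_add hspace \<Rightarrow> ('a \<Rightarrow> 'k) \<Rightarrow> ('p \<Rightarrow> 'k \<Rightarrow> 'k) \<Rightarrow> bool" where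
  "minimal_isometric_nica_dilation H T K J V \<longleftrightarrow>
    hilbert_space K \<and>
    isometric_embedding H K J \<and>
    unital_rep K V \<and>
    (\<forall>p. \<forall>x\<in>hcarrier K. hnorm K (V p x) = hnorm K x) \<and>
    (\<forall>p. \<forall>h\<in>hcarrier H. J (T p h) = orth_proj K (J ` hcarrier H) (V p (J h))) \<and>
    Metric_space.mtopology (hcarrier K) (hdist K) closure_of
      module.span (hscale K) {V p (J h) | p h. h \<in> hcarrier H} = hcarrier K \<and>
    nica_covariant K V"

definition has_minimal_isometric_nica_dilation ::
  "'k::ab_group_add itself \<Rightarrow> 'a::ab_group_add hspace \<Rightarrow>
   ('p::right_lcm_semigroup \<Rightarrow> 'a \<Rightarrow> 'a) \<Rightarrow> bool" where
  "has_minimal_isometric_nica_dilation _ H T \<longleftrightarrow>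
    (\<exists>(K :: 'k hspace) J V. minimal_isometric_nica_dilation H T K J V)"

end

theory Submission
  imports Defs
begin

text \<open>The kernel is positive exactly when \<open>K(p,q) = P\<^sub>H V(p)\<^sup>*V(q)|\<^sub>H\<close> for some isometric
  Nica-covariant \<open>V\<close>: Nica covariance gives \<open>V(p)\<^sup>*V(q) = V(p\<^sup>-\<^sup>1s)V(q\<^sup>-\<^sup>1s)\<^sup>*\<close> for \<open>s \<in> p \<or> q\<close>, and
  \<open>V(b)\<^sup>*\<close> maps \<open>H\<close> into itself because the vectors \<open>V(p)h\<close> are total. Conversely, \<open>V\<close> acts on
  the reproducing kernel Hilbert space of \<open>K\<close>, whose elements are functions \<open>P \<rightarrow> H\<close>, by an explicit
  formula, with \<open>V(p)\<^sup>*f = f(p\<cdot>)\<close>; hence \<open>V(p)V(p)\<^sup>*\<close> evaluates \<open>f\<close> on \<open>p \<or> r\<close>, and Nica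
  covariance can be read off pointwise.

  Positivity of the kernel and positivity of all \<open>Z(F)\<close> are related by two identities between
  sesquilinear forms that involve only \<open>T\<close>. They express, inside a dilation, that
  \<open>\<Prod>\<^bsub>p\<in>F\<^esub> (1 - V(p)V(p)\<^sup>*)\<close> is a projection, and that the range projections of
  \<open>V(p\<^sub>1), \<dots>, V(p\<^sub>n)\<close> split \<open>\<parallel>\<Sum>\<^sub>i V(p\<^sub>i)x\<^sub>i\<parallel>\<^sup>2\<close> into the contributions of the atoms of the Boolean
  algebra they generate.\<close>

section \<open>Inner product spaces\<close>

text \<open>The hard direction leads from \<open>Z(F)\<close> to the kernel: until the kernel is
  known to be positive, there is no space on which the projections of a dilation could act.
  Calculation with commuting projections is therefore replaced by inclusion-exclusion on set
  functions. A product of projections over \<open>U\<close> becomes a number attached to the ideal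
  that \<open>U\<close> determines, and idempotence becomes the fact that a product of two such
  products depends only on the union of the index sets. A least common multiple is determined only
  up to an invertible right factor. A contractive representation is unitary on invertible elements,
  and this makes every formula independent of the choice, including the pointwise formula for the
  dilation. Forming the completion from pointwise limits keeps it in the type of functions from
  \<open>P\<close> to \<open>H\<close>, and lets the formula for \<open>V\<close> pass unchanged
  from finite kernel combinations to their limits.\<close>

locale inner_product_space = vector_space "hscale H" for H :: "'a::ab_group_add hspace" +
  assumes subspace_hcarrier: "subspace (hcarrier H)"
    and hinner_commute: "\<lbrakk>x \<in> hcarrier H; y \<in> hcarrier H\<rbrakk> \<Longrightarrow> hinner H x y = cnj (hinner H y x)"
    and hinner_add_left: "\<lbrakk>x \<in> hcarrier H; y \<in> hcarrier H; z \<in> hcarrier H\<rbrakk>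
      \<Longrightarrow> hinner H (x + y) z = hinner H x z + hinner H y z"
    and hinner_scale_left: "\<lbrakk>x \<in> hcarrier H; y \<in> hcarrier H\<rbrakk>
      \<Longrightarrow> hinner H (hscale H c x) y = c * hinner H x y"
    and hinner_ge_zero: "x \<in> hcarrier H \<Longrightarrow> 0 \<le> hinner H x x"
    and hinner_eq_zero: "\<lbrakk>x \<in> hcarrier H; hinner H x x = 0\<rbrakk> \<Longrightarrow> x = 0"

sublocale hilbert_space \<subseteq> inner_product_space H
  by unfold_locales
    (fact subspace_hcarrier hinner_commute hinner_add_left hinner_scale_left hinner_ge_zero
      hinner_eq_zero)+

context inner_product_space
begin

abbreviation carr :: "'a set" where "carr \<equiv> hcarrier H"
abbreviation ip :: "'a \<Rightarrow> 'a \<Rightarrow> complex" where "ip \<equiv> hinner H"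
abbreviation nrm :: "'a \<Rightarrow> real" where "nrm \<equiv> hnorm H"

section \<open>Sesquilinearity and norm estimates\<close>

lemma carr_zero [simp]: "0 \<in> carr"
  using subspace_hcarrier by (simp add: subspace_def)

lemma carr_add [simp]: "x \<in> carr \<Longrightarrow> y \<in> carr \<Longrightarrow> x + y \<in> carr"
  using subspace_hcarrier by (simp add: subspace_def)

lemma carr_scale [simp]: "x \<in> carr \<Longrightarrow> hscale H c x \<in> carr"
  using subspace_hcarrier by (simp add: subspace_def)

lemma carr_diff [simp]: "x \<in> carr \<Longrightarrow> y \<in> carr \<Longrightarrow> x - y \<in> carr"
  using subspace_hcarrier subspace_diff by blast

lemma carr_minus [simp]: "x \<in> carr \<Longrightarrow> - x \<in> carr"
  using carr_diff[of 0 x] by simp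

lemma carr_sum [simp]: "(\<And>i. i \<in> I \<Longrightarrow> f i \<in> carr) \<Longrightarrow> sum f I \<in> carr"
  by (rule subspace_sum[OF subspace_hcarrier])

lemma ip_zero_left [simp]: "y \<in> carr \<Longrightarrow> ip 0 y = 0"
  using hinner_scale_left[of 0 y 0] by simp

lemma ip_zero_right [simp]: "y \<in> carr \<Longrightarrow> ip y 0 = 0"
  using hinner_commute[of y 0] by simp

lemma ip_add_right:
  "\<lbrakk>x \<in> carr; y \<in> carr; z \<in> carr\<rbrakk> \<Longrightarrow> ip x (y + z) = ip x y + ip x z"
  using hinner_commute[of x "y + z"] hinner_commute[of x y] hinner_commute[of x z]
    hinner_add_left[of y z x] by simp

lemma ip_scale_right:
  "\<lbrakk>x \<in> carr; y \<in> carr\<rbrakk> \<Longrightarrow> ip x (hscale H c y) = cnj c * ip x y"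
  using hinner_commute[of x "hscale H c y"] hinner_commute[of x y] hinner_scale_left[of y x c]
  by simp

lemma ip_diff_left:
  "\<lbrakk>x \<in> carr; y \<in> carr; z \<in> carr\<rbrakk> \<Longrightarrow> ip (x - y) z = ip x z - ip y z"
  using hinner_add_left[of "x - y" y z] by simp

lemma ip_diff_right:
  "\<lbrakk>x \<in> carr; y \<in> carr; z \<in> carr\<rbrakk> \<Longrightarrow> ip x (y - z) = ip x y - ip x z"
  using ip_add_right[of x "y - z" z] by simp

lemma ip_sum_left:
  "\<lbrakk>\<And>i. i \<in> I \<Longrightarrow> f i \<in> carr; y \<in> carr\<rbrakk> \<Longrightarrow> ip (sum f I) y = (\<Sum>i\<in>I. ip (f i) y)"
  by (induction I rule: infinite_finite_induct) (auto simp: hinner_add_left)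

lemma ip_sum_right:
  "\<lbrakk>\<And>i. i \<in> I \<Longrightarrow> f i \<in> carr; y \<in> carr\<rbrakk> \<Longrightarrow> ip y (sum f I) = (\<Sum>i\<in>I. ip y (f i))"
  by (induction I rule: infinite_finite_induct) (auto simp: ip_add_right)

lemma ip_self: "x \<in> carr \<Longrightarrow> ip x x = of_real ((nrm x)\<^sup>2)"
  using hinner_ge_zero[of x] by (simp add: hnorm_def less_eq_complex_def complex_eq_iff)

lemma nrm_ge_zero [simp]: "x \<in> carr \<Longrightarrow> 0 \<le> nrm x"
  using hinner_ge_zero[of x] by (simp add: hnorm_def less_eq_complex_def)

lemma nrm_eq_zero: "x \<in> carr \<Longrightarrow> nrm x = 0 \<longleftrightarrow> x = 0"
  using hinner_eq_zero[of x] ip_self[of x]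
  by (metis carr_zero hnorm_def ip_zero_left of_real_0 power_zero_numeral real_sqrt_zero
      zero_complex.sel(1))

lemma nrm_zero [simp]: "nrm 0 = 0"
  by (simp add: nrm_eq_zero)

lemma nrm_diff_sq:
  assumes "x \<in> carr" "y \<in> carr"
  shows "(nrm (x - y))\<^sup>2 = (nrm x)\<^sup>2 - 2 * Re (ip x y) + (nrm y)\<^sup>2"
proof -
  have "ip (x - y) (x - y) = ip x x - ip x y - cnj (ip x y) + ip y y"
    using assms hinner_commute[of y x] by (simp add: ip_diff_left ip_diff_right)
  then have "Re (ip (x - y) (x - y)) = Re (ip x x) - 2 * Re (ip x y) + Re (ip y y)"
    by simp
  then show ?thesis using assms by (simp add: ip_self)
qed

lemma nrm_minus [simp]: "x \<in> carr \<Longrightarrow> nrm (- x) = nrm x"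
  using nrm_diff_sq[of 0 x] by (auto simp: power2_eq_iff_nonneg)

lemma nrm_diff_commute: "\<lbrakk>x \<in> carr; y \<in> carr\<rbrakk> \<Longrightarrow> nrm (x - y) = nrm (y - x)"
  using nrm_minus[of "x - y"] by simp

lemma nrm_scale: "x \<in> carr \<Longrightarrow> nrm (hscale H c x) = cmod c * nrm x"
proof -
  assume x: "x \<in> carr"
  have "ip (hscale H c x) (hscale H c x) = (c * cnj c) * ip x x"
    using x by (simp add: hinner_scale_left ip_scale_right)
  then have "ip (hscale H c x) (hscale H c x) = of_real ((cmod c * nrm x)\<^sup>2)"
    using x by (simp only: ip_self complex_norm_square[symmetric]) (simp add: power_mult_distrib)
  then have "of_real ((nrm (hscale H c x))\<^sup>2) = (of_real ((cmod c * nrm x)\<^sup>2) :: complex)"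
    using x by (simp only: ip_self carr_scale)
  then have "(nrm (hscale H c x))\<^sup>2 = (cmod c * nrm x)\<^sup>2"
    by (simp only: of_real_eq_iff)
  then show ?thesis using x by (simp add: power2_eq_iff_nonneg)
qed

lemma cauchy_schwarz:
  assumes x: "x \<in> carr" and y: "y \<in> carr"
  shows "cmod (ip x y) \<le> nrm x * nrm y"
proof (cases "y = 0")
  case True
  then show ?thesis using x by simp
next
  case False
  then have ny: "nrm y > 0" using y nrm_eq_zero[of y] nrm_ge_zero[of y] by linarith
  \<comment> \<open>The coefficient of the orthogonal projection of \<open>x\<close> onto the line
    through \<open>y\<close>.\<close>
  define c where "c = ip x y / of_real ((nrm y)\<^sup>2)"
  have "(nrm (x - hscale H c y))\<^sup>2
      = (nrm x)\<^sup>2 - 2 * Re (cnj c * ip x y) + (cmod c * nrm y)\<^sup>2"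
    using x y by (simp add: nrm_diff_sq nrm_scale ip_scale_right)
  moreover have "cnj c * ip x y = of_real ((cmod (ip x y))\<^sup>2 / (nrm y)\<^sup>2)"
    using complex_norm_square[of "ip x y"] by (simp add: c_def mult.commute)
  moreover have "cmod c * nrm y = cmod (ip x y) / nrm y"
    using ny by (simp add: c_def norm_divide norm_mult power2_eq_square)
  ultimately have "(nrm (x - hscale H c y))\<^sup>2 = (nrm x)\<^sup>2 - (cmod (ip x y))\<^sup>2 / (nrm y)\<^sup>2"
    by (simp add: power_divide del: of_real_divide of_real_power)
  then have "(cmod (ip x y))\<^sup>2 / (nrm y)\<^sup>2 \<le> (nrm x)\<^sup>2"
    using zero_le_power2[of "nrm (x - hscale H c y)"] by linarith
  then have "(cmod (ip x y))\<^sup>2 \<le> (nrm x * nrm y)\<^sup>2"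
    using ny by (simp add: field_simps)
  then show ?thesis using x y by (simp add: power2_le_iff_abs_le)
qed

lemma nrm_triangle:
  assumes x: "x \<in> carr" and y: "y \<in> carr"
  shows "nrm (x + y) \<le> nrm x + nrm y"
proof -
  have "(nrm (x + y))\<^sup>2 = (nrm x)\<^sup>2 + 2 * Re (ip x y) + (nrm y)\<^sup>2"
    using nrm_diff_sq[of x "- y"] ip_diff_right[of x 0 y] x y by simp
  also have "\<dots> \<le> (nrm x)\<^sup>2 + 2 * (nrm x * nrm y) + (nrm y)\<^sup>2"
    using cauchy_schwarz[OF x y] complex_Re_le_cmod[of "ip x y"] by linarith
  also have "\<dots> = (nrm x + nrm y)\<^sup>2" by (simp add: power2_sum)
  finally show ?thesis using x y by (simp add: power2_le_iff_abs_le)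
qed

lemma nrm_triangle_diff:
  "\<lbrakk>x \<in> carr; y \<in> carr; z \<in> carr\<rbrakk> \<Longrightarrow> nrm (x - z) \<le> nrm (x - y) + nrm (y - z)"
  using nrm_triangle[of "x - y" "y - z"] by simp

lemma ip_ext: "\<lbrakk>x \<in> carr; y \<in> carr; \<And>z. z \<in> carr \<Longrightarrow> ip x z = ip y z\<rbrakk> \<Longrightarrow> x = y"
  using hinner_eq_zero[of "x - y"] ip_diff_left[of x y "x - y"] by simp

lemma ip_ext_right: "\<lbrakk>x \<in> carr; y \<in> carr; \<And>z. z \<in> carr \<Longrightarrow> ip z x = ip z y\<rbrakk> \<Longrightarrow> x = y"
  by (rule ip_ext) (auto simp: hinner_commute[of x] hinner_commute[of y])

sublocale M: Metric_space carr "hdist H"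
proof
  show "0 \<le> hdist H x y" for x y
    by (auto simp: hdist_def)
  show "hdist H x y = hdist H y x" for x y
    using nrm_diff_commute by (auto simp: hdist_def)
  show "hdist H x y = 0 \<longleftrightarrow> x = y" if "x \<in> carr" "y \<in> carr" for x y
    using that by (simp add: hdist_def nrm_eq_zero)
  show "hdist H x z \<le> hdist H x y + hdist H y z" if "x \<in> carr" "y \<in> carr" "z \<in> carr" for x y z
    using that nrm_triangle_diff by (simp add: hdist_def)
qed

section \<open>Cauchy sequences, limits and density in terms of the norm\<close>

definition hCauchy :: "(nat \<Rightarrow> 'a) \<Rightarrow> bool" where
  "hCauchy X \<longleftrightarrow> range X \<subseteq> carr \<and>
    (\<forall>e>0. \<exists>N. \<forall>m\<ge>N. \<forall>n\<ge>N. nrm (X m - X n) < e)"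

definition hlim :: "(nat \<Rightarrow> 'a) \<Rightarrow> 'a \<Rightarrow> bool" where
  "hlim X x \<longleftrightarrow> range X \<subseteq> carr \<and> x \<in> carr \<and> (\<lambda>n. nrm (X n - x)) \<longlonglongrightarrow> 0"

lemma MCauchy_iff_hCauchy: "M.MCauchy X \<longleftrightarrow> hCauchy X"
  unfolding M.MCauchy_def hCauchy_def by (auto simp: hdist_def range_subsetD)

lemma limitin_iff_hlim:
  assumes "range X \<subseteq> carr"
  shows "limitin M.mtopology X x sequentially \<longleftrightarrow> hlim X x"
proof (cases "x \<in> carr")
  case True
  then have "limitin M.mtopology X x sequentially \<longleftrightarrow> (\<lambda>n. hdist H (X n) x) \<longlonglongrightarrow> 0"
    using assms by (auto simp: M.limitin_metric_dist_null range_subsetD intro!: always_eventually)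
  moreover have "hdist H (X n) x = nrm (X n - x)" for n
    using assms True by (auto simp: hdist_def)
  ultimately show ?thesis using assms True by (simp add: hlim_def)
next
  case False
  then show ?thesis by (auto simp: hlim_def M.limitin_metric_dist_null)
qed

lemma mcomplete_iff: "M.mcomplete \<longleftrightarrow> (\<forall>X. hCauchy X \<longrightarrow> (\<exists>x. hlim X x))"
  unfolding M.mcomplete_def MCauchy_iff_hCauchy
  using limitin_iff_hlim hCauchy_def by metis

lemma hlim_unique:
  assumes "hlim X x" "hlim X y"
  shows "x = y"
  using assms limitin_iff_hlim[of X] M.limitin_metric_unique[of X x sequentially y]
  by (auto simp: hlim_def)

lemma hlim_imp_hCauchy: "hlim X x \<Longrightarrow> hCauchy X"
  using M.convergent_imp_MCauchy[of X x] limitin_iff_hlim[of X x] MCauchy_iff_hCauchy[of X]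
  by (simp add: hlim_def)

lemma hCauchy_bounded:
  assumes "hCauchy X"
  obtains B where "\<And>n. nrm (X n) \<le> B"
proof -
  have X: "X n \<in> carr" for n using assms by (auto simp: hCauchy_def)
  obtain N where N: "\<And>m n. m \<ge> N \<Longrightarrow> n \<ge> N \<Longrightarrow> nrm (X m - X n) < 1"
    using assms unfolding hCauchy_def by (metis zero_less_one)
  have "nrm (X n) \<le> (MAX m\<in>{..N}. nrm (X m)) + 1" for n
  proof (cases "n \<le> N")
    case True
    then have "nrm (X n) \<le> (MAX m\<in>{..N}. nrm (X m))" by (intro Max_ge) auto
    then show ?thesis by simp
  next
    case False
    then have "nrm (X n) \<le> nrm (X n - X N) + nrm (X N)"
      using nrm_triangle[of "X n - X N" "X N"] X by simp
    moreover have "nrm (X n - X N) < 1" using N False by simp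
    moreover have "nrm (X N) \<le> (MAX m\<in>{..N}. nrm (X m))" by (intro Max_ge) auto
    ultimately show ?thesis by linarith
  qed
  then show ?thesis using that by blast
qed

lemma hCauchy_add:
  assumes "hCauchy X" "hCauchy Y"
  shows "hCauchy (\<lambda>n. X n + Y n)"
  unfolding hCauchy_def
proof (intro conjI allI impI)
  have X: "X n \<in> carr" and Y: "Y n \<in> carr" for n using assms by (auto simp: hCauchy_def)
  then show "range (\<lambda>n. X n + Y n) \<subseteq> carr" by auto
  fix e :: real assume "e > 0"
  then obtain N1 N2 where N: "\<And>m n. m \<ge> N1 \<Longrightarrow> n \<ge> N1 \<Longrightarrow> nrm (X m - X n) < e / 2"
    "\<And>m n. m \<ge> N2 \<Longrightarrow> n \<ge> N2 \<Longrightarrow> nrm (Y m - Y n) < e / 2"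
    using assms unfolding hCauchy_def by (meson half_gt_zero)
  have "nrm ((X m + Y m) - (X n + Y n)) < e" if "m \<ge> max N1 N2" "n \<ge> max N1 N2" for m n
  proof -
    have eq: "(X m + Y m) - (X n + Y n) = (X m - X n) + (Y m - Y n)" by simp
    show ?thesis
      unfolding eq using nrm_triangle[of "X m - X n" "Y m - Y n"] X Y N(1)[of m n] N(2)[of m n] that
      by simp
  qed
  then show "\<exists>N. \<forall>m\<ge>N. \<forall>n\<ge>N. nrm ((X m + Y m) - (X n + Y n)) < e" by blast
qed

lemma hCauchy_map:
  assumes "hCauchy X" and "\<And>n. Y n \<in> carr" and "\<And>m n. nrm (Y m - Y n) \<le> C * nrm (X m - X n)"
  shows "hCauchy Y"
  unfolding hCauchy_def
proof (intro conjI allI impI)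
  show "range Y \<subseteq> carr" using assms by auto
  fix e :: real assume e: "e > 0"
  \<comment> \<open>\<open>C\<close> may be zero or negative, and a positive constant is needed as a
    divisor.\<close>
  define D where "D = max C 1"
  have D: "D > 0" "C \<le> D" by (auto simp: D_def)
  have X: "X n \<in> carr" for n using assms(1) by (auto simp: hCauchy_def)
  obtain N where N: "\<And>m n. m \<ge> N \<Longrightarrow> n \<ge> N \<Longrightarrow> nrm (X m - X n) < e / D"
    using assms(1) e D unfolding hCauchy_def by (meson divide_pos_pos)
  have "nrm (Y m - Y n) < e" if "m \<ge> N" "n \<ge> N" for m n
  proof -
    have "nrm (Y m - Y n) \<le> D * nrm (X m - X n)"
      using assms(3)[of m n] D mult_right_mono[of C D "nrm (X m - X n)"] X by simp
    also have "\<dots> < D * (e / D)" using N[OF that] D(1) by (rule mult_strict_left_mono)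
    finally show ?thesis using D by simp
  qed
  then show "\<exists>N. \<forall>m\<ge>N. \<forall>n\<ge>N. nrm (Y m - Y n) < e" by blast
qed

lemma hCauchy_scale: "hCauchy X \<Longrightarrow> hCauchy (\<lambda>n. hscale H c (X n))"
  by (rule hCauchy_map[of X _ "cmod c"])
    (auto simp: hCauchy_def range_subsetD nrm_scale simp flip: scale_right_diff_distrib)

lemma hlim_add:
  assumes "hlim X x" "hlim Y y"
  shows "hlim (\<lambda>n. X n + Y n) (x + y)"
  unfolding hlim_def
proof (intro conjI)
  have X: "X n \<in> carr" "x \<in> carr" and Y: "Y n \<in> carr" "y \<in> carr" for n
    using assms by (auto simp: hlim_def)
  then show "range (\<lambda>n. X n + Y n) \<subseteq> carr" "x + y \<in> carr" by auto
  have 1: "(X n + Y n) - (x + y) = (X n - x) + (Y n - y)" for n by simp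
  show "(\<lambda>n. nrm ((X n + Y n) - (x + y))) \<longlonglongrightarrow> 0"
  proof (rule Lim_null_comparison)
    show "\<forall>\<^sub>F n in sequentially. norm (nrm ((X n + Y n) - (x + y)))
        \<le> nrm (X n - x) + nrm (Y n - y)"
      using X Y by (simp add: 1 nrm_triangle)
    show "(\<lambda>n. nrm (X n - x) + nrm (Y n - y)) \<longlonglongrightarrow> 0"
      using assms by (auto simp: hlim_def intro: tendsto_add_zero)
  qed
qed

lemma hlim_scale:
  assumes "hlim X x"
  shows "hlim (\<lambda>n. hscale H c (X n)) (hscale H c x)"
  using assms tendsto_mult_right_zero[of "\<lambda>n. nrm (X n - x)" sequentially "cmod c"]
  by (auto simp: hlim_def range_subsetD nrm_scale simp flip: scale_right_diff_distrib)

lemma hlim_const [simp]: "x \<in> carr \<Longrightarrow> hlim (\<lambda>n. x) x"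
  by (auto simp: hlim_def)

lemma hlim_ip:
  assumes "hlim X x" "y \<in> carr"
  shows "(\<lambda>n. ip (X n) y) \<longlonglongrightarrow> ip x y"
proof (rule LIM_zero_cancel, rule Lim_null_comparison)
  show "\<forall>\<^sub>F n in sequentially. cmod (ip (X n) y - ip x y) \<le> nrm (X n - x) * nrm y"
    using assms cauchy_schwarz[of "X _ - x" y]
    by (auto simp: hlim_def range_subsetD simp flip: ip_diff_left)
  show "(\<lambda>n. nrm (X n - x) * nrm y) \<longlonglongrightarrow> 0"
    using assms by (auto simp: hlim_def intro: tendsto_mult_left_zero)
qed

lemma hlim_bounded_image:
  assumes "hlim X x" "A ` carr \<subseteq> carr"
    and "\<And>u v. u \<in> carr \<Longrightarrow> v \<in> carr \<Longrightarrow> nrm (A u - A v) \<le> C * nrm (u - v)"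
  shows "hlim (\<lambda>n. A (X n)) (A x)"
  unfolding hlim_def
proof (intro conjI)
  have X: "X n \<in> carr" "x \<in> carr" for n using assms by (auto simp: hlim_def)
  then show "range (\<lambda>n. A (X n)) \<subseteq> carr" "A x \<in> carr" using assms by auto
  show "(\<lambda>n. nrm (A (X n) - A x)) \<longlonglongrightarrow> 0"
  proof (rule Lim_null_comparison)
    show "\<forall>\<^sub>F n in sequentially. norm (nrm (A (X n) - A x)) \<le> C * nrm (X n - x)"
      using X assms by (auto simp: image_subset_iff)
    show "(\<lambda>n. C * nrm (X n - x)) \<longlonglongrightarrow> 0"
      using assms by (auto simp: hlim_def intro: tendsto_mult_right_zero)
  qed
qed

lemma in_closure_of_iff:
  assumes "S \<subseteq> carr"
  shows "x \<in> M.mtopology closure_of S \<longleftrightarrow> x \<in> carr \<and> (\<forall>e>0. \<exists>y\<in>S. nrm (x - y) < e)"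
  using assms nrm_diff_commute unfolding M.metric_closure_of M.in_mball
  by (auto simp: hdist_def subset_iff) metis+

text \<open>The difference \<open>d\<close> of the two vectors is orthogonal to the span, so its
  squared norm equals \<open>ip d (d - z)\<close> for each \<open>z\<close> in the span, and
  \<open>z\<close> can be taken arbitrarily close to \<open>d\<close>.\<close>

lemma dense_ip_ext:
  assumes "S \<subseteq> carr" "M.mtopology closure_of span S = carr" "x \<in> carr" "y \<in> carr"
    and eq: "\<And>z. z \<in> S \<Longrightarrow> ip x z = ip y z"
  shows "x = y"
proof -
  have span: "span S \<subseteq> carr" using assms(1) subspace_hcarrier by (simp add: span_minimal)
  have orth: "ip (x - y) z = 0" if "z \<in> span S" for z
  proof -
    have "subspace {z \<in> carr. ip (x - y) z = 0}"
      using assms(3,4) by (auto simp: subspace_def ip_add_right ip_scale_right)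
    moreover have "S \<subseteq> {z \<in> carr. ip (x - y) z = 0}"
      using assms by (auto simp: ip_diff_left)
    ultimately have "span S \<subseteq> {z \<in> carr. ip (x - y) z = 0}" by (simp add: span_minimal)
    then show ?thesis using that by blast
  qed
  have "nrm (x - y) \<le> 0"
  proof (rule field_le_epsilon)
    fix e :: real assume "e > 0"
    moreover have "x - y \<in> M.mtopology closure_of span S" using assms by simp
    ultimately obtain z where z: "z \<in> span S" "nrm ((x - y) - z) < e"
      using in_closure_of_iff[OF span] by blast
    let ?d = "x - y"
    have d: "?d \<in> carr" and zc: "z \<in> carr" using assms span z by auto
    have "ip ?d (?d - z) = of_real ((nrm ?d)\<^sup>2)"
      using orth[OF z(1)] d zc by (simp add: ip_diff_right[of ?d ?d z] ip_self)
    then have "(nrm ?d)\<^sup>2 = cmod (ip ?d (?d - z))" by (simp add: norm_power)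
    also have "\<dots> \<le> nrm ?d * nrm (?d - z)" using cauchy_schwarz[of ?d "?d - z"] d zc by simp
    finally have "nrm ?d * nrm ?d \<le> nrm ?d * nrm (?d - z)" by (simp add: power2_eq_square)
    then have "nrm ?d \<le> nrm (?d - z)"
      using nrm_ge_zero[OF d] nrm_ge_zero[of "?d - z"] d zc
      by (cases "nrm ?d = 0") (auto simp: mult_le_cancel_left)
    then show "nrm ?d \<le> 0 + e" using z by simp
  qed
  then have "nrm (x - y) = 0" using assms by (intro antisym) simp_all
  then show ?thesis using nrm_eq_zero[of "x - y"] assms by simp
qed

end

lemma hilbert_spaceI:
  assumes "inner_product_space H" and "Metric_space.mcomplete (hcarrier H) (hdist H)"
  shows "hilbert_space H"
proof -
  interpret inner_product_space H by fact
  show ?thesis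
    by unfold_locales
      (fact subspace_hcarrier hinner_commute hinner_add_left hinner_scale_left hinner_ge_zero
        hinner_eq_zero assms(2))+
qed


section \<open>Bounded operators and adjoints\<close>

lemma bounded_opD:
  assumes "bounded_op H A"
  shows "x \<in> hcarrier H \<Longrightarrow> A x \<in> hcarrier H"
    and "\<lbrakk>x \<in> hcarrier H; y \<in> hcarrier H\<rbrakk> \<Longrightarrow> A (x + y) = A x + A y"
    and "x \<in> hcarrier H \<Longrightarrow> A (hscale H c x) = hscale H c (A x)"
  using assms by (auto simp: bounded_op_def)

lemma (in inner_product_space) bounded_op_bound:
  assumes "bounded_op H A"
  obtains C where "C \<ge> 0" "\<And>x. x \<in> carr \<Longrightarrow> nrm (A x) \<le> C * nrm x"
proof -
  obtain C where C: "\<And>x. x \<in> carr \<Longrightarrow> nrm (A x) \<le> C * nrm x"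
    using assms unfolding bounded_op_def by blast
  show ?thesis
  proof (rule that[of "max C 0"])
    fix x assume x: "x \<in> carr"
    have "C * nrm x \<le> max C 0 * nrm x" using x by (intro mult_right_mono) auto
    then show "nrm (A x) \<le> max C 0 * nrm x" using C[OF x] by linarith
  qed simp
qed

lemma (in inner_product_space) bounded_op_zero: "bounded_op H A \<Longrightarrow> A 0 = 0"
  using bounded_opD(3)[of H A 0 0] by simp

lemma (in inner_product_space) bounded_op_diff:
  assumes "bounded_op H A" "x \<in> carr" "y \<in> carr"
  shows "A (x - y) = A x - A y"
  using bounded_opD(2)[OF assms(1), of "x - y" y] assms by (simp add: algebra_simps)

lemma (in inner_product_space) bounded_op_sum:
  assumes "bounded_op H A" "\<And>i. i \<in> I \<Longrightarrow> f i \<in> carr"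
  shows "A (sum f I) = (\<Sum>i\<in>I. A (f i))"
  using assms(2)
  by (induction I rule: infinite_finite_induct)
    (auto simp: bounded_opD[OF assms(1)] bounded_op_zero[OF assms(1)])

lemma (in inner_product_space) bounded_op_hlim:
  assumes "bounded_op H A" "hlim X x"
  shows "hlim (\<lambda>n. A (X n)) (A x)"
proof -
  obtain C where C: "\<And>x. x \<in> carr \<Longrightarrow> nrm (A x) \<le> C * nrm x"
    using bounded_op_bound[OF assms(1)] by blast
  show ?thesis
  proof (rule hlim_bounded_image[where A = A and X = X and C = C])
    show "nrm (A u - A v) \<le> C * nrm (u - v)" if "u \<in> carr" "v \<in> carr" for u v
      using C[of "u - v"] bounded_op_diff[OF assms(1) that] that by simp
  qed (use assms bounded_opD(1)[OF assms(1)] in auto)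
qed

text \<open>The first-variation argument: divide by \<open>s\<close> and let it tend to 0. The
  single value \<open>s = a / (b + 1)\<close> already suffices, the summand 1 guarding against
  \<open>b = 0\<close>.\<close>

lemma quadratic_bound_imp_zero:
  fixes a b :: real
  assumes "a \<ge> 0" "b \<ge> 0" and "\<And>s. s > 0 \<Longrightarrow> 2 * s * a \<le> s\<^sup>2 * b"
  shows "a = 0"
proof (rule ccontr)
  assume "a \<noteq> 0"
  then have a: "a > 0" using assms by simp
  have "2 * (a / (b + 1)) * a \<le> (a / (b + 1))\<^sup>2 * b" using a assms by (intro assms(3)) simp
  also have "\<dots> = (a / (b + 1)) * (a * (b / (b + 1)))" by (simp add: power2_eq_square)
  also have "\<dots> \<le> (a / (b + 1)) * (a * 1)"
    using a assms by (intro mult_left_mono) auto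
  finally have "(a / (b + 1)) * a \<le> 0" by simp
  moreover have "(a / (b + 1)) * a > 0" using a assms by (intro mult_pos_pos divide_pos_pos) auto
  ultimately show False by simp
qed

context hilbert_space
begin

lemma hCauchy_imp_hlim: "hCauchy X \<Longrightarrow> \<exists>x. hlim X x"
  using complete mcomplete_iff by blast

text \<open>The representing vector minimises \<open>\<parallel>x\<parallel>\<^sup>2 - 2 Re \<phi>(x)\<close>; minimising sequences are Cauchy by
  the parallelogram identity.\<close>

theorem riesz_representation:
  assumes add: "\<And>x y. \<lbrakk>x \<in> carr; y \<in> carr\<rbrakk> \<Longrightarrow> \<phi> (x + y) = \<phi> x + \<phi> y"
    and scale: "\<And>c x. x \<in> carr \<Longrightarrow> \<phi> (hscale H c x) = c * \<phi> x"
    and bound: "\<And>x. x \<in> carr \<Longrightarrow> cmod (\<phi> x) \<le> C * nrm x"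
  obtains z where "z \<in> carr" "\<And>x. x \<in> carr \<Longrightarrow> \<phi> x = ip x z"
proof -
  have zero: "\<phi> 0 = 0" using scale[of 0 0] by simp
  have neg: "\<phi> (- x) = - \<phi> x" if "x \<in> carr" for x using add[of x "- x"] that zero
    by (simp add: eq_neg_iff_add_eq_0 add.commute)
  have diff: "\<phi> (x - y) = \<phi> x - \<phi> y" if "x \<in> carr" "y \<in> carr" for x y
    using add[of x "- y"] neg[of y] that by simp
  define F where "F x = (nrm x)\<^sup>2 - 2 * Re (\<phi> x)" for x
  have F_ge: "F x \<ge> - (C\<^sup>2)" if "x \<in> carr" for x
  proof -
    have "Re (\<phi> x) \<le> C * nrm x" using bound[OF that] complex_Re_le_cmod[of "\<phi> x"] by linarith
    moreover have "0 \<le> (nrm x - C)\<^sup>2" by simp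
    ultimately show ?thesis by (simp add: F_def power2_diff algebra_simps)
  qed
  define m where "m = Inf (F ` carr)"
  have bdd: "bdd_below (F ` carr)" using F_ge by (intro bdd_belowI2) auto
  have m_le: "m \<le> F x" if "x \<in> carr" for x
    unfolding m_def using bdd that by (intro cInf_lower) auto
  have "\<exists>x\<in>carr. F x < m + 1 / Suc n" for n
  proof -
    have "Inf (F ` carr) < m + 1 / Suc n" by (simp add: m_def)
    moreover have "F ` carr \<noteq> {}" using carr_zero by blast
    ultimately show ?thesis using cInf_lessD[of "F ` carr"] by auto
  qed
  then obtain X where X: "\<And>n. X n \<in> carr" "\<And>n. F (X n) < m + 1 / Suc n" by metis
  have para: "(nrm (x - y))\<^sup>2 \<le> 2 * (F x - m) + 2 * (F y - m)" if xy: "x \<in> carr" "y \<in> carr" for x y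
  proof -
    \<comment> \<open>The midpoint: in \<open>2 * F x + 2 * F y - 4 * F h\<close> the linear parts
      cancel and the squared norm of \<open>x - y\<close> remains.\<close>
    define h where "h = hscale H (1 / 2) (x + y)"
    have h: "h \<in> carr" using xy by (simp add: h_def)
    have "(nrm (x + y))\<^sup>2 = (nrm x)\<^sup>2 + 2 * Re (ip x y) + (nrm y)\<^sup>2"
      using nrm_diff_sq[of x "- y"] ip_diff_right[of x 0 y] xy by simp
    moreover have "(nrm h)\<^sup>2 = (nrm (x + y))\<^sup>2 / 4"
      using xy by (simp add: h_def nrm_scale power_divide norm_divide del: scale_right_distrib)
    moreover have "Re (\<phi> h) = (Re (\<phi> x) + Re (\<phi> y)) / 2"
      using xy by (simp only: h_def scale add carr_add) simp
    ultimately have "4 * F h = (nrm x)\<^sup>2 + 2 * Re (ip x y) + (nrm y)\<^sup>2 - 4 * (Re (\<phi> x) + Re (\<phi> y))"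
      by (simp add: F_def)
    moreover have "m \<le> F h" using h by (rule m_le)
    moreover have "(nrm (x - y))\<^sup>2 = (nrm x)\<^sup>2 - 2 * Re (ip x y) + (nrm y)\<^sup>2"
      using xy by (simp add: nrm_diff_sq)
    ultimately show ?thesis unfolding F_def by argo
  qed
  have "hCauchy X"
    unfolding hCauchy_def
  proof (intro conjI allI impI)
    show "range X \<subseteq> carr" using X by auto
    fix e :: real assume e: "e > 0"
    obtain N where N: "1 / real (Suc N) < e\<^sup>2 / 4"
      using reals_Archimedean[of "e\<^sup>2 / 4"] e by (auto simp: inverse_eq_divide)
    have "nrm (X i - X j) < e" if "i \<ge> N" "j \<ge> N" for i j
    proof -
      have *: "F (X k) - m < e\<^sup>2 / 4" if "k \<ge> N" for k
      proof -
        have "1 / real (Suc k) \<le> 1 / real (Suc N)" using that by (intro divide_left_mono) auto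
        then show ?thesis using X(2)[of k] N by linarith
      qed
      have "(nrm (X i - X j))\<^sup>2 < e\<^sup>2"
        using para[OF X(1) X(1), of i j] *[OF that(1)] *[OF that(2)] by argo
      then show ?thesis using e by (simp add: power2_less_imp_less)
    qed
    then show "\<exists>N. \<forall>i\<ge>N. \<forall>j\<ge>N. nrm (X i - X j) < e" by blast
  qed
  then obtain z where z: "hlim X z" using hCauchy_imp_hlim by blast
  have zc: "z \<in> carr" using z by (simp add: hlim_def)
  have lim0: "(\<lambda>n. nrm (X n - z)) \<longlonglongrightarrow> 0" using z by (simp add: hlim_def)
  \<comment> \<open>This is \<open>F (X n)\<close> expanded around \<open>z\<close>, so that each
    summand has a limit known from \<open>hlim X z\<close>.\<close>
  have "(\<lambda>n. (nrm (X n - z))\<^sup>2 + 2 * Re (ip (X n) z) - (nrm z)\<^sup>2 - 2 * Re (\<phi> (X n)))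
      \<longlonglongrightarrow> 0\<^sup>2 + 2 * Re (ip z z) - (nrm z)\<^sup>2 - 2 * Re (\<phi> z)"
  proof (intro tendsto_intros lim0 hlim_ip z zc)
    show "(\<lambda>n. \<phi> (X n)) \<longlonglongrightarrow> \<phi> z"
    proof (rule LIM_zero_cancel, rule Lim_null_comparison)
      show "\<forall>\<^sub>F n in sequentially. cmod (\<phi> (X n) - \<phi> z) \<le> C * nrm (X n - z)"
        using bound[of "X _ - z"] X zc by (simp add: diff)
      show "(\<lambda>n. C * nrm (X n - z)) \<longlonglongrightarrow> 0" using lim0 by (rule tendsto_mult_right_zero)
    qed
  qed
  then have "(\<lambda>n. F (X n)) \<longlonglongrightarrow> F z"
    using X zc by (simp add: F_def nrm_diff_sq ip_self)
  moreover have "(\<lambda>n. m + 1 / real (Suc n)) \<longlonglongrightarrow> m + 0"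
    by (intro tendsto_add tendsto_const LIMSEQ_Suc lim_const_over_n)
  ultimately have "F z \<le> m + 0"
    by (rule LIMSEQ_le) (use X(2) less_imp_le in blast)
  then have Fz: "F z \<le> F x" if "x \<in> carr" for x using m_le[OF that] by simp
  have "\<phi> x = ip x z" if x: "x \<in> carr" for x
  proof -
    define w where "w = \<phi> x - ip x z"
    have "(cmod w)\<^sup>2 = 0"
    proof (rule quadratic_bound_imp_zero[where b = "(cmod w)\<^sup>2 * (nrm x)\<^sup>2"])
      fix s :: real assume "s > 0"
      \<comment> \<open>The factor \<open>cnj w\<close> aligns the phase: moving from
        \<open>z\<close> in the direction of \<open>x\<close> by \<open>c\<close> changes
        \<open>F\<close> to first order by \<open>-2 * s * (cmod w)^2\<close>.\<close>
      define c where "c = of_real s * cnj w"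
      define v where "v = hscale H (- c) x"
      have v: "v \<in> carr" using x by (simp add: v_def)
      have "F (z - v) = (nrm z)\<^sup>2 - 2 * Re (ip z v) + (nrm v)\<^sup>2 - 2 * Re (\<phi> z) + 2 * Re (\<phi> v)"
        using v zc by (simp add: F_def nrm_diff_sq diff)
      moreover have "Re (ip z v) = Re (ip v z)" using hinner_commute[of z v] v zc by simp
      moreover have "Re (\<phi> v) - Re (ip v z) = - Re (c * w)"
        using x zc by (simp add: v_def scale hinner_scale_left w_def algebra_simps neg
            del: scale_minus_left)
      moreover have "c * w = of_real (s * (cmod w)\<^sup>2)"
        using complex_norm_square[of w] by (simp add: c_def mult.commute mult.left_commute)
      moreover have "(nrm v)\<^sup>2 = s\<^sup>2 * ((cmod w)\<^sup>2 * (nrm x)\<^sup>2)"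
        using x by (simp add: v_def c_def nrm_scale norm_mult power_mult_distrib del: scale_minus_left)
      moreover have "F z \<le> F (z - v)" using v zc by (intro Fz) simp
      ultimately show "2 * s * (cmod w)\<^sup>2 \<le> s\<^sup>2 * ((cmod w)\<^sup>2 * (nrm x)\<^sup>2)"
        unfolding F_def by (simp del: of_real_power of_real_mult)
    qed auto
    then show ?thesis by (simp add: w_def)
  qed
  then show ?thesis using that zc by blast
qed

section \<open>Adjoints, isometries and agreement on total sets\<close>

lemma hadjoint_eqI:
  assumes "z \<in> carr" "\<And>x. x \<in> carr \<Longrightarrow> ip (A x) y = ip x z"
  shows "hadjoint H A y = z"
  unfolding hadjoint_def
proof (rule the_equality)
  show "z \<in> carr \<and> (\<forall>x\<in>carr. ip (A x) y = ip x z)" using assms by auto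
  fix z' assume "z' \<in> carr \<and> (\<forall>x\<in>carr. ip (A x) y = ip x z')"
  then show "z' = z" using assms by (intro ip_ext_right) auto
qed

context
  fixes A :: "'a \<Rightarrow> 'a"
  assumes A: "bounded_op H A"
begin

lemma hadjoint_ex: "y \<in> carr \<Longrightarrow> \<exists>z\<in>carr. \<forall>x\<in>carr. ip (A x) y = ip x z"
proof -
  assume y: "y \<in> carr"
  obtain C where C: "C \<ge> 0" "\<And>x. x \<in> carr \<Longrightarrow> nrm (A x) \<le> C * nrm x"
    using bounded_op_bound[OF A] by blast
  have "cmod (ip (A x) y) \<le> (C * nrm y) * nrm x" if "x \<in> carr" for x
  proof -
    have "cmod (ip (A x) y) \<le> nrm (A x) * nrm y"
      using cauchy_schwarz bounded_opD(1)[OF A] that y by blast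
    also have "\<dots> \<le> (C * nrm x) * nrm y" using C(2)[OF that] y by (intro mult_right_mono) auto
    finally show ?thesis by (simp add: mult.commute mult.left_commute)
  qed
  then show ?thesis
    using riesz_representation[of "\<lambda>x. ip (A x) y" "C * nrm y"] y bounded_opD[OF A]
    by (simp add: hinner_add_left hinner_scale_left) metis
qed

lemma hadjoint_carr [simp]: "y \<in> carr \<Longrightarrow> hadjoint H A y \<in> carr"
  using hadjoint_ex[of y] hadjoint_eqI[of _ A y] by metis

lemma ip_hadjoint: "\<lbrakk>x \<in> carr; y \<in> carr\<rbrakk> \<Longrightarrow> ip x (hadjoint H A y) = ip (A x) y"
  using hadjoint_ex[of y] hadjoint_eqI[of _ A y] by metis

lemma ip_hadjoint_left: "\<lbrakk>x \<in> carr; y \<in> carr\<rbrakk> \<Longrightarrow> ip (hadjoint H A y) x = ip y (A x)"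
  using ip_hadjoint[of x y] bounded_opD(1)[OF A, of x] hinner_commute[of "hadjoint H A y" x]
    hinner_commute[of y "A x"] by simp

lemma hadjoint_add:
  "\<lbrakk>x \<in> carr; y \<in> carr\<rbrakk> \<Longrightarrow> hadjoint H A (x + y) = hadjoint H A x + hadjoint H A y"
  by (rule hadjoint_eqI) (auto simp: ip_hadjoint ip_add_right bounded_opD[OF A])

lemma hadjoint_scale: "x \<in> carr \<Longrightarrow> hadjoint H A (hscale H c x) = hscale H c (hadjoint H A x)"
  by (rule hadjoint_eqI) (auto simp: ip_hadjoint ip_scale_right bounded_opD[OF A])

lemma nrm_hadjoint_le:
  assumes "C \<ge> 0" "\<And>x. x \<in> carr \<Longrightarrow> nrm (A x) \<le> C * nrm x" and y: "y \<in> carr"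
  shows "nrm (hadjoint H A y) \<le> C * nrm y"
proof -
  let ?z = "hadjoint H A y"
  have z: "?z \<in> carr" using y by simp
  have "complex_of_real ((nrm ?z)\<^sup>2) = ip (A ?z) y"
    using ip_hadjoint[OF z y] ip_self[OF z] by simp
  then have "(nrm ?z)\<^sup>2 = cmod (ip (A ?z) y)"
    by (metis abs_of_nonneg norm_of_real zero_le_power2)
  also have "\<dots> \<le> nrm (A ?z) * nrm y" using cauchy_schwarz bounded_opD(1)[OF A] z y by blast
  also have "\<dots> \<le> (C * nrm ?z) * nrm y" using assms z by (intro mult_right_mono) auto
  finally have "nrm ?z * nrm ?z \<le> nrm ?z * (C * nrm y)"
    by (simp add: power2_eq_square mult.commute mult.left_commute)
  then show ?thesis
    using nrm_ge_zero[OF z] assms y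
    by (cases "nrm ?z = 0") (auto simp: mult_le_cancel_left)
qed

lemma bounded_op_hadjoint: "bounded_op H (hadjoint H A)"
proof -
  obtain C where C: "C \<ge> 0" "\<And>x. x \<in> carr \<Longrightarrow> nrm (A x) \<le> C * nrm x"
    using bounded_op_bound[OF A] by blast
  have "\<forall>x\<in>carr. nrm (hadjoint H A x) \<le> C * nrm x" using nrm_hadjoint_le[OF C] by blast
  then show ?thesis
    unfolding bounded_op_def using hadjoint_add hadjoint_scale by auto
qed

end

lemma hadjoint_comp:
  assumes "bounded_op H A" "bounded_op H B" "y \<in> carr"
    and "\<And>x. x \<in> carr \<Longrightarrow> D x = A (B x)"
  shows "hadjoint H D y = hadjoint H B (hadjoint H A y)"
  using assms
  by (intro hadjoint_eqI) (auto simp: ip_hadjoint hadjoint_carr bounded_opD)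

lemma nrm_le_op_norm:
  assumes "bounded_op H A" "x \<in> carr"
  shows "nrm (A x) \<le> op_norm H A * nrm x"
proof (cases "x = 0")
  case True
  then show ?thesis using bounded_op_zero[OF assms(1)] by simp
next
  case False
  then have nx: "nrm x > 0" using nrm_eq_zero[OF assms(2)] nrm_ge_zero[OF assms(2)] by linarith
  obtain C where C: "C \<ge> 0" "\<And>x. x \<in> carr \<Longrightarrow> nrm (A x) \<le> C * nrm x"
    using bounded_op_bound[OF assms(1)] by blast
  \<comment> \<open>A real supremum is an upper bound only for a set bounded above, so boundedness
    of \<open>A\<close> enters here.\<close>
  have bdd: "bdd_above ((\<lambda>x. nrm (A x)) ` {x \<in> carr. nrm x \<le> 1})"
  proof (rule bdd_aboveI2)
    fix y assume "y \<in> {x \<in> carr. nrm x \<le> 1}"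
    then show "nrm (A y) \<le> C" using C(2)[of y] mult_left_mono[of "nrm y" 1 C] C(1) by simp
  qed
  define u where "u = hscale H (of_real (inverse (nrm x))) x"
  have "nrm (A u) \<le> op_norm H A"
    unfolding op_norm_def
    using assms nx by (intro cSUP_upper bdd) (simp add: u_def nrm_scale norm_inverse)
  moreover have "nrm (A u) = nrm (A x) / nrm x"
    using assms nx bounded_opD[OF assms(1)] by (simp add: u_def nrm_scale divide_inverse norm_inverse)
  ultimately show ?thesis using nx by (simp add: field_simps)
qed

text \<open>Polarisation is avoided. The vector \<open>z\<close> obtained by applying
  \<open>A\<close> and then its adjoint has norm at most that of \<open>x\<close>, and
  \<open>Re (ip z x)\<close> is the squared norm of \<open>x\<close>, so expanding the squared norm
  of \<open>z - x\<close> gives at most 0.\<close>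

lemma hadjoint_isometry:
  assumes A: "bounded_op H A" and iso: "\<And>x. x \<in> carr \<Longrightarrow> nrm (A x) = nrm x" and x: "x \<in> carr"
  shows "hadjoint H A (A x) = x"
proof -
  let ?z = "hadjoint H A (A x)"
  have Ax: "A x \<in> carr" using x bounded_opD(1)[OF A] by simp
  then have z: "?z \<in> carr" using A by simp
  have "nrm ?z \<le> 1 * nrm (A x)" using A iso Ax by (intro nrm_hadjoint_le) auto
  then have "(nrm ?z)\<^sup>2 \<le> (nrm x)\<^sup>2" using iso[OF x] z by (simp add: power_mono)
  moreover have "ip ?z x = ip (A x) (A x)" using ip_hadjoint_left[OF A x Ax] .
  then have "Re (ip ?z x) = (nrm x)\<^sup>2" using ip_self[OF Ax] iso[OF x]
    by (simp del: of_real_power)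
  ultimately have "(nrm (?z - x))\<^sup>2 \<le> 0" using nrm_diff_sq[OF z x] by simp
  then show ?thesis using z x nrm_eq_zero[of "?z - x"] by simp
qed

text \<open>A contraction with contractive inverse is isometric, since the norm of
  \<open>x = B (A x)\<close> is at most that of \<open>A x\<close>. Applied to \<open>T u\<close>
  with \<open>u\<close> invertible, this yields unitarity.\<close>

lemma hadjoint_eq_inverse:
  assumes A: "bounded_op H A" "\<And>x. x \<in> carr \<Longrightarrow> nrm (A x) \<le> nrm x"
    and B: "bounded_op H B" "\<And>x. x \<in> carr \<Longrightarrow> nrm (B x) \<le> nrm x"
    and BA: "\<And>x. x \<in> carr \<Longrightarrow> B (A x) = x" and AB: "\<And>x. x \<in> carr \<Longrightarrow> A (B x) = x"
    and y: "y \<in> carr"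
  shows "hadjoint H A y = B y"
proof -
  have "nrm (A x) = nrm x" if "x \<in> carr" for x
    using A(2)[OF that] B(2)[of "A x"] BA[OF that] bounded_opD(1)[OF A(1) that] by simp
  then show ?thesis
    using hadjoint_isometry[OF A(1), of "B y"] AB[OF y] bounded_opD(1)[OF B(1) y] by simp
qed

text \<open>The adjoints agree because their values can be tested against the total set
  \<open>S\<close>; no limit of approximating vectors has to be taken.\<close>

lemma bounded_op_dense_ext:
  assumes A: "bounded_op H A" and B: "bounded_op H B"
    and S: "S \<subseteq> carr" "M.mtopology closure_of span S = carr"
    and eq: "\<And>z. z \<in> S \<Longrightarrow> A z = B z" and x: "x \<in> carr"
  shows "A x = B x"
proof (rule ip_ext)
  fix y assume y: "y \<in> carr"
  have "hadjoint H A y = hadjoint H B y"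
    by (rule dense_ip_ext[OF S]) (use A B S y eq in \<open>auto simp: ip_hadjoint_left subset_iff\<close>)
  then show "ip (A x) y = ip (B x) y" using ip_hadjoint[OF A x y] ip_hadjoint[OF B x y] by simp
qed (use A B x in \<open>auto simp: bounded_opD\<close>)

end

section \<open>Orthogonal projection onto an embedded Hilbert space\<close>

lemma isometric_embeddingD:
  assumes "isometric_embedding H K J"
  shows "x \<in> hcarrier H \<Longrightarrow> J x \<in> hcarrier K"
    and "\<lbrakk>x \<in> hcarrier H; y \<in> hcarrier H\<rbrakk> \<Longrightarrow> J (x + y) = J x + J y"
    and "x \<in> hcarrier H \<Longrightarrow> J (hscale H c x) = hscale K c (J x)"
    and "\<lbrakk>x \<in> hcarrier H; y \<in> hcarrier H\<rbrakk> \<Longrightarrow> hinner K (J x) (J y) = hinner H x y"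
  using assms by (auto simp: isometric_embedding_def)

text \<open>Uniqueness is checked inside \<open>H\<close>: two candidates in the range of
  \<open>J\<close> pull back to vectors with the same inner products.\<close>

lemma orth_proj_embedding_eqI:
  assumes "inner_product_space H" "inner_product_space K" "isometric_embedding H K J"
    and v: "v \<in> hcarrier K" and z: "z \<in> hcarrier H"
    and eq: "\<And>h. h \<in> hcarrier H \<Longrightarrow> hinner K v (J h) = hinner H z h"
  shows "orth_proj K (J ` hcarrier H) v = J z"
  unfolding orth_proj_def
proof (rule the_equality)
  interpret H: inner_product_space H by fact
  interpret K: inner_product_space K by fact
  note J = isometric_embeddingD[OF assms(3)]
  show 1: "J z \<in> J ` hcarrier H \<and> (\<forall>m\<in>J ` hcarrier H. hinner K (v - J z) m = 0)"
    using z v J eq by (auto simp: K.ip_diff_left)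
  fix y assume y: "y \<in> J ` hcarrier H \<and> (\<forall>m\<in>J ` hcarrier H. hinner K (v - y) m = 0)"
  then obtain w where w: "w \<in> hcarrier H" "y = J w" by auto
  have "w = z"
  proof (rule H.ip_ext)
    fix h assume h: "h \<in> hcarrier H"
    have "hinner K (v - J w) (J h) = 0" using y w h by auto
    then show "hinner H w h = hinner H z h" using h w v J eq by (simp add: K.ip_diff_left)
  qed (use w z in auto)
  then show "y = J z" using w by simp
qed

text \<open>Existence of the projection comes from Riesz representation in \<open>H\<close> of the
  functional sending \<open>x\<close> to \<open>hinner K (J x) v\<close>; the representing vector is
  the adjoint of \<open>J\<close> applied to \<open>v\<close>.\<close>

lemma ip_orth_proj_embedding:
  assumes "hilbert_space H" "hilbert_space K" "isometric_embedding H K J"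
    and v: "v \<in> hcarrier K" and h: "h \<in> hcarrier H"
  shows "hinner K (orth_proj K (J ` hcarrier H) v) (J h) = hinner K v (J h)"
proof -
  interpret H: hilbert_space H by fact
  interpret K: hilbert_space K by fact
  note J = isometric_embeddingD[OF assms(3)]
  have nJ: "hnorm K (J x) = hnorm H x" if "x \<in> hcarrier H" for x
    using J(4)[OF that that] by (simp add: hnorm_def)
  obtain z where z: "z \<in> hcarrier H" "\<And>x. x \<in> hcarrier H \<Longrightarrow> hinner K (J x) v = hinner H x z"
  proof (rule H.riesz_representation[of "\<lambda>x. hinner K (J x) v" "hnorm K v"])
    show "cmod (hinner K (J x) v) \<le> hnorm K v * hnorm H x" if "x \<in> hcarrier H" for x
      using K.cauchy_schwarz[of "J x" v] J that v nJ by (simp add: mult.commute)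
  qed (use J v in \<open>auto simp: K.hinner_add_left K.hinner_scale_left\<close>)
  have eq: "hinner K v (J x) = hinner H z x" if "x \<in> hcarrier H" for x
    using z that v J K.hinner_commute[of v "J x"] H.hinner_commute[of z x] by simp
  have "orth_proj K (J ` hcarrier H) v = J z"
    using assms z eq
    by (intro orth_proj_embedding_eqI H.inner_product_space_axioms K.inner_product_space_axioms)
  then show ?thesis using eq[OF h] z h J by simp
qed


section \<open>Reproducing kernel Hilbert spaces\<close>

context inner_product_space
begin

lemma hCauchy_ip_convergent:
  assumes "hCauchy X" "hCauchy Y"
  shows "convergent (\<lambda>n. ip (X n) (Y n))"
proof -
  have X: "X n \<in> carr" and Y: "Y n \<in> carr" for n using assms by (auto simp: hCauchy_def)
  obtain B1 B2 where B12: "\<And>n. nrm (X n) \<le> B1" "\<And>n. nrm (Y n) \<le> B2"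
    using hCauchy_bounded[OF assms(1)] hCauchy_bounded[OF assms(2)] by metis
  define B where "B = max 1 (max B1 B2)"
  have B: "B > 0" "\<And>n. nrm (X n) \<le> B" "\<And>n. nrm (Y n) \<le> B"
    using B12 by (auto simp: B_def max.coboundedI1 max.coboundedI2)
  have "Cauchy (\<lambda>n. ip (X n) (Y n))"
  proof (rule metric_CauchyI)
    fix e :: real assume e: "e > 0"
    then have "e / (2 * B) > 0" using B by simp
    then obtain N1 N2 where N: "\<And>m n. m \<ge> N1 \<Longrightarrow> n \<ge> N1 \<Longrightarrow> nrm (X m - X n) < e / (2 * B)"
      "\<And>m n. m \<ge> N2 \<Longrightarrow> n \<ge> N2 \<Longrightarrow> nrm (Y m - Y n) < e / (2 * B)"
      using assms unfolding hCauchy_def by meson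
    have "dist (ip (X m) (Y m)) (ip (X n) (Y n)) < e"
      if m: "m \<ge> max N1 N2" and n: "n \<ge> max N1 N2" for m n
    proof -
      have "ip (X m) (Y m) - ip (X n) (Y n) = ip (X m - X n) (Y m) + ip (X n) (Y m - Y n)"
        using X Y by (simp add: ip_diff_left ip_diff_right)
      then have "dist (ip (X m) (Y m)) (ip (X n) (Y n))
          \<le> cmod (ip (X m - X n) (Y m)) + cmod (ip (X n) (Y m - Y n))"
        by (simp add: dist_norm norm_triangle_ineq)
      also have "\<dots> \<le> nrm (X m - X n) * nrm (Y m) + nrm (X n) * nrm (Y m - Y n)"
        using X Y by (intro add_mono cauchy_schwarz) auto
      also have "\<dots> \<le> nrm (X m - X n) * B + B * nrm (Y m - Y n)"
        using X Y B by (intro add_mono mult_left_mono mult_right_mono) auto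
      also have "\<dots> < (e / (2 * B)) * B + B * (e / (2 * B))"
        using N(1)[of m n] N(2)[of m n] m n B
        by (intro add_strict_mono mult_strict_left_mono mult_strict_right_mono) auto
      also have "\<dots> = e" using B by (simp add: field_simps)
      finally show ?thesis .
    qed
    then show "\<exists>M. \<forall>m\<ge>M. \<forall>n\<ge>M. dist (ip (X m) (Y m)) (ip (X n) (Y n)) < e" by blast
  qed
  then show ?thesis by (rule Cauchy_convergent)
qed

text \<open>Makes the inner product of the completion independent of the approximating
  sequences.\<close>

lemma hCauchy_ip_diff_null:
  assumes "hCauchy X" "hCauchy Y'" "range X' \<subseteq> carr" "range Y \<subseteq> carr"
    and "(\<lambda>n. nrm (X n - X' n)) \<longlonglongrightarrow> 0" "(\<lambda>n. nrm (Y n - Y' n)) \<longlonglongrightarrow> 0"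
  shows "(\<lambda>n. ip (X n) (Y n) - ip (X' n) (Y' n)) \<longlonglongrightarrow> 0"
proof -
  have c: "X n \<in> carr" "X' n \<in> carr" "Y n \<in> carr" "Y' n \<in> carr" for n
    using assms by (auto simp: hCauchy_def)
  obtain B1 B2 where B: "\<And>n. nrm (X n) \<le> B1" "\<And>n. nrm (Y' n) \<le> B2"
    using hCauchy_bounded[OF assms(1)] hCauchy_bounded[OF assms(2)] by metis
  show ?thesis
  proof (rule Lim_null_comparison)
    have "cmod (ip (X n) (Y n) - ip (X' n) (Y' n))
        \<le> B1 * nrm (Y n - Y' n) + nrm (X n - X' n) * B2" for n
    proof -
      have "ip (X n) (Y n) - ip (X' n) (Y' n) = ip (X n) (Y n - Y' n) + ip (X n - X' n) (Y' n)"
        using c by (simp add: ip_diff_left ip_diff_right)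
      then have "cmod (ip (X n) (Y n) - ip (X' n) (Y' n))
          \<le> cmod (ip (X n) (Y n - Y' n)) + cmod (ip (X n - X' n) (Y' n))"
        by (simp add: norm_triangle_ineq)
      also have "\<dots> \<le> nrm (X n) * nrm (Y n - Y' n) + nrm (X n - X' n) * nrm (Y' n)"
        using c by (intro add_mono cauchy_schwarz) auto
      also have "\<dots> \<le> B1 * nrm (Y n - Y' n) + nrm (X n - X' n) * B2"
        using c B by (intro add_mono mult_left_mono mult_right_mono) auto
      finally show ?thesis .
    qed
    then show "\<forall>\<^sub>F n in sequentially. cmod (ip (X n) (Y n) - ip (X' n) (Y' n))
        \<le> B1 * nrm (Y n - Y' n) + nrm (X n - X' n) * B2" by simp
    show "(\<lambda>n. B1 * nrm (Y n - Y' n) + nrm (X n - X' n) * B2) \<longlonglongrightarrow> 0"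
      using assms by (auto intro!: tendsto_add_zero tendsto_mult_right_zero tendsto_mult_left_zero)
  qed
qed

end

locale positive_kernel = hilbert_space H
  for H :: "'a::ab_group_add hspace" +
  fixes \<kappa> :: "'p \<Rightarrow> 'p \<Rightarrow> 'a \<Rightarrow> 'a"
  assumes kernel_bounded: "bounded_op H (\<kappa> p q)"
    and kernel_hermitian: "\<lbrakk>x \<in> hcarrier H; y \<in> hcarrier H\<rbrakk>
      \<Longrightarrow> hinner H (\<kappa> p q x) y = hinner H x (\<kappa> q p y)"
    and kernel_positive: "\<lbrakk>finite A; \<And>p. f p \<in> hcarrier H\<rbrakk>
      \<Longrightarrow> 0 \<le> (\<Sum>p\<in>A. \<Sum>q\<in>A. hinner H (\<kappa> p q (f q)) (f p))"
begin

section \<open>The pre-Hilbert space of finite kernel combinations\<close>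

lemmas kernel_carr = bounded_opD(1)[OF kernel_bounded]
lemmas kernel_add = bounded_opD(2)[OF kernel_bounded]
lemmas kernel_scale = bounded_opD(3)[OF kernel_bounded]

text \<open>The section of the kernel at \<open>p\<close> in direction \<open>h\<close>. In the
  dilation it plays the role of \<open>V(p)h\<close>.\<close>

definition kvec :: "'p \<Rightarrow> 'a \<Rightarrow> 'p \<Rightarrow> 'a" where
  "kvec p h = (\<lambda>r. \<kappa> r p h)"

definition kcomb :: "'p set \<Rightarrow> ('p \<Rightarrow> 'a) \<Rightarrow> 'p \<Rightarrow> 'a" where
  "kcomb A x = (\<Sum>p\<in>A. kvec p (x p))"

definition fscale :: "complex \<Rightarrow> ('p \<Rightarrow> 'a) \<Rightarrow> 'p \<Rightarrow> 'a" where
  "fscale c f = (\<lambda>r. hscale H c (f r))"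

definition is_kcomb :: "('p \<Rightarrow> 'a) \<Rightarrow> 'p set \<times> ('p \<Rightarrow> 'a) \<Rightarrow> bool" where
  "is_kcomb f Ax \<longleftrightarrow> finite (fst Ax) \<and> (\<forall>p. snd Ax p \<in> carr) \<and> f = kcomb (fst Ax) (snd Ax)"

text \<open>The first argument enters only through its values, which makes linearity in it
  immediate. Only the second is represented as a combination, and the choice of representation turns
  out to be immaterial.\<close>

definition pre_ip :: "('p \<Rightarrow> 'a) \<Rightarrow> ('p \<Rightarrow> 'a) \<Rightarrow> complex" where
  "pre_ip f g = (let By = SOME By. is_kcomb g By in \<Sum>q\<in>fst By. ip (f q) (snd By q))"

definition pre_rkhs :: "('p \<Rightarrow> 'a) hspace" where
  "pre_rkhs = \<lparr>hcarrier = {f. \<exists>Ax. is_kcomb f Ax}, hscale = fscale, hinner = pre_ip\<rparr>"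

lemma pre_rkhs_simps [simp]:
  "hscale pre_rkhs = fscale" "hinner pre_rkhs = pre_ip"
  by (simp_all add: pre_rkhs_def)

lemma fscale_apply: "fscale c f r = hscale H c (f r)"
  by (simp add: fscale_def)

lemma sum_fun_apply: "(\<Sum>i\<in>I. f i) r = (\<Sum>i\<in>I. f i r)" for f :: "'i \<Rightarrow> 'p \<Rightarrow> 'a"
  by (induction I rule: infinite_finite_induct) auto

lemma kcomb_apply: "kcomb A x r = (\<Sum>p\<in>A. \<kappa> r p (x p))"
  by (simp add: kcomb_def sum_fun_apply kvec_def)

lemma pre_rkhsE:
  assumes "f \<in> hcarrier pre_rkhs"
  obtains A x where "finite A" "\<And>p. x p \<in> carr" "f = kcomb A x"
  using assms by (auto simp: pre_rkhs_def is_kcomb_def)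

lemma kcomb_pre_rkhs [simp]:
  "finite A \<Longrightarrow> (\<And>p. x p \<in> carr) \<Longrightarrow> kcomb A x \<in> hcarrier pre_rkhs"
  by (auto simp: pre_rkhs_def is_kcomb_def intro!: exI[of _ "(A, x)"])

lemma kvec_pre_rkhs [simp]: "h \<in> carr \<Longrightarrow> kvec p h \<in> hcarrier pre_rkhs"
  using kcomb_pre_rkhs[of "{p}" "\<lambda>_. h"] by (simp add: kcomb_def)

lemma pre_rkhs_eval [simp]: "f \<in> hcarrier pre_rkhs \<Longrightarrow> f p \<in> carr"
  by (elim pre_rkhsE) (simp add: kcomb_apply kernel_carr)

text \<open>One side uses the left combination only as a function, the other side the right one. By
  Hermitian symmetry they agree, so the form depends on neither representation.\<close>

lemma pre_ip_kcomb_swap: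
  assumes "finite A" "\<And>p. x p \<in> carr" "finite B" "\<And>p. y p \<in> carr"
  shows "(\<Sum>q\<in>B. ip (kcomb A x q) (y q)) = (\<Sum>p\<in>A. ip (x p) (kcomb B y p))"
proof -
  have "(\<Sum>q\<in>B. ip (kcomb A x q) (y q)) = (\<Sum>q\<in>B. \<Sum>p\<in>A. ip (x p) (\<kappa> p q (y q)))"
    using assms by (simp add: kcomb_apply ip_sum_left kernel_carr kernel_hermitian)
  also have "\<dots> = (\<Sum>p\<in>A. \<Sum>q\<in>B. ip (x p) (\<kappa> p q (y q)))" by (rule sum.swap)
  also have "\<dots> = (\<Sum>p\<in>A. ip (x p) (kcomb B y p))"
    using assms by (simp add: kcomb_apply ip_sum_right kernel_carr)
  finally show ?thesis .
qed

lemma pre_ip_kcomb: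
  assumes f: "f \<in> hcarrier pre_rkhs" and B: "finite B" "\<And>p. y p \<in> carr"
  shows "pre_ip f (kcomb B y) = (\<Sum>q\<in>B. ip (f q) (y q))"
proof -
  obtain A x where A: "finite A" "\<And>p. x p \<in> carr" "f = kcomb A x"
    using f by (rule pre_rkhsE) blast
  have "is_kcomb (kcomb B y) (B, y)" using B by (simp add: is_kcomb_def)
  then have "is_kcomb (kcomb B y) (SOME By. is_kcomb (kcomb B y) By)" by (rule someI)
  moreover obtain C z where Cz: "(SOME By. is_kcomb (kcomb B y) By) = (C, z)"
    by (metis prod.collapse)
  ultimately have C: "finite C" "\<And>p. z p \<in> carr" "kcomb B y = kcomb C z"
    by (simp_all add: is_kcomb_def)
  have "pre_ip f (kcomb B y) = (\<Sum>q\<in>C. ip (f q) (z q))"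
    by (simp add: pre_ip_def Cz)
  also have "\<dots> = (\<Sum>p\<in>A. ip (x p) (kcomb B y p))"
    unfolding A(3) C(3) by (rule pre_ip_kcomb_swap[OF A(1,2) C(1,2)])
  also have "\<dots> = (\<Sum>q\<in>B. ip (f q) (y q))"
    unfolding A(3) by (rule pre_ip_kcomb_swap[OF A(1,2) B, symmetric])
  finally show ?thesis .
qed

lemma pre_ip_kvec: "\<lbrakk>f \<in> hcarrier pre_rkhs; h \<in> carr\<rbrakk> \<Longrightarrow> pre_ip f (kvec p h) = ip (f p) h"
  using pre_ip_kcomb[of f "{p}" "\<lambda>_. h"] by (simp add: kcomb_def)

lemma kcomb_extend:
  assumes "A \<subseteq> B" "finite B"
  shows "kcomb A x = kcomb B (\<lambda>p. if p \<in> A then x p else 0)"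
proof -
  have "kvec p 0 = 0" for p
    by (auto simp: kvec_def zero_fun_def bounded_op_zero[OF kernel_bounded])
  then show ?thesis
    using assms by (auto simp: kcomb_def intro!: sum.mono_neutral_cong_left)
qed

lemma fscale_vector_space: "vector_space fscale"
  by unfold_locales
    (simp_all add: fscale_def fun_eq_iff scale_right_distrib scale_left_distrib)

lemma kvec_add: "\<lbrakk>x \<in> carr; y \<in> carr\<rbrakk> \<Longrightarrow> kvec p (x + y) = kvec p x + kvec p y"
  by (auto simp: kvec_def kernel_add)

lemma kvec_scale: "x \<in> carr \<Longrightarrow> kvec p (hscale H c x) = fscale c (kvec p x)"
  by (auto simp: kvec_def fscale_def kernel_scale)

lemma pre_rkhs_add:
  assumes "f \<in> hcarrier pre_rkhs" "g \<in> hcarrier pre_rkhs"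
  shows "f + g \<in> hcarrier pre_rkhs"
proof -
  obtain A x where A: "finite A" "\<And>p. x p \<in> carr" "f = kcomb A x"
    using assms(1) by (rule pre_rkhsE) blast
  obtain B y where B: "finite B" "\<And>p. y p \<in> carr" "g = kcomb B y"
    using assms(2) by (rule pre_rkhsE) blast
  define x' y' where "x' = (\<lambda>p. if p \<in> A then x p else 0)"
    and "y' = (\<lambda>p. if p \<in> B then y p else 0)"
  have "f = kcomb (A \<union> B) x'" "g = kcomb (A \<union> B) y'"
    using A B kcomb_extend[of A "A \<union> B" x] kcomb_extend[of B "A \<union> B" y]
    by (auto simp: x'_def y'_def)
  moreover have "x' p \<in> carr" "y' p \<in> carr" for p using A B by (auto simp: x'_def y'_def)
  ultimately have "f + g = kcomb (A \<union> B) (\<lambda>p. x' p + y' p)"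
    by (simp add: kcomb_def kvec_add sum.distrib)
  then show ?thesis using A B \<open>\<And>p. x' p \<in> carr\<close> \<open>\<And>p. y' p \<in> carr\<close> by simp
qed

lemma pre_rkhs_scale:
  assumes "f \<in> hcarrier pre_rkhs"
  shows "fscale c f \<in> hcarrier pre_rkhs"
proof -
  interpret F: vector_space fscale by (rule fscale_vector_space)
  obtain A x where A: "finite A" "\<And>p. x p \<in> carr" "f = kcomb A x"
    using assms by (rule pre_rkhsE) blast
  have "fscale c f = kcomb A (\<lambda>p. hscale H c (x p))"
    using A by (simp add: kcomb_def kvec_scale F.scale_sum_right)
  then show ?thesis using A by simp
qed

lemma pre_ip_commute:
  assumes "f \<in> hcarrier pre_rkhs" "g \<in> hcarrier pre_rkhs"
  shows "pre_ip f g = cnj (pre_ip g f)"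
proof -
  obtain A x where A: "finite A" "\<And>p. x p \<in> carr" "f = kcomb A x"
    using assms(1) by (rule pre_rkhsE) blast
  obtain B y where B: "finite B" "\<And>p. y p \<in> carr" "g = kcomb B y"
    using assms(2) by (rule pre_rkhsE) blast
  have "pre_ip f g = (\<Sum>p\<in>A. ip (x p) (g p))"
    using pre_ip_kcomb[OF assms(1) B(1,2)] pre_ip_kcomb_swap[OF A(1,2) B(1,2)] A B by simp
  also have "\<dots> = cnj (\<Sum>p\<in>A. ip (g p) (x p))"
    unfolding cnj_sum using A(2) assms by (intro sum.cong refl hinner_commute) auto
  also have "(\<Sum>p\<in>A. ip (g p) (x p)) = pre_ip g f"
    using pre_ip_kcomb[OF assms(2) A(1,2)] A by simp
  finally show ?thesis .
qed

lemma pre_ip_add_left: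
  "\<lbrakk>f \<in> hcarrier pre_rkhs; g \<in> hcarrier pre_rkhs; k \<in> hcarrier pre_rkhs\<rbrakk>
    \<Longrightarrow> pre_ip (f + g) k = pre_ip f k + pre_ip g k"
  by (elim pre_rkhsE[of k])
    (simp add: pre_ip_kcomb pre_rkhs_add hinner_add_left sum.distrib)

lemma pre_ip_scale_left:
  "\<lbrakk>f \<in> hcarrier pre_rkhs; k \<in> hcarrier pre_rkhs\<rbrakk> \<Longrightarrow> pre_ip (fscale c f) k = c * pre_ip f k"
  by (elim pre_rkhsE[of k])
    (simp add: pre_ip_kcomb pre_rkhs_scale hinner_scale_left sum_distrib_left fscale_apply)

lemma pre_ip_ge_zero:
  assumes "f \<in> hcarrier pre_rkhs"
  shows "0 \<le> pre_ip f f"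
proof -
  obtain A x where A: "finite A" "\<And>p. x p \<in> carr" "f = kcomb A x"
    using assms by (rule pre_rkhsE) blast
  then have "pre_ip f f = (\<Sum>p\<in>A. \<Sum>q\<in>A. ip (\<kappa> p q (x q)) (x p))"
    by (simp add: pre_ip_kcomb kcomb_apply ip_sum_left kernel_carr)
  then show ?thesis using kernel_positive[of A x] A by simp
qed

text \<open>Expanding \<open>0 \<le> \<langle>f - s k, f - s k\<rangle>\<close> for small \<open>s\<close> avoids the Cauchy-Schwarz inequality, which
  is only available once the form is known to be definite.\<close>

lemma pre_ip_eq_zero:
  assumes f: "f \<in> hcarrier pre_rkhs" and 0: "pre_ip f f = 0"
  shows "f = 0"
proof
  fix p
  \<comment> \<open>Testing against this vector returns the squared norm of \<open>f p\<close>, by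
    the reproducing property.\<close>
  define k where "k = kvec p (f p)"
  have k: "k \<in> hcarrier pre_rkhs" using f by (simp add: k_def)
  have fk: "pre_ip f k = of_real ((nrm (f p))\<^sup>2)" using f by (simp add: k_def pre_ip_kvec ip_self)
  have kf: "pre_ip k f = of_real ((nrm (f p))\<^sup>2)" using pre_ip_commute[OF k f] fk by simp
  have "(nrm (f p))\<^sup>2 = 0"
  proof (rule quadratic_bound_imp_zero[where b = "Re (pre_ip k k)"])
    show "0 \<le> Re (pre_ip k k)" using pre_ip_ge_zero[OF k] by (simp add: less_eq_complex_def)
    fix s :: real assume "s > 0"
    define c where "c = - complex_of_real s"
    have ck: "fscale c k \<in> hcarrier pre_rkhs" using k by (rule pre_rkhs_scale)
    have right: "pre_ip g (f + fscale c k) = pre_ip g f + c * pre_ip g k"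
      if g: "g \<in> hcarrier pre_rkhs" for g
      using pre_ip_commute[OF g pre_rkhs_add[OF f ck]] pre_ip_commute[OF g f] pre_ip_commute[OF g k]
      by (simp add: pre_ip_add_left[OF f ck g] pre_ip_scale_left[OF k g]) (simp add: c_def)
    have "pre_ip (f + fscale c k) (f + fscale c k)
        = of_real (- 2 * s * (nrm (f p))\<^sup>2) + of_real (s\<^sup>2) * pre_ip k k"
    proof -
      have "pre_ip (f + fscale c k) f = c * pre_ip k f"
        by (simp add: pre_ip_add_left[OF f ck f] pre_ip_scale_left[OF k f] 0)
      moreover have "pre_ip (f + fscale c k) k = pre_ip f k + c * pre_ip k k"
        by (simp add: pre_ip_add_left[OF f ck k] pre_ip_scale_left[OF k k])
      ultimately have "pre_ip (f + fscale c k) (f + fscale c k)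
          = c * pre_ip k f + c * (pre_ip f k + c * pre_ip k k)"
        using right[OF pre_rkhs_add[OF f ck]] by simp
      then show ?thesis by (simp add: fk kf c_def algebra_simps power2_eq_square)
    qed
    then have "0 \<le> Re (of_real (- 2 * s * (nrm (f p))\<^sup>2) + of_real (s\<^sup>2) * pre_ip k k)"
      using pre_ip_ge_zero[OF pre_rkhs_add[OF f ck]] by (simp add: less_eq_complex_def)
    then show "2 * s * (nrm (f p))\<^sup>2 \<le> s\<^sup>2 * Re (pre_ip k k)"
      by (simp del: of_real_mult of_real_power)
  qed simp
  then show "f p = 0 p" using f nrm_eq_zero[of "f p"] by simp
qed

lemma kcomb_empty: "kcomb {} x = 0"
  by (simp add: kcomb_def)

sublocale E: inner_product_space pre_rkhs
proof (rule inner_product_space.intro)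
  show "vector_space (hscale pre_rkhs)" using fscale_vector_space by simp
  interpret F: vector_space fscale by (rule fscale_vector_space)
  have "0 \<in> hcarrier pre_rkhs" using kcomb_pre_rkhs[of "{}" "\<lambda>_. 0"] by (simp add: kcomb_empty)
  then have "F.subspace (hcarrier pre_rkhs)"
    using pre_rkhs_add pre_rkhs_scale by (simp add: F.subspace_def)
  then show "inner_product_space_axioms pre_rkhs"
    by (intro inner_product_space_axioms.intro)
      (simp_all add: pre_ip_commute[symmetric] pre_ip_add_left pre_ip_scale_left
        pre_ip_ge_zero pre_ip_eq_zero)
qed

text \<open>By the reproducing property the squared norm of \<open>f p\<close> is the inner product
  of \<open>f\<close> with \<open>kvec p (f p)\<close>, and the squared norm of
  \<open>kvec p h\<close> is \<open>ip (\<kappa> p p h) h\<close>, at most \<open>C\<close> times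
  that of \<open>h\<close>. Hence the constant \<open>sqrt C\<close>. Norm-Cauchy sequences
  therefore converge pointwise.\<close>

lemma eval_bounded:
  assumes "inner_product_space L"
    and L: "\<And>f. f \<in> hcarrier L \<Longrightarrow> f p \<in> carr" "\<And>h. h \<in> carr \<Longrightarrow> kvec p h \<in> hcarrier L"
      "\<And>f h. \<lbrakk>f \<in> hcarrier L; h \<in> carr\<rbrakk> \<Longrightarrow> hinner L f (kvec p h) = ip (f p) h"
  obtains C where "\<And>f. f \<in> hcarrier L \<Longrightarrow> nrm (f p) \<le> C * hnorm L f"
proof -
  interpret L: inner_product_space L by fact
  obtain C where C: "C \<ge> 0" "\<And>x. x \<in> carr \<Longrightarrow> nrm (\<kappa> p p x) \<le> C * nrm x"
    using bounded_op_bound[OF kernel_bounded] by blast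
  have kv: "hnorm L (kvec p h) \<le> sqrt C * nrm h" if h: "h \<in> carr" for h
  proof -
    have "complex_of_real ((hnorm L (kvec p h))\<^sup>2) = ip (\<kappa> p p h) h"
      using L.ip_self[OF L(2)[OF h]] L(3)[OF L(2)[OF h] h] by (simp add: kvec_def)
    then have "(hnorm L (kvec p h))\<^sup>2 = cmod (ip (\<kappa> p p h) h)"
      by (metis abs_of_nonneg norm_of_real zero_le_power2)
    also have "\<dots> \<le> nrm (\<kappa> p p h) * nrm h" using h by (intro cauchy_schwarz kernel_carr)
    also have "\<dots> \<le> (C * nrm h) * nrm h" using C(2)[OF h] h by (intro mult_right_mono) auto
    also have "\<dots> = (sqrt C * nrm h)\<^sup>2" using C by (simp add: power_mult_distrib power2_eq_square)
    finally show ?thesis using h C L(2)[OF h] by (simp add: power2_le_iff_abs_le)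
  qed
  show ?thesis
  proof (rule that[of "sqrt C"])
    fix f assume f: "f \<in> hcarrier L"
    have "complex_of_real ((nrm (f p))\<^sup>2) = hinner L f (kvec p (f p))"
      using L(3)[OF f L(1)[OF f]] ip_self[OF L(1)[OF f]] by simp
    then have "(nrm (f p))\<^sup>2 = cmod (hinner L f (kvec p (f p)))"
      by (metis abs_of_nonneg norm_of_real zero_le_power2)
    also have "\<dots> \<le> hnorm L f * hnorm L (kvec p (f p))"
      using f L(1,2) by (intro L.cauchy_schwarz) auto
    also have "\<dots> \<le> hnorm L f * (sqrt C * nrm (f p))"
      using f kv[OF L(1)[OF f]] by (intro mult_left_mono) auto
    finally have "nrm (f p) * nrm (f p) \<le> nrm (f p) * (sqrt C * hnorm L f)"
      by (simp add: power2_eq_square mult.commute mult.left_commute)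
    then show "nrm (f p) \<le> sqrt C * hnorm L f"
      using nrm_ge_zero[OF L(1)[OF f]] C f
      by (cases "nrm (f p) = 0") (auto simp: mult_le_cancel_left)
  qed
qed

text \<open>The completion is realised inside the function space, a Cauchy sequence of kernel combinations
  being identified with its pointwise limit.\<close>

definition approx :: "(nat \<Rightarrow> 'p \<Rightarrow> 'a) \<Rightarrow> ('p \<Rightarrow> 'a) \<Rightarrow> bool" where
  "approx X f \<longleftrightarrow> E.hCauchy X \<and> (\<forall>p. hlim (\<lambda>n. X n p) (f p))"

definition rkhs_ip :: "('p \<Rightarrow> 'a) \<Rightarrow> ('p \<Rightarrow> 'a) \<Rightarrow> complex" where
  "rkhs_ip f g = lim (\<lambda>n. pre_ip ((SOME X. approx X f) n) ((SOME Y. approx Y g) n))"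

definition rkhs :: "('p \<Rightarrow> 'a) hspace" where
  "rkhs = \<lparr>hcarrier = {f. \<exists>X. approx X f}, hscale = fscale, hinner = rkhs_ip\<rparr>"

lemma rkhs_simps [simp]: "hscale rkhs = fscale" "hinner rkhs = rkhs_ip"
  by (simp_all add: rkhs_def)

lemma mem_rkhs: "f \<in> hcarrier rkhs \<longleftrightarrow> (\<exists>X. approx X f)"
  by (simp add: rkhs_def)

lemma approx_carr: "approx X f \<Longrightarrow> X n \<in> hcarrier pre_rkhs"
  by (auto simp: approx_def E.hCauchy_def)

lemma approx_add: "\<lbrakk>approx X f; approx Y g\<rbrakk> \<Longrightarrow> approx (\<lambda>n. X n + Y n) (f + g)"
  by (simp add: approx_def E.hCauchy_add hlim_add)

lemma approx_scale: "approx X f \<Longrightarrow> approx (\<lambda>n. fscale c (X n)) (fscale c f)"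
  using E.hCauchy_scale[of X c] by (simp add: approx_def fscale_def hlim_scale)

lemma fscale_minus_one: "fscale (- 1) f = - f"
  by (simp add: fscale_def fun_eq_iff)

lemma approx_diff: "\<lbrakk>approx X f; approx Y g\<rbrakk> \<Longrightarrow> approx (\<lambda>n. X n - Y n) (f - g)"
  using approx_add[of X f "\<lambda>n. fscale (- 1) (Y n)" "fscale (- 1) g"] approx_scale[of Y g "- 1"]
  by (simp add: fscale_minus_one)

lemma approx_const: "f \<in> hcarrier pre_rkhs \<Longrightarrow> approx (\<lambda>n. f) f"
  using E.hlim_imp_hCauchy[of "\<lambda>n. f" f] by (simp add: approx_def)

text \<open>This is what permits identifying a Cauchy sequence with its pointwise limit. The squared
  norm of \<open>X n\<close> splits into its inner products with \<open>X n - X N\<close> and with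
  \<open>X N\<close>. The first is small by the Cauchy property; the second tends to 0 because
  \<open>X N\<close> is a finite combination and sees only finitely many values of
  \<open>X n\<close>.\<close>

lemma approx_null:
  assumes "approx X 0"
  shows "(\<lambda>n. E.nrm (X n)) \<longlonglongrightarrow> 0"
proof -
  have Xc: "X n \<in> hcarrier pre_rkhs" for n using assms by (rule approx_carr)
  have X: "E.hCauchy X" using assms by (simp add: approx_def)
  obtain B0 where B0: "\<And>n. E.nrm (X n) \<le> B0" using E.hCauchy_bounded[OF X] by blast
  define B where "B = max 1 B0"
  have B: "B > 0" "\<And>n. E.nrm (X n) \<le> B" using B0 by (auto simp: B_def max.coboundedI2)
  have "(\<lambda>n. (E.nrm (X n))\<^sup>2) \<longlonglongrightarrow> 0"
  proof (rule LIMSEQ_I)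
    fix e :: real assume e: "e > 0"
    obtain N where N: "\<And>m n. m \<ge> N \<Longrightarrow> n \<ge> N \<Longrightarrow> E.nrm (X m - X n) < e / (2 * B)"
      using X e B unfolding E.hCauchy_def by (metis divide_pos_pos mult_pos_pos zero_less_numeral)
    obtain A x where A: "finite A" "\<And>p. x p \<in> carr" "X N = kcomb A x"
      using Xc by (rule pre_rkhsE) blast
    have "(\<lambda>n. \<Sum>q\<in>A. ip (X n q) (x q)) \<longlonglongrightarrow> (\<Sum>q\<in>A. ip (0 q) (x q))"
      using assms A by (intro tendsto_sum hlim_ip) (auto simp: approx_def)
    then have "(\<lambda>n. pre_ip (X n) (X N)) \<longlonglongrightarrow> 0"
      using A Xc by (simp add: pre_ip_kcomb)
    then obtain M where M: "\<And>n. n \<ge> M \<Longrightarrow> cmod (pre_ip (X n) (X N)) < e / 2"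
      using LIMSEQ_D[of "\<lambda>n. pre_ip (X n) (X N)" 0 "e / 2"] e by auto
    have "norm ((E.nrm (X n))\<^sup>2 - 0) < e" if n: "n \<ge> max M N" for n
    proof -
      have "complex_of_real ((E.nrm (X n))\<^sup>2) = pre_ip (X n) (X n - X N) + pre_ip (X n) (X N)"
        using E.ip_self[OF Xc[of n]] E.ip_diff_right[OF Xc Xc Xc, of n n N] by simp
      then have "(E.nrm (X n))\<^sup>2 = cmod (pre_ip (X n) (X n - X N) + pre_ip (X n) (X N))"
        by (metis abs_of_nonneg norm_of_real zero_le_power2)
      also have "\<dots> \<le> cmod (pre_ip (X n) (X n - X N)) + cmod (pre_ip (X n) (X N))"
        by (rule norm_triangle_ineq)
      also have "cmod (pre_ip (X n) (X n - X N)) \<le> E.nrm (X n) * E.nrm (X n - X N)"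
        using E.cauchy_schwarz[of "X n" "X n - X N"] Xc by simp
      also have "\<dots> \<le> B * (e / (2 * B))"
        using B N[of n N] n Xc by (intro mult_mono) (auto intro: less_imp_le)
      also have "\<dots> = e / 2" using B by simp
      finally show ?thesis using M[of n] n by simp
    qed
    then show "\<exists>no. \<forall>n\<ge>no. norm ((E.nrm (X n))\<^sup>2 - 0) < e" by blast
  qed
  then have "(\<lambda>n. sqrt ((E.nrm (X n))\<^sup>2)) \<longlonglongrightarrow> sqrt 0" by (rule tendsto_real_sqrt)
  then show ?thesis using Xc by simp
qed

lemma approx_ip:
  assumes X: "approx X f" and Y: "approx Y g"
  shows "(\<lambda>n. pre_ip (X n) (Y n)) \<longlonglongrightarrow> rkhs_ip f g"
proof -
  let ?X = "SOME X. approx X f" and ?Y = "SOME Y. approx Y g"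
  have X': "approx ?X f" by (rule someI[of "\<lambda>X. approx X f", OF X])
  have Y': "approx ?Y g" by (rule someI[of "\<lambda>Y. approx Y g", OF Y])
  have "(\<lambda>n. pre_ip (?X n) (?Y n)) \<longlonglongrightarrow> rkhs_ip f g"
    using E.hCauchy_ip_convergent[of ?X ?Y] X' Y'
    by (simp add: approx_def rkhs_ip_def convergent_LIMSEQ_iff)
  moreover have "(\<lambda>n. pre_ip (X n) (Y n) - pre_ip (?X n) (?Y n)) \<longlonglongrightarrow> 0"
    using E.hCauchy_ip_diff_null[of X ?Y ?X Y] X Y X' Y' approx_carr
      approx_null[of "\<lambda>n. X n - ?X n"] approx_null[of "\<lambda>n. Y n - ?Y n"]
      approx_diff[OF X X'] approx_diff[OF Y Y']
    by (auto simp: approx_def)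
  ultimately show ?thesis using tendsto_add by fastforce
qed

lemma pre_rkhs_subset: "f \<in> hcarrier pre_rkhs \<Longrightarrow> f \<in> hcarrier rkhs"
  using approx_const mem_rkhs by blast

lemma rkhs_ip_pre: "\<lbrakk>f \<in> hcarrier pre_rkhs; g \<in> hcarrier pre_rkhs\<rbrakk> \<Longrightarrow> rkhs_ip f g = pre_ip f g"
  using approx_ip[OF approx_const approx_const, of f g] LIMSEQ_unique by blast

lemma kvec_rkhs [simp]: "h \<in> carr \<Longrightarrow> kvec p h \<in> hcarrier rkhs"
  by (simp add: pre_rkhs_subset)

lemma rkhs_eval [simp]: "f \<in> hcarrier rkhs \<Longrightarrow> f p \<in> carr"
  by (auto simp: mem_rkhs approx_def hlim_def)

theorem rkhs_reproducing:
  assumes f: "f \<in> hcarrier rkhs" and h: "h \<in> carr"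
  shows "rkhs_ip f (kvec p h) = ip (f p) h"
proof -
  obtain X where X: "approx X f" using f mem_rkhs by blast
  have "(\<lambda>n. pre_ip (X n) (kvec p h)) \<longlonglongrightarrow> rkhs_ip f (kvec p h)"
    using approx_ip[OF X approx_const] h by simp
  moreover have "(\<lambda>n. ip (X n p) h) \<longlonglongrightarrow> ip (f p) h"
    using X h by (intro hlim_ip) (auto simp: approx_def)
  ultimately show ?thesis
    using approx_carr[OF X] h LIMSEQ_unique by (simp add: pre_ip_kvec)
qed

text \<open>The approximants tend to 0 in norm, and bounded point evaluation then forces their
  pointwise limit to vanish.\<close>

lemma rkhs_ip_eq_zero:
  assumes f: "f \<in> hcarrier rkhs" and 0: "rkhs_ip f f = 0"
  shows "f = 0"
proof
  fix p
  obtain X where X: "approx X f" using f mem_rkhs by blast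
  note Xc = approx_carr[OF X]
  obtain C where C: "\<And>f. f \<in> hcarrier pre_rkhs \<Longrightarrow> nrm (f p) \<le> C * E.nrm f"
    using eval_bounded[OF E.inner_product_space_axioms, of p] by (auto simp: pre_ip_kvec)
  have "(\<lambda>n. cmod (pre_ip (X n) (X n))) \<longlonglongrightarrow> cmod 0"
    using approx_ip[OF X X] 0 by (intro tendsto_norm) simp
  then have "(\<lambda>n. (E.nrm (X n))\<^sup>2) \<longlonglongrightarrow> 0"
    using E.ip_self[OF Xc] by (simp add: norm_power)
  then have "(\<lambda>n. sqrt ((E.nrm (X n))\<^sup>2)) \<longlonglongrightarrow> sqrt 0" by (rule tendsto_real_sqrt)
  then have "(\<lambda>n. C * E.nrm (X n)) \<longlonglongrightarrow> 0" using Xc by (simp add: tendsto_mult_right_zero)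
  then have "(\<lambda>n. nrm (X n p)) \<longlonglongrightarrow> 0"
    by (rule Lim_null_comparison[rotated]) (use C Xc in simp)
  then have "hlim (\<lambda>n. X n p) 0" using Xc by (auto simp: hlim_def)
  then show "f p = 0 p" using X hlim_unique by (fastforce simp: approx_def)
qed

sublocale K: inner_product_space rkhs
proof (rule inner_product_space.intro)
  show "vector_space (hscale rkhs)" using fscale_vector_space by simp
  interpret F: vector_space fscale by (rule fscale_vector_space)
  have "F.subspace (hcarrier rkhs)"
    unfolding F.subspace_def
  proof (intro conjI ballI allI)
    show "0 \<in> hcarrier rkhs" by (rule pre_rkhs_subset[OF E.carr_zero])
    show "f + g \<in> hcarrier rkhs" if "f \<in> hcarrier rkhs" "g \<in> hcarrier rkhs" for f g
      using that approx_add unfolding mem_rkhs by blast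
    show "fscale c f \<in> hcarrier rkhs" if "f \<in> hcarrier rkhs" for c f
      using that approx_scale unfolding mem_rkhs by blast
  qed
  then show "inner_product_space_axioms rkhs"
  proof (intro inner_product_space_axioms.intro, simp_all)
    fix f g assume "f \<in> hcarrier rkhs" "g \<in> hcarrier rkhs"
    then obtain X Y where X: "approx X f" and Y: "approx Y g" by (auto simp: mem_rkhs)
    note XY = approx_carr[OF X] approx_carr[OF Y]
    show "rkhs_ip f g = cnj (rkhs_ip g f)"
      using approx_ip[OF X Y] tendsto_cnj[OF approx_ip[OF Y X]] XY LIMSEQ_unique
      by (simp add: pre_ip_commute[symmetric])
    show "rkhs_ip (fscale c f) g = c * rkhs_ip f g" for c
      using approx_ip[OF approx_scale[OF X, of c] Y] tendsto_mult_left[OF approx_ip[OF X Y], of c]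
        XY LIMSEQ_unique by (simp add: pre_ip_scale_left)
    fix k assume "k \<in> hcarrier rkhs"
    then obtain Z where Z: "approx Z k" by (auto simp: mem_rkhs)
    show "rkhs_ip (f + g) k = rkhs_ip f k + rkhs_ip g k"
      using approx_ip[OF approx_add[OF X Y] Z] tendsto_add[OF approx_ip[OF X Z] approx_ip[OF Y Z]]
        XY approx_carr[OF Z] LIMSEQ_unique by (simp add: pre_ip_add_left)
  next
    fix f assume f: "f \<in> hcarrier rkhs"
    then obtain X where X: "approx X f" by (auto simp: mem_rkhs)
    note lim = approx_ip[OF X X]
    have ge: "0 \<le> pre_ip (X n) (X n)" for n using pre_ip_ge_zero[OF approx_carr[OF X]] .
    have "0 \<le> Re (rkhs_ip f f)"
      using LIMSEQ_le_const[OF tendsto_Re[OF lim]] ge by (auto simp: less_eq_complex_def)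
    moreover have "Im (rkhs_ip f f) = 0"
      using LIMSEQ_unique[OF tendsto_Im[OF lim]] ge by (simp add: less_eq_complex_def)
    ultimately show "0 \<le> rkhs_ip f f" by (simp add: less_eq_complex_def)
    show "f = 0" if "rkhs_ip f f = 0" using rkhs_ip_eq_zero[OF f that] .
  qed
qed

lemma rkhs_norm_pre: "f \<in> hcarrier pre_rkhs \<Longrightarrow> K.nrm f = E.nrm f"
  by (simp add: hnorm_def rkhs_ip_pre)

lemma approx_hlim:
  assumes X: "approx X f"
  shows "K.hlim X f"
  unfolding K.hlim_def
proof (intro conjI)
  note Xc = approx_carr[OF X]
  show "range X \<subseteq> hcarrier rkhs" using Xc pre_rkhs_subset by auto
  show f: "f \<in> hcarrier rkhs" using X mem_rkhs by blast
  show "(\<lambda>n. K.nrm (X n - f)) \<longlonglongrightarrow> 0"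
  proof (rule LIMSEQ_I)
    fix e :: real assume e: "e > 0"
    then have "e / 2 > 0" by simp
    then obtain N where N: "\<And>m n. m \<ge> N \<Longrightarrow> n \<ge> N \<Longrightarrow> E.nrm (X m - X n) < e / 2"
      using X unfolding approx_def E.hCauchy_def by meson
    have "norm (K.nrm (X n - f) - 0) < e" if n: "n \<ge> N" for n
    proof -
      have c: "X n - f \<in> hcarrier rkhs" using f pre_rkhs_subset[OF Xc[of n]] by simp
      \<comment> \<open>With \<open>n\<close> fixed, the distance from \<open>X n\<close> to
        \<open>f\<close> is the limit over \<open>m\<close> of the distances to \<open>X m\<close>.
        The bound survives only as a weak inequality, hence \<open>e / 2\<close>.\<close>
      have "approx (\<lambda>m. X n - X m) (X n - f)" by (rule approx_diff[OF approx_const[OF Xc] X])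
      then have "(\<lambda>m. cmod (pre_ip (X n - X m) (X n - X m))) \<longlonglongrightarrow> cmod (rkhs_ip (X n - f) (X n - f))"
        by (intro tendsto_norm approx_ip)
      then have "(\<lambda>m. (E.nrm (X n - X m))\<^sup>2) \<longlonglongrightarrow> (K.nrm (X n - f))\<^sup>2"
        using E.ip_self[of "X n - X _"] Xc K.ip_self[OF c] by (simp add: norm_power)
      moreover have "(E.nrm (X n - X m))\<^sup>2 \<le> (e / 2)\<^sup>2" if "m \<ge> N" for m
        using N[OF n that] Xc by (intro power_mono) auto
      ultimately have "(K.nrm (X n - f))\<^sup>2 \<le> (e / 2)\<^sup>2"
        by (intro LIMSEQ_le_const2) auto
      then have "K.nrm (X n - f) \<le> e / 2" 
        by (rule power2_le_imp_le) (use e in simp)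
      then show ?thesis using e c by simp
    qed
    then show "\<exists>no. \<forall>n\<ge>no. norm (K.nrm (X n - f) - 0) < e" by blast
  qed
qed

lemma pre_rkhs_dense:
  assumes "f \<in> hcarrier rkhs" "e > 0"
  obtains g where "g \<in> hcarrier pre_rkhs" "K.nrm (f - g) < e"
proof -
  obtain X where X: "approx X f" using assms mem_rkhs by blast
  then have "(\<lambda>n. K.nrm (X n - f)) \<longlonglongrightarrow> 0" using approx_hlim by (simp add: K.hlim_def)
  then obtain n where "K.nrm (X n - f) < e"
    using order_tendstoD(2)[of _ 0 sequentially e] assms(2) unfolding eventually_sequentially
    by blast
  then show ?thesis
    using that[of "X n"] approx_carr[OF X, of n] assms pre_rkhs_subset
      K.nrm_diff_commute[of f "X n"] by simp
qed

text \<open>Each term of a Cauchy sequence is replaced by a finite combination at distance less than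
  \<open>1 / Suc n\<close>. The new sequence is Cauchy, converges pointwise because \<open>H\<close>
  is complete and evaluations are bounded, and so approximates its pointwise limit by
  definition.\<close>

theorem rkhs_hilbert_space: "hilbert_space rkhs"
proof (rule hilbert_spaceI[OF K.inner_product_space_axioms])
  have "\<exists>f. K.hlim F f" if F: "K.hCauchy F" for F
  proof -
    have Fc: "F n \<in> hcarrier rkhs" for n using F by (auto simp: K.hCauchy_def)
    have "\<exists>g. g \<in> hcarrier pre_rkhs \<and> K.nrm (F n - g) < 1 / real (Suc n)" for n
      using pre_rkhs_dense[OF Fc[of n], of "1 / real (Suc n)"] by auto
    then obtain g where g: "\<And>n. g n \<in> hcarrier pre_rkhs" "\<And>n. K.nrm (F n - g n) < 1 / real (Suc n)"
      by metis
    have gc: "g n \<in> hcarrier rkhs" for n using g pre_rkhs_subset by blast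
    have close: "(\<lambda>n. K.nrm (F n - g n)) \<longlonglongrightarrow> 0"
    proof (rule Lim_null_comparison)
      show "\<forall>\<^sub>F n in sequentially. norm (K.nrm (F n - g n)) \<le> inverse (real (Suc n))"
        using g gc Fc by (auto intro!: always_eventually less_imp_le simp: inverse_eq_divide)
    qed (rule LIMSEQ_inverse_real_of_nat)
    then have "K.hlim (\<lambda>n. F n - g n) 0" using Fc gc by (auto simp: K.hlim_def)
    then have "K.hCauchy (\<lambda>n. F n + fscale (- 1) (F n - g n))"
      using K.hCauchy_add[OF F K.hCauchy_scale[OF K.hlim_imp_hCauchy, of _ _ "- 1"]] by simp
    then have "K.hCauchy g" by (simp add: fscale_minus_one)
    then have gE: "E.hCauchy g"
      using g unfolding K.hCauchy_def E.hCauchy_def by (auto simp: rkhs_norm_pre range_subsetD)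
    have "\<exists>y. hlim (\<lambda>n. g n p) y" for p
    proof (rule hCauchy_imp_hlim, unfold hCauchy_def, intro conjI allI impI)
      show "range (\<lambda>n. g n p) \<subseteq> carr" using g by auto
      obtain C0 where C0: "\<And>f. f \<in> hcarrier pre_rkhs \<Longrightarrow> nrm (f p) \<le> C0 * E.nrm f"
        using eval_bounded[OF E.inner_product_space_axioms, of p] by (auto simp: pre_ip_kvec)
      define C where "C = max 1 C0"
      have C: "C > 0" "\<And>f. f \<in> hcarrier pre_rkhs \<Longrightarrow> nrm (f p) \<le> C * E.nrm f"
      proof -
        fix f assume f: "f \<in> hcarrier pre_rkhs"
        have "C0 * E.nrm f \<le> C * E.nrm f" using f by (intro mult_right_mono) (auto simp: C_def)
        then show "nrm (f p) \<le> C * E.nrm f" using C0[OF f] by linarith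
      qed (simp add: C_def)
      fix e :: real assume "e > 0"
      then have "e / C > 0" using C by simp
      then obtain N where N: "\<And>m n. m \<ge> N \<Longrightarrow> n \<ge> N \<Longrightarrow> E.nrm (g m - g n) < e / C"
        using gE unfolding E.hCauchy_def by meson
      have "nrm (g m p - g n p) < e" if "m \<ge> N" "n \<ge> N" for m n
      proof -
        have "nrm (g m p - g n p) \<le> C * E.nrm (g m - g n)" using C(2)[of "g m - g n"] g by simp
        also have "\<dots> < C * (e / C)" using N[OF that] C(1) by (rule mult_strict_left_mono)
        finally show ?thesis using C by simp
      qed
      then show "\<exists>N. \<forall>m\<ge>N. \<forall>n\<ge>N. nrm (g m p - g n p) < e" by blast
    qed
    then obtain f where "\<And>p. hlim (\<lambda>n. g n p) (f p)" by metis
    then have "K.hlim g f" using gE by (intro approx_hlim) (simp add: approx_def)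
    then have "K.hlim (\<lambda>n. (F n - g n) + g n) (0 + f)"
      using \<open>K.hlim (\<lambda>n. F n - g n) 0\<close> by (rule K.hlim_add[rotated])
    then show ?thesis by auto
  qed
  then show "K.M.mcomplete" using K.mcomplete_iff by blast
qed

theorem rkhs_span_dense:
  "K.M.mtopology closure_of K.span {kvec p h | p h. h \<in> carr} = hcarrier rkhs"
proof -
  let ?S = "{kvec p h | p h. h \<in> carr}"
  have span: "K.span ?S \<subseteq> hcarrier rkhs"
    by (rule K.span_minimal[OF _ K.subspace_hcarrier]) auto
  have E: "f \<in> K.span ?S" if "f \<in> hcarrier pre_rkhs" for f
  proof -
    from that obtain A x where A: "finite A" "\<And>p. x p \<in> carr" "f = kcomb A x"
      by (rule pre_rkhsE) blast
    show ?thesis unfolding A(3) kcomb_def by (intro K.span_sum K.span_base) (use A in blast)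
  qed
  have "\<exists>g\<in>K.span ?S. K.nrm (f - g) < e" if "f \<in> hcarrier rkhs" "e > 0" for f e
  proof -
    from that obtain g where "g \<in> hcarrier pre_rkhs" "K.nrm (f - g) < e" by (rule pre_rkhs_dense)
    then show ?thesis using E by blast
  qed
  then show ?thesis unfolding set_eq_iff K.in_closure_of_iff[OF span] by blast
qed

text \<open>Because \<open>L\<close> respects pointwise limits, it sends an approximating sequence
  of \<open>f\<close> to one of \<open>L f\<close>; the continuous extension is thus given by the
  same formula.\<close>

lemma rkhs_extend_isometry:
  assumes E: "\<And>f. f \<in> hcarrier pre_rkhs \<Longrightarrow> L f \<in> hcarrier pre_rkhs"
    and iso: "\<And>f g. \<lbrakk>f \<in> hcarrier pre_rkhs; g \<in> hcarrier pre_rkhs\<rbrakk>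
      \<Longrightarrow> pre_ip (L f) (L g) = pre_ip f g"
    and diff: "\<And>f g. \<lbrakk>f \<in> hcarrier pre_rkhs; g \<in> hcarrier pre_rkhs\<rbrakk> \<Longrightarrow> L (f - g) = L f - L g"
    and cont: "\<And>X f p. (\<And>q. hlim (\<lambda>n. X n q) (f q)) \<Longrightarrow> hlim (\<lambda>n. L (X n) p) (L f p)"
  shows "f \<in> hcarrier rkhs \<Longrightarrow> L f \<in> hcarrier rkhs"
    and "\<lbrakk>f \<in> hcarrier rkhs; g \<in> hcarrier rkhs\<rbrakk> \<Longrightarrow> rkhs_ip (L f) (L g) = rkhs_ip f g"
proof -
  have L: "approx (\<lambda>n. L (X n)) (L f)" if X: "approx X f" for X f
    unfolding approx_def
  proof (intro conjI allI)
    have norm: "E.nrm (L (X m) - L (X n)) = E.nrm (X m - X n)" for m n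
      using iso[of "X m - X n" "X m - X n"] diff[of "X m" "X n"] approx_carr[OF X]
      by (simp add: hnorm_def)
    show "E.hCauchy (\<lambda>n. L (X n))"
    proof (rule E.hCauchy_map[where X = X and C = 1])
      show "E.hCauchy X" using X by (simp add: approx_def)
      show "L (X n) \<in> hcarrier pre_rkhs" for n using E[OF approx_carr[OF X]] .
      show "E.nrm (L (X m) - L (X n)) \<le> 1 * E.nrm (X m - X n)" for m n by (simp add: norm)
    qed
    show "hlim (\<lambda>n. L (X n) p) (L f p)" for p
      using X by (intro cont) (simp add: approx_def)
  qed
  show "f \<in> hcarrier rkhs \<Longrightarrow> L f \<in> hcarrier rkhs" using L by (auto simp: mem_rkhs)
  show "rkhs_ip (L f) (L g) = rkhs_ip f g" if "f \<in> hcarrier rkhs" "g \<in> hcarrier rkhs"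
  proof -
    obtain X Y where X: "approx X f" and Y: "approx Y g" using \<open>f \<in> _\<close> \<open>g \<in> _\<close> by (auto simp: mem_rkhs)
    then show ?thesis
      using approx_ip[OF L[OF X] L[OF Y]] approx_ip[OF X Y] iso approx_carr[OF X] approx_carr[OF Y]
        LIMSEQ_unique by simp
  qed
qed

end


section \<open>Principal right ideals\<close>

abbreviation pideal :: "'p::right_lcm_semigroup \<Rightarrow> 'p set" where
  "pideal \<equiv> principal_right_ideal"

lemma mem_pideal: "x \<in> pideal p \<longleftrightarrow> (\<exists>a. x = p * a)"
  by (auto simp: principal_right_ideal_def)

lemma mult_in_pideal [simp]: "p * a \<in> pideal p"
  by (auto simp: mem_pideal)

lemma self_in_pideal [simp]: "p \<in> pideal p"
  using mult_in_pideal[of p 1] by simp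

lemma pideal_one [simp]: "pideal 1 = UNIV"
  by (auto simp: mem_pideal)

lemma pideal_mult_subset: "pideal (p * q) \<subseteq> pideal p"
  by (auto simp: mem_pideal mult.assoc)

lemma pideal_subset_iff: "pideal r \<subseteq> pideal p \<longleftrightarrow> r \<in> pideal p"
proof
  show "pideal r \<subseteq> pideal p \<Longrightarrow> r \<in> pideal p" using self_in_pideal by blast
  show "r \<in> pideal p \<Longrightarrow> pideal r \<subseteq> pideal p" by (auto simp: mem_pideal mult.assoc)
qed

lemma left_cancel: "p * a = p * b \<longleftrightarrow> a = b" for p :: "'p::right_lcm_semigroup"
  using left_cancellative by blast

lemma left_quotient_mult [simp]: "left_quotient p (p * t) = t"
  by (auto simp: left_quotient_def left_cancel)

lemma mult_left_quotient: "s \<in> pideal p \<Longrightarrow> p * left_quotient p s = s"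
  by (auto simp: mem_pideal)

lemma left_quotient_one [simp]: "left_quotient 1 s = s"
  using left_quotient_mult[of 1 s] by simp

lemma left_quotient_self [simp]: "left_quotient s s = 1"
  using left_quotient_mult[of s 1] by simp

lemma left_quotient_mult_right:
  "s \<in> pideal p \<Longrightarrow> left_quotient p (s * t) = left_quotient p s * t"
  by (auto simp: mem_pideal mult.assoc)

lemma left_quotient_trans:
  "s \<in> pideal p \<Longrightarrow> t \<in> pideal s \<Longrightarrow> left_quotient p t = left_quotient p s * left_quotient s t"
  using left_quotient_mult_right[of s p "left_quotient s t"] by (simp add: mult_left_quotient)

text \<open>Left cancellation turns \<open>r * (u * v) = r\<close> into \<open>u * v = 1\<close>,
  and likewise on the other side. Every independence of a chosen least common multiple rests on
  this.\<close>

lemma pideal_eq_imp_unit: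
  assumes "pideal r = pideal s"
  obtains u v where "s = r * u" "u * v = 1" "v * u = 1"
proof -
  have "s \<in> pideal r" "r \<in> pideal s" using assms self_in_pideal by blast+
  then obtain u v where "s = r * u" "r = s * v" by (auto simp only: mem_pideal)
  moreover from this have "r * (u * v) = r * 1" "s * (v * u) = s * 1"
    by (metis mult.assoc mult.right_neutral)+
  ultimately show ?thesis using that unfolding left_cancel by blast
qed

lemma pideal_Int_eqD:
  assumes "pideal p \<inter> pideal q = pideal s"
  shows "s \<in> pideal p" "s \<in> pideal q"
  using assms self_in_pideal by blast+

lemma image_mult_pideal: "(*) p ` pideal a = pideal (p * a)"
  by (simp add: principal_right_ideal_def image_image mult.assoc)

lemma pideal_Int_cases:
  obtains "pideal p \<inter> pideal q = {}" | r where "pideal p \<inter> pideal q = pideal r"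
  using right_lcm by blast

definition ideal_Int :: "'p::right_lcm_semigroup set \<Rightarrow> 'p set" where
  "ideal_Int F = (\<Inter>x\<in>F. pideal x)"

lemma mem_lcms: "r \<in> lcms F \<longleftrightarrow> ideal_Int F = pideal r"
  by (simp add: lcms_def ideal_Int_def)

lemma ideal_Int_empty [simp]: "ideal_Int {} = UNIV"
  by (simp add: ideal_Int_def)

lemma ideal_Int_insert [simp]: "ideal_Int (insert p F) = pideal p \<inter> ideal_Int F"
  by (simp add: ideal_Int_def)

lemma ideal_Int_Un: "ideal_Int (F \<union> G) = ideal_Int F \<inter> ideal_Int G"
  by (auto simp: ideal_Int_def)

lemma ideal_Int_principal:
  assumes "finite F" "ideal_Int F \<noteq> {}"
  obtains r where "ideal_Int F = pideal r"
proof -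
  have "ideal_Int F = {} \<or> (\<exists>r. ideal_Int F = pideal r)"
    using assms(1)
  proof induction
    case empty
    then show ?case using pideal_one by (metis ideal_Int_empty)
  next
    case (insert p F)
    then consider "ideal_Int F = {}" | r where "ideal_Int F = pideal r" by blast
    then show ?case
    proof cases
      case 2
      then show ?thesis using right_lcm[of p r] by simp
    qed simp
  qed
  then show ?thesis using that assms by blast
qed

lemma lcms_eq_empty_iff: "finite F \<Longrightarrow> lcms F = {} \<longleftrightarrow> ideal_Int F = {}"
  using ideal_Int_principal[of F] self_in_pideal unfolding mem_lcms[symmetric]
  by (metis empty_iff equals0I mem_lcms)


section \<open>Alternating sums over power sets\<close>

lemma sum_Pow_insert:
  fixes g :: "'i set \<Rightarrow> 'b::comm_monoid_add"
  assumes "finite F" "a \<notin> F"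
  shows "(\<Sum>U\<in>Pow (insert a F). g U) = (\<Sum>U\<in>Pow F. g U + g (insert a U))"
proof -
  have "inj_on (insert a) (Pow F)" using assms by (auto simp: inj_on_def)
  moreover have "Pow F \<inter> insert a ` Pow F = {}" using assms by auto
  ultimately show ?thesis
    using assms by (simp add: Pow_insert sum.union_disjoint sum.reindex sum.distrib)
qed

text \<open>Adjoining \<open>a\<close> applies the difference operator in direction \<open>a\<close>
  to the set function, as a factor \<open>1 - E\<close> does to a product of projections. This is
  why the inductions below keep \<open>f\<close> arbitrary.\<close>

lemma alternating_sum_Pow_insert:
  fixes f :: "'i set \<Rightarrow> complex"
  assumes "finite F" "a \<notin> F"
  shows "(\<Sum>U\<in>Pow (insert a F). (- 1) ^ card U * f U)
    = (\<Sum>U\<in>Pow F. (- 1) ^ card U * (f U - f (insert a U)))"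
  unfolding sum_Pow_insert[OF assms]
proof (rule sum.cong)
  fix U assume "U \<in> Pow F"
  then have "finite U" "a \<notin> U" using assms finite_subset by auto
  then show "(- 1) ^ card U * f U + (- 1) ^ card (insert a U) * f (insert a U)
      = (- 1) ^ card U * (f U - f (insert a U))" by (simp add: algebra_simps)
qed simp

text \<open>Idempotence of a product of commuting factors \<open>1 - E\<close>, where
  \<open>f X\<close> stands for the product of the \<open>E\<close> over \<open>X\<close>.\<close>

lemma alternating_sum_Pow_Un:
  fixes f :: "'i set \<Rightarrow> complex"
  assumes "finite F"
  shows "(\<Sum>U\<in>Pow F. (- 1) ^ card U * (\<Sum>W\<in>Pow F. (- 1) ^ card W * f (U \<union> W)))
    = (\<Sum>X\<in>Pow F. (- 1) ^ card X * f X)"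
  using assms
proof (induction F arbitrary: f)
  case (insert a F)
  let ?f = "\<lambda>X. f X - f (insert a X)"
  \<comment> \<open>The inner sum at \<open>insert a U\<close> vanishes, since adjoining
    \<open>a\<close> to \<open>W\<close> no longer changes the union.\<close>
  have "(\<Sum>W\<in>Pow (insert a F). (- 1) ^ card W * f (U \<union> W))
        - (\<Sum>W\<in>Pow (insert a F). (- 1) ^ card W * f (insert a U \<union> W))
      = (\<Sum>W\<in>Pow F. (- 1) ^ card W * ?f (U \<union> W))" for U
    unfolding alternating_sum_Pow_insert[OF insert.hyps] sum_subtractf[symmetric]
    by (intro sum.cong) (simp_all add: algebra_simps)
  then show ?case
    using insert.IH[of ?f] by (simp only: alternating_sum_Pow_insert[OF insert.hyps])
qed simp

text \<open>A repeated factor \<open>1 - E\<close> counts once, so \<open>t\<close> may identify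
  indices.\<close>

lemma alternating_sum_Pow_image:
  fixes f :: "'i set \<Rightarrow> complex"
  assumes "finite J"
  shows "(\<Sum>B\<in>Pow J. (- 1) ^ card B * f (t ` B)) = (\<Sum>U\<in>Pow (t ` J). (- 1) ^ card U * f U)"
  using assms
proof (induction J arbitrary: f)
  case (insert k J)
  let ?f = "\<lambda>X. f X - f (insert (t k) X)"
  have "(\<Sum>B\<in>Pow (insert k J). (- 1) ^ card B * f (t ` B))
      = (\<Sum>U\<in>Pow (t ` J). (- 1) ^ card U * ?f U)"
    using insert.IH[of ?f] by (simp add: alternating_sum_Pow_insert[OF insert.hyps])
  also have "\<dots> = (\<Sum>U\<in>Pow (t ` insert k J). (- 1) ^ card U * f U)"
  proof (cases "t k \<in> t ` J")
    case True
    define F where "F = t ` J - {t k}"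
    have F: "finite F" "t k \<notin> F" "t ` J = insert (t k) F" using True insert.hyps by (auto simp: F_def)
    \<comment> \<open>A set function insensitive to the element \<open>t k\<close> has alternating
      sum 0: sets with and without it cancel in pairs.\<close>
    have "(\<Sum>U\<in>Pow (t ` J). (- 1) ^ card U * f (insert (t k) U)) = 0"
      unfolding F(3) by (subst alternating_sum_Pow_insert[OF F(1,2)]) simp
    moreover have "t ` insert k J = t ` J" using True by auto
    ultimately show ?thesis by (simp add: right_diff_distrib sum_subtractf)
  next
    case False
    then show ?thesis using insert.hyps
      by (simp only: image_insert) (subst alternating_sum_Pow_insert, auto)
  qed
  finally show ?case .
qed simp

text \<open>The atoms of a Boolean algebra of projections sum to 1. In the induction the terms with
  \<open>a\<close> in \<open>A\<close> cancel those with \<open>a\<close> in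
  \<open>B\<close>.\<close>

lemma sum_Pow_disjoint_pairs:
  fixes f :: "'i set \<Rightarrow> complex"
  assumes "finite D"
  shows "(\<Sum>A\<in>Pow D. \<Sum>B\<in>Pow (D - A). (- 1) ^ card B * f (A \<union> B)) = f {}"
  using assms
proof (induction D)
  case (insert a D)
  have "(\<Sum>B\<in>Pow (insert a D - A). (- 1) ^ card B * f (A \<union> B))
        + (\<Sum>B\<in>Pow (insert a D - insert a A). (- 1) ^ card B * f (insert a A \<union> B))
      = (\<Sum>B\<in>Pow (D - A). (- 1) ^ card B * f (A \<union> B))"
    if A: "A \<in> Pow D" for A
  proof -
    have 1: "insert a D - A = insert a (D - A)" "insert a D - insert a A = D - A"
      using A insert.hyps by auto
    have 2: "finite (D - A)" "a \<notin> D - A" using insert.hyps by auto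
    show ?thesis
      unfolding 1 alternating_sum_Pow_insert[OF 2] sum.distrib[symmetric]
      by (intro sum.cong) (simp_all add: algebra_simps)
  qed
  then show ?case using insert.IH by (simp add: sum_Pow_insert[OF insert.hyps])
qed simp

text \<open>The atoms below the product over \<open>M\<close> sum to that product; removing
  \<open>M\<close> from each \<open>A\<close> reduces this to the partition of unity.\<close>

lemma sum_Pow_superset_pairs:
  fixes f :: "'i set \<Rightarrow> complex"
  assumes "finite N" "M \<subseteq> N"
  shows "(\<Sum>A\<in>{A \<in> Pow N. M \<subseteq> A}. \<Sum>B\<in>Pow (N - A). (- 1) ^ card B * f (A \<union> B)) = f M"
proof -
  have "(\<Sum>A\<in>{A \<in> Pow N. M \<subseteq> A}. \<Sum>B\<in>Pow (N - A). (- 1) ^ card B * f (A \<union> B))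
      = (\<Sum>A\<in>Pow (N - M). \<Sum>B\<in>Pow (N - M - A). (- 1) ^ card B * f (M \<union> (A \<union> B)))"
  proof (rule sum.reindex_bij_witness[of _ "\<lambda>A. A \<union> M" "\<lambda>A. A - M"])
    fix A assume A: "A \<in> {A \<in> Pow N. M \<subseteq> A}"
    then have "N - M - (A - M) = N - A" "M \<union> (A - M \<union> B) = A \<union> B" for B by auto
    then show "(\<Sum>B\<in>Pow (N - M - (A - M)). (- 1) ^ card B * f (M \<union> (A - M \<union> B)))
        = (\<Sum>B\<in>Pow (N - A). (- 1) ^ card B * f (A \<union> B))" by simp
  qed (use assms in auto)
  also have "\<dots> = f (M \<union> {})"
    using sum_Pow_disjoint_pairs[of "N - M" "\<lambda>X. f (M \<union> X)"] assms by simp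
  finally show ?thesis by simp
qed


section \<open>Contractive representations\<close>

locale contractive_rep = hilbert_space H for H :: "'a::ab_group_add hspace" +
  fixes T :: "'p::right_lcm_semigroup \<Rightarrow> 'a \<Rightarrow> 'a"
  assumes rep: "unital_contractive_rep H T"
begin

lemma T_bounded: "bounded_op H (T p)"
  using rep by (simp add: unital_contractive_rep_def unital_rep_def)

lemmas T_carr [simp] = bounded_opD(1)[OF T_bounded]

lemma T_one [simp]: "x \<in> carr \<Longrightarrow> T 1 x = x"
  using rep by (simp add: unital_contractive_rep_def unital_rep_def)

lemma T_mult: "x \<in> carr \<Longrightarrow> T (p * q) x = T p (T q x)"
  using rep by (simp add: unital_contractive_rep_def unital_rep_def)

lemma T_contr: "x \<in> carr \<Longrightarrow> nrm (T p x) \<le> nrm x"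
  using nrm_le_op_norm[OF T_bounded, of x p] rep mult_right_mono[of "op_norm H (T p)" 1 "nrm x"]
  by (simp add: unital_contractive_rep_def)

definition Ts :: "'p \<Rightarrow> 'a \<Rightarrow> 'a" where
  "Ts p = hadjoint H (T p)"

lemma Ts_bounded: "bounded_op H (Ts p)"
  unfolding Ts_def by (rule bounded_op_hadjoint[OF T_bounded])

lemmas Ts_carr [simp] = bounded_opD(1)[OF Ts_bounded]

lemma ip_Ts: "\<lbrakk>x \<in> carr; y \<in> carr\<rbrakk> \<Longrightarrow> ip x (Ts p y) = ip (T p x) y"
  unfolding Ts_def by (rule ip_hadjoint[OF T_bounded])

lemma ip_Ts_left: "\<lbrakk>x \<in> carr; y \<in> carr\<rbrakk> \<Longrightarrow> ip (Ts p y) x = ip y (T p x)"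
  unfolding Ts_def by (rule ip_hadjoint_left[OF T_bounded])

lemma Ts_mult: "x \<in> carr \<Longrightarrow> Ts (p * q) x = Ts q (Ts p x)"
  unfolding Ts_def by (rule hadjoint_comp[OF T_bounded T_bounded]) (auto simp: T_mult)

lemma Ts_one [simp]: "x \<in> carr \<Longrightarrow> Ts 1 x = x"
  unfolding Ts_def by (rule hadjoint_eqI) auto

text \<open>This is where contractivity enters.\<close>

lemma Ts_unit:
  assumes "u * v = 1" "v * u = 1" "x \<in> carr"
  shows "Ts u x = T v x"
  unfolding Ts_def
  by (rule hadjoint_eq_inverse[OF T_bounded T_contr T_bounded T_contr])
    (use assms in \<open>auto simp flip: T_mult\<close>)

lemma T_Ts_unit: "\<lbrakk>u * v = 1; v * u = 1; x \<in> carr\<rbrakk> \<Longrightarrow> T u (Ts u x) = x"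
  by (simp add: Ts_unit flip: T_mult)

lemma Ts_T_unit: "\<lbrakk>u * v = 1; v * u = 1; x \<in> carr\<rbrakk> \<Longrightarrow> Ts u (T u x) = x"
  by (simp add: Ts_unit flip: T_mult)

text \<open>Replacing \<open>r\<close> by \<open>r * u\<close> with \<open>u\<close> invertible
  inserts \<open>T u\<close> followed by its adjoint between the two factors, and this product is 1.
  The case \<open>p = q = 1\<close> concerns the operators attached to a finite set.\<close>

lemma T_Ts_pideal_cong:
  assumes "pideal r = pideal s" "r \<in> pideal p" "r \<in> pideal q" "x \<in> carr"
  shows "T (left_quotient p s) (Ts (left_quotient q s) x)
    = T (left_quotient p r) (Ts (left_quotient q r) x)"
proof -
  obtain u v where "s = r * u" "u * v = 1" "v * u = 1"
    using pideal_eq_imp_unit[OF assms(1)] .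
  then show ?thesis
    using assms by (simp add: left_quotient_mult_right T_mult Ts_mult T_Ts_unit)
qed

lemma regular_kernel_eq:
  assumes "pideal p \<inter> pideal q = pideal s" "x \<in> carr"
  shows "regular_kernel H T p q x = T (left_quotient p s) (Ts (left_quotient q s) x)"
proof -
  have "s \<in> lcms {p, q}" using assms by (simp add: mem_lcms)
  then have "(SOME s. s \<in> lcms {p, q}) \<in> lcms {p, q}" "lcms {p, q} \<noteq> {}" by (auto intro: someI)
  then show ?thesis
    using T_Ts_pideal_cong[of s "SOME s. s \<in> lcms {p, q}" p q x] assms pideal_Int_eqD[OF assms(1)]
    by (auto simp: regular_kernel_def Let_def Ts_def mem_lcms)
qed

lemma regular_kernel_disjoint:
  "pideal p \<inter> pideal q = {} \<Longrightarrow> regular_kernel H T p q x = 0"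
  by (simp add: regular_kernel_def lcms_eq_empty_iff)

lemma range_op_lcm_eq:
  assumes "ideal_Int U = pideal r" "x \<in> carr"
  shows "range_op_lcm H T U x = T r (Ts r x)"
proof -
  have "r \<in> lcms U" using assms by (simp add: mem_lcms)
  then have "(SOME s. s \<in> lcms U) \<in> lcms U" "lcms U \<noteq> {}" by (auto intro: someI)
  then show ?thesis
    using T_Ts_pideal_cong[of r "SOME s. s \<in> lcms U" 1 1 x] assms
    by (auto simp: range_op_lcm_def range_op_def Ts_def mem_lcms)
qed

lemma range_op_lcm_disjoint:
  "finite U \<Longrightarrow> ideal_Int U = {} \<Longrightarrow> range_op_lcm H T U x = 0"
  by (simp add: range_op_lcm_def lcms_eq_empty_iff)

text \<open>Both the kernel and the operators \<open>TT\<^sup>*(\<Or>U)\<close> are instances of one sesquilinear form, which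
  depends on the generator of the ideal \<open>C\<close> only through \<open>C\<close>.\<close>

definition ideal_form :: "'p set \<Rightarrow> 'p \<Rightarrow> 'p \<Rightarrow> 'a \<Rightarrow> 'a \<Rightarrow> complex" where
  "ideal_form C q p y x = (if C = {} then 0 else let s = SOME s. C = pideal s in
    ip (Ts (left_quotient q s) y) (Ts (left_quotient p s) x))"

lemma ideal_form_empty [simp]: "ideal_form {} q p y x = 0"
  by (simp add: ideal_form_def)

lemma ip_T_Ts: "\<lbrakk>x \<in> carr; y \<in> carr\<rbrakk> \<Longrightarrow> ip (T p (Ts q y)) x = ip (Ts q y) (Ts p x)"
  by (simp add: ip_Ts)

lemma ideal_form_eq:
  assumes "s \<in> pideal p" "s \<in> pideal q" "x \<in> carr" "y \<in> carr"
  shows "ideal_form (pideal s) q p y x = ip (Ts (left_quotient q s) y) (Ts (left_quotient p s) x)"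
proof -
  define r where "r = (SOME r. pideal s = pideal r)"
  have "pideal s = pideal r" unfolding r_def by (rule someI) (rule refl)
  moreover have "pideal s \<noteq> {}" using self_in_pideal by blast
  then have "ideal_form (pideal s) q p y x = ip (Ts (left_quotient q r) y) (Ts (left_quotient p r) x)"
    by (simp add: ideal_form_def Let_def r_def)
  ultimately show ?thesis
    using T_Ts_pideal_cong[of s r p q y] assms by (simp flip: ip_T_Ts)
qed

lemma ip_regular_kernel:
  assumes "x \<in> carr" "y \<in> carr"
  shows "ip (regular_kernel H T p q y) x = ideal_form (pideal p \<inter> pideal q) q p y x"
proof (cases rule: pideal_Int_cases[of p q])
  case 1
  then show ?thesis using assms by (simp add: regular_kernel_disjoint)
next
  case (2 s)
  then have "s \<in> pideal p" "s \<in> pideal q" by (rule pideal_Int_eqD)+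
  then show ?thesis using 2 assms by (simp add: regular_kernel_eq ideal_form_eq ip_T_Ts)
qed

lemma ip_range_op_lcm:
  assumes "finite U" "x \<in> carr" "y \<in> carr"
  shows "range_op_lcm H T U y \<in> carr"
    and "ip (range_op_lcm H T U y) x = ideal_form (ideal_Int U) 1 1 y x"
proof -
  have "range_op_lcm H T U y \<in> carr
    \<and> ip (range_op_lcm H T U y) x = ideal_form (ideal_Int U) 1 1 y x"
  proof (cases "ideal_Int U = {}")
    case True
    then show ?thesis using assms by (simp add: range_op_lcm_disjoint)
  next
    case False
    then obtain r where "ideal_Int U = pideal r" using ideal_Int_principal assms by blast
    then show ?thesis using assms by (simp add: range_op_lcm_eq ideal_form_eq ip_T_Ts)
  qed
  then show "range_op_lcm H T U y \<in> carr"
    and "ip (range_op_lcm H T U y) x = ideal_form (ideal_Int U) 1 1 y x" by auto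
qed

lemma ip_Z_op:
  assumes F: "finite F" and x: "x \<in> carr"
  shows "ip (Z_op H T F x) x = (\<Sum>U\<in>Pow F. (- 1) ^ card U * ideal_form (ideal_Int U) 1 1 x x)"
proof -
  have U: "finite U" if "U \<in> Pow F" for U using that F finite_subset by auto
  have "ip (Z_op H T F x) x = (\<Sum>U\<in>Pow F. ip (hscale H ((- 1) ^ card U) (range_op_lcm H T U x)) x)"
    unfolding Z_op_def using x U by (intro ip_sum_left) (simp_all add: ip_range_op_lcm)
  also have "\<dots> = (\<Sum>U\<in>Pow F. (- 1) ^ card U * ideal_form (ideal_Int U) 1 1 x x)"
    using x U by (intro sum.cong) (simp_all add: hinner_scale_left ip_range_op_lcm)
  finally show ?thesis .
qed

text \<open>Passes from numbered points to families over any finite index set, repetitions allowed;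
  finite subsets of \<open>P\<close> will serve as indices.\<close>

lemma star_regular_positive:
  assumes "star_regular_dilation H T" "finite I" "\<And>i. i \<in> I \<Longrightarrow> x i \<in> carr"
  shows "0 \<le> (\<Sum>i\<in>I. \<Sum>j\<in>I. ip (regular_kernel H T (p i) (p j) (x j)) (x i))"
proof -
  obtain e where e: "bij_betw e {..<card I} I"
    using ex_bij_betw_nat_finite[OF assms(2)] by (auto simp: atLeast0LessThan)
  then have "\<forall>i<card I. x (e i) \<in> carr" using assms(3) by (auto simp: bij_betw_def)
  then have "0 \<le> (\<Sum>i<card I. \<Sum>j<card I.
      ip (regular_kernel H T (p (e i)) (p (e j)) (x (e j))) (x (e i)))"
    using assms(1)[unfolded star_regular_dilation_def positive_op_matrix_def, rule_format,
        of "card I" "\<lambda>i. x (e i)" "\<lambda>i. p (e i)"] by blast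
  also have "\<dots> = (\<Sum>i\<in>I. \<Sum>j\<in>I. ip (regular_kernel H T (p i) (p j) (x j)) (x i))"
    using sum.reindex_bij_betw[OF e] by (simp add: sum.reindex_bij_betw[OF e, symmetric])
  finally show ?thesis .
qed


section \<open>The kernel and the operators \<open>Z(F)\<close>\<close>

text \<open>In a dilation, \<open>\<langle>Z(F)x, x\<rangle>\<close> is the squared norm of \<open>\<Sum>\<^sub>U (-1)\<^bsup>|U|\<^esup> V(r\<^sub>U) V(r\<^sub>U)\<^sup>* x\<close> with
  \<open>r\<^sub>U \<in> \<Or>U\<close>; the kernel already computes this norm.\<close>

theorem star_regular_imp_Z_positive:
  assumes reg: "star_regular_dilation H T" and F: "finite F"
  shows "positive_op H (Z_op H T F)"
  unfolding positive_op_def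
proof
  fix x assume x: "x \<in> carr"
  define \<phi> where "\<phi> U = ideal_form (ideal_Int U) 1 1 x x" for U
  \<comment> \<open>Only these \<open>U\<close> have a least common multiple to carry a point of the
    kernel; the other terms are 0 and return at the end.\<close>
  define I where "I = {U \<in> Pow F. ideal_Int U \<noteq> {}}"
  have fin: "finite I" "finite (Pow F)" using F by (auto simp: I_def)
  have "\<exists>r. ideal_Int U = pideal r" if "U \<in> I" for U
  proof -
    have "finite U" "ideal_Int U \<noteq> {}" using that F finite_subset by (auto simp: I_def)
    then show ?thesis using ideal_Int_principal by blast
  qed
  then obtain r where r: "\<And>U. U \<in> I \<Longrightarrow> ideal_Int U = pideal (r U)" by metis
  \<comment> \<open>In a dilation \<open>V(r)^*\<close> acts on \<open>H\<close> as
    \<open>Ts r\<close>, so the range projection of \<open>V(r)\<close> maps \<open>x\<close> to the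
    kernel vector at \<open>r\<close> in direction \<open>Ts r x\<close>.\<close>
  define y where "y U = hscale H ((- 1) ^ card U) (Ts (r U) x)" for U
  have yc: "y U \<in> carr" for U using x by (simp add: y_def)
  have "ip (regular_kernel H T (r U) (r W) (y W)) (y U)
      = (- 1) ^ card U * ((- 1) ^ card W * \<phi> (U \<union> W))" if U: "U \<in> I" and W: "W \<in> I" for U W
  proof -
    have Int: "ideal_Int (U \<union> W) = pideal (r U) \<inter> pideal (r W)"
      using r[OF U] r[OF W] by (simp add: ideal_Int_Un)
    show ?thesis
    proof (cases rule: pideal_Int_cases[of "r U" "r W"])
      case 1
      then show ?thesis using x Int by (simp add: regular_kernel_disjoint y_def \<phi>_def)
    next
      case (2 s)
      have s: "s \<in> pideal (r U)" "s \<in> pideal (r W)" using 2 by (rule pideal_Int_eqD)+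
      \<comment> \<open>The quotient and \<open>r X\<close> recombine to \<open>s\<close>, so a
        matrix entry depends on \<open>U\<close> and \<open>W\<close>, apart from signs, only
        through their joint ideal.\<close>
      have Ts: "Ts (left_quotient (r X) s) (y X) = hscale H ((- 1) ^ card X) (Ts s x)"
        if "s \<in> pideal (r X)" for X
        using x mult_left_quotient[OF that]
        by (simp add: y_def bounded_opD(3)[OF Ts_bounded] flip: Ts_mult)
      have "ip (regular_kernel H T (r U) (r W) (y W)) (y U)
          = ip (hscale H ((- 1) ^ card W) (Ts s x)) (hscale H ((- 1) ^ card U) (Ts s x))"
        using yc 2 s by (simp add: ip_regular_kernel ideal_form_eq Ts)
      also have "\<dots> = (- 1) ^ card U * ((- 1) ^ card W * ip (Ts s x) (Ts s x))"
        using x by (simp add: hinner_scale_left ip_scale_right)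
      also have "ip (Ts s x) (Ts s x) = \<phi> (U \<union> W)"
        using x Int 2 by (simp add: \<phi>_def ideal_form_eq)
      finally show ?thesis .
    qed
  qed
  then have "0 \<le> (\<Sum>U\<in>I. \<Sum>W\<in>I. (- 1) ^ card U * ((- 1) ^ card W * \<phi> (U \<union> W)))"
    using star_regular_positive[OF reg fin(1), of y r] x by (simp add: y_def cong: sum.cong)
  also have "\<dots> = (\<Sum>U\<in>Pow F. (- 1) ^ card U * (\<Sum>W\<in>Pow F. (- 1) ^ card W * \<phi> (U \<union> W)))"
  proof -
    have 0: "\<phi> (U \<union> W) = 0" if "ideal_Int U = {} \<or> ideal_Int W = {}" for U W
      using that by (auto simp: \<phi>_def ideal_Int_Un)
    have inner: "(\<Sum>W\<in>I. (- 1) ^ card W * \<phi> (U \<union> W)) = (\<Sum>W\<in>Pow F. (- 1) ^ card W * \<phi> (U \<union> W))"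
      for U using fin 0 by (intro sum.mono_neutral_left) (auto simp: I_def)
    show ?thesis
      unfolding sum_distrib_left[symmetric] inner
      using fin 0 by (intro sum.mono_neutral_left) (auto simp: I_def)
  qed
  also have "\<dots> = (\<Sum>X\<in>Pow F. (- 1) ^ card X * \<phi> X)" by (rule alternating_sum_Pow_Un[OF F])
  also have "\<dots> = ip (Z_op H T F x) x" using F x by (simp add: ip_Z_op \<phi>_def)
  finally show "0 \<le> ip (Z_op H T F x) x" .
qed

text \<open>In a dilation, write \<open>1 = \<Sum>\<^sub>A Q\<^sub>A\<close> over \<open>A \<subseteq> {1..n}\<close>, where
  \<open>Q\<^sub>A = \<Prod>\<^bsub>i\<in>A\<^esub> V(p\<^sub>i)V(p\<^sub>i)\<^sup>* \<Prod>\<^bsub>i\<notin>A\<^esub> (1 - V(p\<^sub>i)V(p\<^sub>i)\<^sup>*)\<close>. The next lemma is positivity of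
  \<open>\<parallel>Q\<^sub>A \<Sum>\<^sub>i V(p\<^sub>i)x\<^sub>i\<parallel>\<^sup>2\<close>: for \<open>r \<in> \<Or>A\<close> it equals \<open>\<langle>Z(F)y, y\<rangle>\<close>, where \<open>F\<close> consists of the
  quotients of \<open>r \<or> p\<^sub>k\<close> by \<open>r\<close> for \<open>k \<notin> A\<close> and \<open>y\<close> is the sum of \<open>T(p\<^sub>i\<^sup>-\<^sup>1r)\<^sup>*x\<^sub>i\<close> over \<open>i \<in> A\<close>.\<close>

lemma atom_positive:
  fixes p :: "'i \<Rightarrow> 'p"
  assumes Z: "\<And>F. finite F \<Longrightarrow> positive_op H (Z_op H T F)"
    and N: "finite N" and A: "A \<subseteq> N" and x: "\<And>i. i \<in> N \<Longrightarrow> x i \<in> carr"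
  shows "0 \<le> (\<Sum>B\<in>Pow (N - A). (- 1) ^ card B *
    (\<Sum>i\<in>A. \<Sum>j\<in>A. ideal_form (ideal_Int (p ` (A \<union> B))) (p j) (p i) (x j) (x i)))"
proof (cases "ideal_Int (p ` A) = {}")
  case True
  then show ?thesis by (simp add: image_Un ideal_Int_Un)
next
  case False
  have finA: "finite A" using N A finite_subset by blast
  obtain r where r: "ideal_Int (p ` A) = pideal r"
    using ideal_Int_principal[OF _ False] finA by blast
  have rp: "r \<in> pideal (p i)" if "i \<in> A" for i
    using that r self_in_pideal[of r] by (auto simp: ideal_Int_def)
  define y where "y = (\<Sum>i\<in>A. Ts (left_quotient (p i) r) (x i))"
  have y: "y \<in> carr" unfolding y_def using A x by (intro carr_sum) auto
  \<comment> \<open>For the other \<open>k\<close> the range projections of \<open>V(r)\<close> and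
    \<open>V(p k)\<close> would be orthogonal, so their factor acts as 1 on the atom.\<close>
  define J where "J = {k \<in> N - A. pideal r \<inter> pideal (p k) \<noteq> {}}"
  have finJ: "finite J" using N by (simp add: J_def)
  have "\<exists>t. pideal r \<inter> pideal (p k) = pideal (r * t)" if "k \<in> J" for k
  proof -
    from that obtain s where s: "pideal r \<inter> pideal (p k) = pideal s"
      by (cases rule: pideal_Int_cases[of r "p k"]) (auto simp: J_def)
    then have "s \<in> pideal r" by (rule pideal_Int_eqD)
    then show ?thesis using s by (auto simp: mem_pideal[of s r])
  qed
  then obtain t where t: "\<And>k. k \<in> J \<Longrightarrow> pideal r \<inter> pideal (p k) = pideal (r * t k)" by metis
  \<comment> \<open>Left multiplication by \<open>r\<close> is injective and commutes with
    intersections, so the part of the lattice below \<open>r\<close> is a translated copy of the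
    whole.\<close>
  have cap: "ideal_Int (p ` (A \<union> B)) = (*) r ` ideal_Int (t ` B)" if "B \<subseteq> J" for B
  proof -
    have "finite B" using that finJ finite_subset by blast
    then show ?thesis
      using that
    proof (induction B)
      case empty
      then show ?case using image_mult_pideal[of r 1] by (simp add: r)
    next
      case (insert k B)
      have "ideal_Int (p ` (A \<union> insert k B)) = pideal (p k) \<inter> ideal_Int (p ` (A \<union> B))"
        by simp
      also have "\<dots> = (pideal r \<inter> pideal (p k)) \<inter> ideal_Int (p ` (A \<union> B))"
        using r by (auto simp: image_Un ideal_Int_Un)
      also have "\<dots> = (*) r ` pideal (t k) \<inter> (*) r ` ideal_Int (t ` B)"
        using insert t[of k] by (simp add: image_mult_pideal)
      also have "\<dots> = (*) r ` (pideal (t k) \<inter> ideal_Int (t ` B))"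
        by (rule image_Int[symmetric]) (simp add: inj_def left_cancel)
      finally show ?case by simp
    qed
  qed
  have form: "(\<Sum>i\<in>A. \<Sum>j\<in>A. ideal_form (ideal_Int (p ` (A \<union> B))) (p j) (p i) (x j) (x i))
      = ideal_form (ideal_Int (t ` B)) 1 1 y y" if B: "B \<subseteq> J" for B
  proof (cases "ideal_Int (t ` B) = {}")
    case True
    then show ?thesis using cap[OF B] by simp
  next
    case False
    have "finite (t ` B)" using B finJ finite_subset by blast
    then obtain w where w: "ideal_Int (t ` B) = pideal w" using ideal_Int_principal False by blast
    then have c: "ideal_Int (p ` (A \<union> B)) = pideal (r * w)"
      using cap[OF B] by (simp add: image_mult_pideal)
    have mem: "r * w \<in> pideal (p i)" if "i \<in> A" for i
      using rp[OF that] by (auto simp: mem_pideal mult.assoc)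
    have Tsw: "Ts w y = (\<Sum>i\<in>A. Ts (left_quotient (p i) (r * w)) (x i))"
      unfolding y_def using A x rp
      by (subst bounded_op_sum[OF Ts_bounded])
        (auto intro!: sum.cong simp: left_quotient_mult_right Ts_mult subset_iff)
    have xA: "x i \<in> carr" if "i \<in> A" for i using A x that by auto
    have "(\<Sum>i\<in>A. \<Sum>j\<in>A. ideal_form (ideal_Int (p ` (A \<union> B))) (p j) (p i) (x j) (x i))
        = (\<Sum>i\<in>A. \<Sum>j\<in>A. ip (Ts (left_quotient (p j) (r * w)) (x j))
            (Ts (left_quotient (p i) (r * w)) (x i)))"
      unfolding c using xA mem by (intro sum.cong refl ideal_form_eq) auto
    also have "\<dots> = ip (Ts w y) (Ts w y)"
      unfolding Tsw using xA by (simp add: ip_sum_left ip_sum_right carr_sum)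
    also have "\<dots> = ideal_form (ideal_Int (t ` B)) 1 1 y y"
      unfolding w using y by (simp add: ideal_form_eq)
    finally show ?thesis .
  qed
  have "0 \<le> ip (Z_op H T (t ` J) y) y"
    using Z[of "t ` J"] finJ y by (simp add: positive_op_def)
  \<comment> \<open>Distinct \<open>k\<close> may yield the same quotient \<open>t k\<close>, hence
    the passage through images.\<close>
  also have "\<dots> = (\<Sum>B\<in>Pow J. (- 1) ^ card B * ideal_form (ideal_Int (t ` B)) 1 1 y y)"
    using finJ y alternating_sum_Pow_image[OF finJ, of "\<lambda>U. ideal_form (ideal_Int U) 1 1 y y" t]
    by (simp add: ip_Z_op)
  also have "\<dots> = (\<Sum>B\<in>Pow J. (- 1) ^ card B *
      (\<Sum>i\<in>A. \<Sum>j\<in>A. ideal_form (ideal_Int (p ` (A \<union> B))) (p j) (p i) (x j) (x i)))"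
    by (intro sum.cong refl) (simp add: form)
  also have "\<dots> = (\<Sum>B\<in>Pow (N - A). (- 1) ^ card B *
      (\<Sum>i\<in>A. \<Sum>j\<in>A. ideal_form (ideal_Int (p ` (A \<union> B))) (p j) (p i) (x j) (x i)))"
  proof (intro sum.mono_neutral_left ballI)
    fix B assume "B \<in> Pow (N - A) - Pow J"
    then obtain k where k: "k \<in> B" "k \<in> N - A" "k \<notin> J" by blast
    then have "ideal_Int (p ` (A \<union> B)) \<subseteq> ideal_Int (p ` A) \<inter> pideal (p k)"
      by (auto simp: ideal_Int_def)
    then have "ideal_Int (p ` (A \<union> B)) = {}" using k r unfolding J_def by blast
    then show "(- 1) ^ card B * (\<Sum>i\<in>A. \<Sum>j\<in>A.
        ideal_form (ideal_Int (p ` (A \<union> B))) (p j) (p i) (x j) (x i)) = 0" by simp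
  qed (use N J_def in auto)
  finally show ?thesis .
qed

text \<open>Summing the nonnegative atom contributions and collecting the coefficient of each pair
  \<open>i\<close>, \<open>j\<close> leaves the atoms with \<open>i\<close> and \<open>j\<close> in
  \<open>A\<close>. These add up to the form on the intersection of the ideals of \<open>p i\<close>
  and \<open>p j\<close>, which is the kernel entry.\<close>

theorem Z_positive_imp_star_regular:
  assumes Z: "\<And>F. finite F \<Longrightarrow> positive_op H (Z_op H T F)"
  shows "star_regular_dilation H T"
  unfolding star_regular_dilation_def positive_op_matrix_def
proof (intro allI impI)
  fix n :: nat and p :: "nat \<Rightarrow> 'p" and x assume x: "\<forall>i<n. x i \<in> carr"
  define N where "N = {..<n}"
  have N: "finite N" by (simp add: N_def)
  define G where "G C i j = ideal_form (ideal_Int (p ` C)) (p j) (p i) (x j) (x i)" for C i j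
  have "0 \<le> (\<Sum>A\<in>Pow N. \<Sum>B\<in>Pow (N - A). (- 1) ^ card B * (\<Sum>i\<in>A. \<Sum>j\<in>A. G (A \<union> B) i j))"
    unfolding G_def using x by (intro sum_nonneg atom_positive Z N) (auto simp: N_def)
  \<comment> \<open>Moving the condition on \<open>i\<close> and \<open>j\<close> into the summand
    frees their ranges from \<open>A\<close>, so the sums can be exchanged.\<close>
  also have "\<dots> = (\<Sum>A\<in>Pow N. \<Sum>i\<in>N. \<Sum>j\<in>N. if {i, j} \<subseteq> A
      then \<Sum>B\<in>Pow (N - A). (- 1) ^ card B * G (A \<union> B) i j else 0)"
  proof (rule sum.cong)
    fix A assume A: "A \<in> Pow N"
    have "(\<Sum>B\<in>Pow (N - A). (- 1) ^ card B * (\<Sum>i\<in>A. \<Sum>j\<in>A. G (A \<union> B) i j))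
        = (\<Sum>B\<in>Pow (N - A). \<Sum>i\<in>A. \<Sum>j\<in>A. (- 1) ^ card B * G (A \<union> B) i j)"
      by (simp add: sum_distrib_left)
    also have "\<dots> = (\<Sum>i\<in>A. \<Sum>j\<in>A. \<Sum>B\<in>Pow (N - A). (- 1) ^ card B * G (A \<union> B) i j)"
      by (subst sum.swap, rule sum.cong[OF refl], subst sum.swap, rule refl)
    also have "\<dots> = (\<Sum>i\<in>A. \<Sum>j\<in>N. if {i, j} \<subseteq> A
        then \<Sum>B\<in>Pow (N - A). (- 1) ^ card B * G (A \<union> B) i j else 0)"
      using A N by (intro sum.cong refl sum.mono_neutral_cong_left) auto
    also have "\<dots> = (\<Sum>i\<in>N. \<Sum>j\<in>N. if {i, j} \<subseteq> A
        then \<Sum>B\<in>Pow (N - A). (- 1) ^ card B * G (A \<union> B) i j else 0)"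
      using A N by (intro sum.mono_neutral_left) auto
    finally show "(\<Sum>B\<in>Pow (N - A). (- 1) ^ card B * (\<Sum>i\<in>A. \<Sum>j\<in>A. G (A \<union> B) i j)) = \<dots>" .
  qed simp
  also have "\<dots> = (\<Sum>i\<in>N. \<Sum>j\<in>N. \<Sum>A\<in>Pow N. if {i, j} \<subseteq> A
      then \<Sum>B\<in>Pow (N - A). (- 1) ^ card B * G (A \<union> B) i j else 0)"
    by (subst sum.swap, rule sum.cong[OF refl], subst sum.swap, rule refl)
  also have "\<dots> = (\<Sum>i\<in>N. \<Sum>j\<in>N. G {i, j} i j)"
  proof (intro sum.cong refl)
    fix i j assume ij: "i \<in> N" "j \<in> N"
    have "(\<Sum>A\<in>Pow N. if {i, j} \<subseteq> A
        then \<Sum>B\<in>Pow (N - A). (- 1) ^ card B * G (A \<union> B) i j else 0)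
      = (\<Sum>A\<in>{A \<in> Pow N. {i, j} \<subseteq> A}. \<Sum>B\<in>Pow (N - A). (- 1) ^ card B * G (A \<union> B) i j)"
      using N by (intro sum.inter_filter[symmetric]) simp
    also have "\<dots> = G {i, j} i j"
      using N ij by (intro sum_Pow_superset_pairs[where f = "\<lambda>C. G C i j"]) auto
    finally show "(\<Sum>A\<in>Pow N. if {i, j} \<subseteq> A
        then \<Sum>B\<in>Pow (N - A). (- 1) ^ card B * G (A \<union> B) i j else 0) = G {i, j} i j" .
  qed
  also have "\<dots> = (\<Sum>i<n. \<Sum>j<n. ip (regular_kernel H T (p i) (p j) (x j)) (x i))"
    using x by (auto simp: N_def G_def ip_regular_kernel intro!: sum.cong)
  finally show "0 \<le> (\<Sum>i<n. \<Sum>j<n. ip (regular_kernel H T (p i) (p j) (x j)) (x i))" .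
qed

end


section \<open>From a dilation to the kernel\<close>

text \<open>Makes the calculus of \<open>Ts\<close> available for the dilation itself.\<close>

lemma isometric_rep_contractive:
  assumes "hilbert_space K" "unital_rep K V"
    and iso: "\<And>p x. x \<in> hcarrier K \<Longrightarrow> hnorm K (V p x) = hnorm K x"
  shows "contractive_rep K V"
proof -
  interpret K: hilbert_space K by fact
  have "op_norm K (V p) \<le> 1" for p
    unfolding op_norm_def
  proof (rule cSUP_least)
    have "0 \<in> {x \<in> K.carr. K.nrm x \<le> 1}" by simp
    then show "{x \<in> K.carr. K.nrm x \<le> 1} \<noteq> {}" by blast
  qed (use iso in auto)
  then show ?thesis
    using assms by unfold_locales (simp add: unital_contractive_rep_def)
qed

theorem (in contractive_rep) dilation_imp_star_regular:
  fixes K :: "'k::ab_group_add hspace"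
  assumes dil: "minimal_isometric_nica_dilation H T K J V"
  shows "star_regular_dilation H T"
proof -
  have hK: "hilbert_space K" and emb: "isometric_embedding H K J" and rV: "unital_rep K V"
    and iso: "\<And>p x. x \<in> hcarrier K \<Longrightarrow> hnorm K (V p x) = hnorm K x"
    and compress: "\<And>p h. h \<in> carr \<Longrightarrow> J (T p h) = orth_proj K (J ` carr) (V p (J h))"
    and dense: "Metric_space.mtopology (hcarrier K) (hdist K) closure_of
      module.span (hscale K) {V p (J h) | p h. h \<in> carr} = hcarrier K"
    and nica: "nica_covariant K V"
    using dil by (auto simp: minimal_isometric_nica_dilation_def)
  interpret K: contractive_rep K V by (rule isometric_rep_contractive[OF hK rV iso])
  note J = isometric_embeddingD[OF emb]
  have VV: "K.Ts p (V p x) = x" if "x \<in> K.carr" for p x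
    unfolding K.Ts_def using that iso by (intro K.hadjoint_isometry K.T_bounded)
  have compr: "K.ip (V p (J h)) (J k) = ip (T p h) k" if "h \<in> carr" "k \<in> carr" for p h k
    using ip_orth_proj_embedding[OF hilbert_space_axioms hK emb, of "V p (J h)" k] that J
    by (simp flip: compress)
  \<comment> \<open>Tested on \<open>V(p)h\<close>, both sides reduce to the compression of
    \<open>V(b * p)\<close>, because \<open>T\<close> is multiplicative.\<close>
  have coinv: "K.Ts b (J k) = J (Ts b k)" if k: "k \<in> carr" for b k
  proof (rule K.dense_ip_ext[OF _ dense])
    show "{V p (J h) | p h. h \<in> carr} \<subseteq> K.carr" using J by auto
    fix z assume "z \<in> {V p (J h) | p h. h \<in> carr}"
    then obtain p h where h: "h \<in> carr" and z: "z = V p (J h)" by auto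
    have "K.ip (K.Ts b (J k)) z = K.ip (J k) (V (b * p) (J h))"
      using h k J by (simp add: z K.ip_Ts_left K.T_mult)
    also have "\<dots> = cnj (ip (T (b * p) h) k)"
      using h k J K.hinner_commute[of "J k" "V (b * p) (J h)"] compr[of h k "b * p"] by simp
    also have "\<dots> = cnj (ip (T p h) (Ts b k))" using h k by (simp add: T_mult ip_Ts)
    also have "\<dots> = K.ip (J (Ts b k)) z"
      using h k J K.hinner_commute[of "J (Ts b k)" z] compr[of h "Ts b k" p] by (simp add: z)
    finally show "K.ip (K.Ts b (J k)) z = K.ip (J (Ts b k)) z" .
  qed (use k J in auto)
  have ker: "ip (regular_kernel H T p q y) x = K.ip (V q (J y)) (V p (J x))"
    if x: "x \<in> carr" and y: "y \<in> carr" for p q x y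
  proof -
    let ?a = "V q (J y)" and ?b = "V p (J x)"
    have c: "?a \<in> K.carr" "?b \<in> K.carr" using x y J by auto
    \<comment> \<open>Both vectors lie in the ranges of their isometries, so the range projections
      can be inserted for Nica covariance to act on.\<close>
    have "K.ip ?a ?b = K.ip (V q (K.Ts q ?a)) (V p (K.Ts p ?b))" using x y J VV by simp
    also have "\<dots> = K.ip (V p (K.Ts p (V q (K.Ts q ?a)))) ?b"
      using c by (simp add: K.ip_Ts_left K.ip_T_Ts flip: K.ip_Ts)
    also have "\<dots> = K.ip (range_op K V p (range_op K V q ?a)) ?b"
      by (simp add: range_op_def K.Ts_def)
    finally have E: "K.ip ?a ?b = K.ip (range_op K V p (range_op K V q ?a)) ?b" .
    show ?thesis
    proof (cases rule: pideal_Int_cases[of p q])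
      case 1
      then have "range_op K V p (range_op K V q ?a) = 0" using nica c by (simp add: nica_covariant_def)
      then show ?thesis using E 1 x c by (simp add: regular_kernel_disjoint)
    next
      case (2 s)
      note s = pideal_Int_eqD[OF 2]
      \<comment> \<open>Since \<open>V(r)^* V(r) = 1\<close>, the factor \<open>r\<close> of
        \<open>s\<close> cancels, and the remaining adjoint leaves the embedded \<open>H\<close>
        invariant.\<close>
      have TsJ: "K.Ts s (V r (J z)) = J (Ts (left_quotient r s) z)"
        if "s \<in> pideal r" "z \<in> carr" for r z
      proof -
        have "K.Ts s (V r (J z)) = K.Ts (r * left_quotient r s) (V r (J z))"
          using mult_left_quotient[OF that(1)] by simp
        also have "\<dots> = J (Ts (left_quotient r s) z)"
          using that J by (simp only: K.Ts_mult K.T_carr VV coinv)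
        finally show ?thesis .
      qed
      have "range_op K V p (range_op K V q ?a) = range_op K V s ?a"
        using nica 2 c by (simp add: nica_covariant_def)
      then have "K.ip ?a ?b = K.ip (V s (K.Ts s ?a)) ?b"
        using E by (simp add: range_op_def K.Ts_def)
      also have "\<dots> = K.ip (K.Ts s ?a) (K.Ts s ?b)" using c by (simp add: K.ip_Ts)
      also have "\<dots> = ip (Ts (left_quotient q s) y) (Ts (left_quotient p s) x)"
        using s x y J by (simp add: TsJ)
      finally show ?thesis using 2 s x y by (simp add: ip_regular_kernel ideal_form_eq)
    qed
  qed
  show ?thesis
    unfolding star_regular_dilation_def positive_op_matrix_def
  proof (intro allI impI)
    fix n :: nat and p :: "nat \<Rightarrow> 'p" and x assume x: "\<forall>i<n. x i \<in> carr"
    define v where "v = (\<Sum>i<n. V (p i) (J (x i)))"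
    have c: "V (p i) (J (x i)) \<in> K.carr" if "i \<in> {..<n}" for i using that x J by simp
    then have v: "v \<in> K.carr" unfolding v_def by (rule K.carr_sum)
    have "K.ip v v = (\<Sum>i<n. K.ip v (V (p i) (J (x i))))"
      using K.ip_sum_right[of "{..<n}" "\<lambda>i. V (p i) (J (x i))" v] c v
      unfolding v_def by blast
    also have "\<dots> = (\<Sum>i<n. \<Sum>j<n. K.ip (V (p j) (J (x j))) (V (p i) (J (x i))))"
      unfolding v_def by (intro sum.cong refl K.ip_sum_left c)
    also have "\<dots> = (\<Sum>i<n. \<Sum>j<n. ip (regular_kernel H T (p i) (p j) (x j)) (x i))"
      using x by (intro sum.cong refl) (simp add: ker)
    finally show "0 \<le> (\<Sum>i<n. \<Sum>j<n. ip (regular_kernel H T (p i) (p j) (x j)) (x i))"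
      using K.hinner_ge_zero[OF v] by simp
  qed
qed


section \<open>From the kernel to a dilation\<close>

locale star_regular_rep = contractive_rep H T
  for H :: "'a::ab_group_add hspace" and T :: "'p::right_lcm_semigroup \<Rightarrow> 'a \<Rightarrow> 'a" +
  assumes star_regular: "star_regular_dilation H T"
begin

lemma regular_kernel_bounded: "bounded_op H (regular_kernel H T p q)"
proof (cases rule: pideal_Int_cases[of p q])
  case 1
  then show ?thesis by (auto simp: bounded_op_def regular_kernel_disjoint intro!: exI[of _ 0])
next
  case (2 s)
  let ?a = "left_quotient p s" and ?b = "left_quotient q s"
  have "nrm (regular_kernel H T p q x) \<le> 1 * nrm x" if x: "x \<in> carr" for x
  proof -
    have "nrm (T ?a (Ts ?b x)) \<le> nrm (Ts ?b x)" using x by (intro T_contr) simp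
    also have "\<dots> \<le> 1 * nrm x" unfolding Ts_def using x T_contr
      by (intro nrm_hadjoint_le T_bounded) auto
    finally show ?thesis using x by (simp add: regular_kernel_eq[OF 2])
  qed
  then show ?thesis
    unfolding bounded_op_def
    by (auto intro!: exI[of _ 1] simp: regular_kernel_eq[OF 2]
        bounded_opD(2,3)[OF T_bounded] bounded_opD(2,3)[OF Ts_bounded])
qed

lemma regular_kernel_hermitian:
  assumes "x \<in> carr" "y \<in> carr"
  shows "ip (regular_kernel H T p q x) y = ip x (regular_kernel H T q p y)"
proof (cases rule: pideal_Int_cases[of p q])
  case 1
  then show ?thesis using assms by (simp add: regular_kernel_disjoint Int_commute)
next
  case (2 s)
  moreover from this have "pideal q \<inter> pideal p = pideal s" by (simp add: Int_commute)
  ultimately show ?thesis using assms by (simp add: regular_kernel_eq ip_T_Ts ip_Ts_left)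
qed

sublocale positive_kernel H "regular_kernel H T"
  using regular_kernel_bounded regular_kernel_hermitian
    star_regular_positive[OF star_regular, of _ _ "\<lambda>p. p"]
  by unfold_locales blast+

text \<open>The formula is forced by the requirement that \<open>V(p)\<close> sends the kernel vector at \<open>q\<close> to the
  kernel vector at \<open>pq\<close>.\<close>

definition V :: "'p \<Rightarrow> ('p \<Rightarrow> 'a) \<Rightarrow> 'p \<Rightarrow> 'a" where
  "V p f = (\<lambda>r. if pideal p \<inter> pideal r = {} then 0
    else let s = SOME s. pideal p \<inter> pideal r = pideal s
      in T (left_quotient r s) (f (left_quotient p s)))"

text \<open>One \<open>s\<close> serves all \<open>f\<close>, so linearity and pointwise continuity
  of \<open>V p\<close> reduce to those of \<open>T\<close>.\<close>

lemma V_cases: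
  obtains "pideal p \<inter> pideal r = {}" "\<And>f. V p f r = 0"
  | s where "pideal p \<inter> pideal r = pideal s"
      "\<And>f. V p f r = T (left_quotient r s) (f (left_quotient p s))"
proof (cases "pideal p \<inter> pideal r = {}")
  case True
  then show ?thesis using that(1) by (simp add: V_def)
next
  case False
  then have "\<exists>s. pideal p \<inter> pideal r = pideal s" using right_lcm by blast
  then have "pideal p \<inter> pideal r = pideal (SOME s. pideal p \<inter> pideal r = pideal s)"
    by (rule someI_ex)
  then show ?thesis using that(2) False by (simp add: V_def Let_def)
qed

lemma V_kvec:
  assumes h: "h \<in> carr"
  shows "V p (kvec q h) = kvec (p * q) h"
proof
  fix r
  show "V p (kvec q h) r = kvec (p * q) h r"
  proof (cases rule: V_cases[of p r])
    case 1
    then have "pideal r \<inter> pideal (p * q) = {}" using pideal_mult_subset[of p q] by auto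
    then show ?thesis using 1 by (simp add: kvec_def regular_kernel_disjoint)
  next
    case (2 s)
    note s = pideal_Int_eqD[OF 2(1)]
    define a where "a = left_quotient p s"
    have pa: "s = p * a" using mult_left_quotient[OF s(1)] by (simp add: a_def)
    \<comment> \<open>An element of \<open>pideal r\<close> that is also a multiple of
      \<open>p\<close> lies in \<open>pideal s\<close>; cancelling \<open>p\<close> there leaves the
      pair \<open>a\<close>, \<open>q\<close>.\<close>
    have Int: "pideal r \<inter> pideal (p * q) = (*) p ` (pideal a \<inter> pideal q)"
    proof -
      have "pideal r \<inter> pideal (p * q) = pideal (p * a) \<inter> pideal (p * q)"
        using 2(1) pideal_mult_subset[of p q] pa by auto
      also have "\<dots> = (*) p ` (pideal a \<inter> pideal q)"
        unfolding image_mult_pideal[symmetric]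
        by (rule image_Int[symmetric]) (simp add: inj_def left_cancel)
      finally show ?thesis .
    qed
    show ?thesis
    proof (cases rule: pideal_Int_cases[of a q])
      case 1
      then show ?thesis using 2 Int
        by (simp add: kvec_def regular_kernel_disjoint bounded_op_zero[OF T_bounded] flip: a_def)
    next
      case (2 w)
      note w = pideal_Int_eqD[OF 2]
      have v: "pideal r \<inter> pideal (p * q) = pideal (p * w)"
        using Int 2 by (simp add: image_mult_pideal)
      obtain b c where b: "w = a * b" and c: "w = q * c" using w unfolding mem_pideal by blast
      have "left_quotient a w = b" "left_quotient q w = c" unfolding b by simp (simp add: c flip: b)
      moreover have "left_quotient r (p * w) = left_quotient r s * b"
        using left_quotient_mult_right[OF s(2), of b] by (simp add: pa b mult.assoc)
      moreover have "left_quotient (p * q) (p * w) = c"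
        using left_quotient_mult[of "p * q" c] by (simp add: c mult.assoc)
      ultimately show ?thesis
        using h \<open>\<And>f. V p f r = _\<close>
        by (simp add: kvec_def regular_kernel_eq[OF 2] regular_kernel_eq[OF v] T_mult flip: a_def)
    qed
  qed
qed

lemma V_add: "\<lbrakk>\<And>q. f q \<in> carr; \<And>q. g q \<in> carr\<rbrakk> \<Longrightarrow> V p (f + g) = V p f + V p g"
proof
  fix r assume "\<And>q. f q \<in> carr" "\<And>q. g q \<in> carr"
  then show "V p (f + g) r = (V p f + V p g) r"
    by (cases rule: V_cases[of p r]) (simp_all add: bounded_opD[OF T_bounded])
qed

lemma V_scale: "(\<And>q. f q \<in> carr) \<Longrightarrow> V p (fscale c f) = fscale c (V p f)"
proof
  fix r assume "\<And>q. f q \<in> carr"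
  then show "V p (fscale c f) r = fscale c (V p f) r"
    by (cases rule: V_cases[of p r]) (simp_all add: fscale_apply bounded_opD[OF T_bounded])
qed

lemma V_diff: "\<lbrakk>\<And>q. f q \<in> carr; \<And>q. g q \<in> carr\<rbrakk> \<Longrightarrow> V p (f - g) = V p f - V p g"
proof
  fix r assume "\<And>q. f q \<in> carr" "\<And>q. g q \<in> carr"
  then show "V p (f - g) r = (V p f - V p g) r"
    by (cases rule: V_cases[of p r]) (simp_all add: bounded_op_diff[OF T_bounded])
qed

lemma V_zero: "V p 0 = 0"
proof
  show "V p 0 r = 0 r" for r
    by (cases rule: V_cases[of p r]) (simp_all add: bounded_op_zero[OF T_bounded])
qed

lemma V_kcomb:
  assumes "finite A" "\<And>q. x q \<in> carr"
  shows "V p (kcomb A x) = (\<Sum>q\<in>A. kvec (p * q) (x q))"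
  using assms(1)
proof (induction A)
  case empty
  then show ?case by (simp only: kcomb_empty V_zero sum.empty)
next
  case (insert q A)
  have "kcomb (insert q A) x = kvec q (x q) + kcomb A x"
    unfolding kcomb_def using insert.hyps by (rule sum.insert)
  moreover have "V p (kvec q (x q) + kcomb A x) = V p (kvec q (x q)) + V p (kcomb A x)"
    using insert.hyps assms(2) by (intro V_add pre_rkhs_eval) auto
  ultimately show ?case
    by (simp only: insert.IH V_kvec[OF assms(2)] sum.insert[OF insert.hyps])
qed

lemma V_pre_rkhs: "f \<in> hcarrier pre_rkhs \<Longrightarrow> V p f \<in> hcarrier pre_rkhs"
  by (elim pre_rkhsE) (simp add: V_kcomb)

text \<open>The kernel is invariant under left translation: multiplication by \<open>p\<close>
  carries common multiples to common multiples and leaves the quotients unchanged. This is the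
  source of isometry.\<close>

lemma pre_ip_kvec_shift:
  assumes "x \<in> carr" "y \<in> carr"
  shows "pre_ip (kvec (p * q) x) (kvec (p * r) y) = pre_ip (kvec q x) (kvec r y)"
proof -
  have "pideal (p * r) \<inter> pideal (p * q) = (*) p ` (pideal r \<inter> pideal q)"
    unfolding image_mult_pideal[symmetric]
    by (rule image_Int[symmetric]) (simp add: inj_def left_cancel)
  then have "regular_kernel H T (p * r) (p * q) x = regular_kernel H T r q x"
  proof (cases rule: pideal_Int_cases[of r q])
    case (2 s)
    obtain a b where "s = r * a" "s = q * b"
      using pideal_Int_eqD[OF 2] unfolding mem_pideal by blast
    then have "left_quotient (p * r) (p * s) = a" "left_quotient (p * q) (p * s) = b"
      "left_quotient r s = a" "left_quotient q s = b"
      by (metis left_quotient_mult mult.assoc)+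
    moreover assume "pideal (p * r) \<inter> pideal (p * q) = (*) p ` (pideal r \<inter> pideal q)"
    then have "pideal (p * r) \<inter> pideal (p * q) = pideal (p * s)"
      using 2 by (simp add: image_mult_pideal)
    ultimately show ?thesis using assms 2 by (simp add: regular_kernel_eq)
  qed (simp add: regular_kernel_disjoint)
  then show ?thesis using assms by (simp add: pre_ip_kvec) (simp add: kvec_def)
qed

lemma V_pre_isometry:
  assumes "f \<in> hcarrier pre_rkhs" "g \<in> hcarrier pre_rkhs"
  shows "pre_ip (V p f) (V p g) = pre_ip f g"
proof -
  obtain A x where A: "finite A" "\<And>p. x p \<in> carr" "f = kcomb A x"
    using assms(1) by (rule pre_rkhsE) blast
  obtain B y where B: "finite B" "\<And>p. y p \<in> carr" "g = kcomb B y"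
    using assms(2) by (rule pre_rkhsE) blast
  have sum: "pre_ip (\<Sum>q\<in>A. kvec (k q) (x q)) (\<Sum>r\<in>B. kvec (k r) (y r))
      = (\<Sum>q\<in>A. \<Sum>r\<in>B. pre_ip (kvec (k q) (x q)) (kvec (k r) (y r)))" for k
    using E.ip_sum_left[of A "\<lambda>q. kvec (k q) (x q)" "\<Sum>r\<in>B. kvec (k r) (y r)"]
      E.ip_sum_right[of B "\<lambda>r. kvec (k r) (y r)"] A B by simp
  show ?thesis
    using sum[of "\<lambda>q. p * q"] sum[of "\<lambda>q. q"] A B
    by (simp add: V_kcomb pre_ip_kvec_shift) (simp add: kcomb_def)
qed

lemma V_pointwise_continuous:
  assumes "\<And>q. hlim (\<lambda>n. X n q) (f q)"
  shows "hlim (\<lambda>n. V p (X n) r) (V p f r)"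
  by (cases rule: V_cases[of p r]) (simp_all add: bounded_op_hlim[OF T_bounded assms])

lemma V_rkhs [simp]: "f \<in> hcarrier rkhs \<Longrightarrow> V p f \<in> hcarrier rkhs"
  by (rule rkhs_extend_isometry(1)[where L = "V p"])
    (simp_all add: V_pre_rkhs V_pre_isometry V_diff V_pointwise_continuous)

lemma V_isometry:
  "\<lbrakk>f \<in> hcarrier rkhs; g \<in> hcarrier rkhs\<rbrakk> \<Longrightarrow> rkhs_ip (V p f) (V p g) = rkhs_ip f g"
  by (rule rkhs_extend_isometry(2)[where L = "V p"])
    (simp_all add: V_pre_rkhs V_pre_isometry V_diff V_pointwise_continuous)

lemma V_nrm: "f \<in> hcarrier rkhs \<Longrightarrow> K.nrm (V p f) = K.nrm f"
  by (simp add: hnorm_def V_isometry)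

lemma V_bounded: "bounded_op rkhs (V p)"
  unfolding bounded_op_def
  by (auto simp: V_add V_scale V_nrm intro!: exI[of _ 1])

section \<open>The representation \<open>V\<close>, its adjoints and range projections\<close>

sublocale K: hilbert_space rkhs
  by (rule rkhs_hilbert_space)

lemma V_unital_rep: "unital_rep rkhs V"
  unfolding unital_rep_def
proof (intro conjI allI ballI V_bounded)
  let ?S = "{kvec p h | p h. h \<in> carr}"
  have S: "?S \<subseteq> K.carr" by auto
  fix f assume f: "f \<in> K.carr"
  have id: "bounded_op rkhs (\<lambda>f. f)" by (auto simp: bounded_op_def intro!: exI[of _ 1])
  show "V 1 f = f"
    by (rule K.bounded_op_dense_ext[OF V_bounded id S rkhs_span_dense _ f]) (auto simp: V_kvec)
  have comp: "bounded_op rkhs (\<lambda>f. V p (V q f))" for p q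
    by (auto simp: bounded_op_def V_add V_scale V_nrm intro!: exI[of _ 1])
  show "V (p * q) f = V p (V q f)" for p q
    by (rule K.bounded_op_dense_ext[OF V_bounded comp S rkhs_span_dense _ f])
      (auto simp: V_kvec mult.assoc)
qed

lemma hadjoint_V:
  assumes f: "f \<in> hcarrier rkhs"
  shows "hadjoint rkhs (V p) f q = f (p * q)"
proof (rule ip_ext)
  let ?g = "hadjoint rkhs (V p) f"
  have g: "?g \<in> hcarrier rkhs" using K.hadjoint_carr[OF V_bounded f] .
  then show "?g q \<in> carr" by simp
  show "f (p * q) \<in> carr" using f by simp
  fix h assume h: "h \<in> carr"
  have "ip (?g q) h = rkhs_ip ?g (kvec q h)" using g h by (simp add: rkhs_reproducing)
  also have "\<dots> = rkhs_ip f (V p (kvec q h))"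
    using K.ip_hadjoint_left[OF V_bounded _ f, of "kvec q h" p] h by simp
  also have "\<dots> = ip (f (p * q)) h" using f h by (simp add: V_kvec rkhs_reproducing)
  finally show "ip (?g q) h = ip (f (p * q)) h" .
qed

text \<open>Invertible right translation of the point only rotates the direction: the kernel vector
  at \<open>s * u\<close> in direction \<open>h\<close> is the one at \<open>s\<close> in direction
  \<open>T u h\<close>.\<close>

lemma rkhs_eval_unit:
  assumes f: "f \<in> hcarrier rkhs" and u: "u * v = 1" "v * u = 1"
  shows "f (s * u) = Ts u (f s)"
proof (rule ip_ext)
  fix h assume h: "h \<in> carr"
  have su: "pideal (s * u) = pideal s"
  proof
    have "s = s * u * v" using u by (simp add: mult.assoc)
    then have "s \<in> pideal (s * u)" using mult_in_pideal by metis
    then show "pideal s \<subseteq> pideal (s * u)" by (simp add: pideal_subset_iff)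
  qed (rule pideal_mult_subset)
  have "kvec (s * u) h = kvec s (T u h)"
  proof
    fix r
    show "kvec (s * u) h r = kvec s (T u h) r"
    proof (cases rule: pideal_Int_cases[of r s])
      case 1
      then show ?thesis using su by (simp add: kvec_def regular_kernel_disjoint)
    next
      case (2 w)
      have w: "pideal r \<inter> pideal (s * u) = pideal w" using 2 su by simp
      obtain c where c: "w = s * u * c" using pideal_Int_eqD(2)[OF w] by (auto simp: mem_pideal)
      have "left_quotient s w = u * c" "left_quotient (s * u) w = c"
        unfolding c by (simp_all add: mult.assoc) (metis left_quotient_mult mult.assoc)
      then show ?thesis
        using h u by (simp add: kvec_def regular_kernel_eq[OF 2] regular_kernel_eq[OF w] Ts_mult Ts_T_unit)
    qed
  qed
  then have "rkhs_ip f (kvec (s * u) h) = rkhs_ip f (kvec s (T u h))" by simp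
  then show "ip (f (s * u)) h = ip (Ts u (f s)) h"
    using f h by (simp add: rkhs_reproducing ip_Ts_left)
qed (use f in auto)

text \<open>The adjoint followed by \<open>V p\<close> evaluates \<open>f\<close> at the generator
  chosen inside \<open>V\<close>. Another generator \<open>v\<close> costs \<open>T u\<close>
  composed with its adjoint, which is 1.\<close>

lemma range_op_V:
  assumes f: "f \<in> hcarrier rkhs" and v: "pideal p \<inter> pideal t = pideal v"
  shows "range_op rkhs V p f t = T (left_quotient t v) (f v)"
proof (cases rule: V_cases[of p t])
  case 1
  then show ?thesis using v self_in_pideal by blast
next
  case (2 s)
  have "pideal s = pideal v" using 2(1) v by simp
  then obtain u u' where u: "v = s * u" "u * u' = 1" "u' * u = 1" by (rule pideal_eq_imp_unit)
  note s = pideal_Int_eqD[OF 2(1)]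
  have "range_op rkhs V p f t = T (left_quotient t s) (f s)"
    using f 2 mult_left_quotient[OF s(1)] by (simp add: range_op_def hadjoint_V)
  also have "\<dots> = T (left_quotient t v) (f v)"
    using f s u rkhs_eval_unit[OF f u(2,3), of s]
    by (simp add: left_quotient_mult_right T_mult T_Ts_unit)
  finally show ?thesis .
qed

lemma range_op_V_disjoint: "pideal p \<inter> pideal t = {} \<Longrightarrow> range_op rkhs V p f t = 0"
  by (simp add: range_op_def V_def)

lemma range_op_V_rkhs: "f \<in> hcarrier rkhs \<Longrightarrow> range_op rkhs V p f \<in> hcarrier rkhs"
  by (simp add: range_op_def K.hadjoint_carr[OF V_bounded])

text \<open>Two successive range projections read \<open>f\<close> at a generator of the triple
  intersection, because left quotients compose. The result is what Nica covariance predicts.\<close>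

lemma range_op_V_comp:
  assumes f: "f \<in> hcarrier rkhs"
  shows "pideal p \<inter> pideal q \<inter> pideal t = {} \<Longrightarrow> range_op rkhs V p (range_op rkhs V q f) t = 0"
    and "pideal p \<inter> pideal q \<inter> pideal t = pideal v \<Longrightarrow>
      range_op rkhs V p (range_op rkhs V q f) t = T (left_quotient t v) (f v)"
proof -
  note g = range_op_V_rkhs[OF f, of q]
  show "range_op rkhs V p (range_op rkhs V q f) t = 0"
    if e: "pideal p \<inter> pideal q \<inter> pideal t = {}"
  proof (cases rule: pideal_Int_cases[of p t])
    case 1
    then show ?thesis by (rule range_op_V_disjoint)
  next
    case (2 u)
    then have "pideal q \<inter> pideal u = {}" using e by blast
    then show ?thesis
      using range_op_V[OF g 2] by (simp add: range_op_V_disjoint bounded_op_zero[OF T_bounded])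
  qed
  show "range_op rkhs V p (range_op rkhs V q f) t = T (left_quotient t v) (f v)"
    if e: "pideal p \<inter> pideal q \<inter> pideal t = pideal v"
  proof (cases rule: pideal_Int_cases[of p t])
    case 1
    then have "pideal v = {}" using e by blast
    then show ?thesis using self_in_pideal by blast
  next
    case (2 u)
    then have v: "pideal q \<inter> pideal u = pideal v" using e by blast
    have "left_quotient t v = left_quotient t u * left_quotient u v"
      using pideal_Int_eqD[OF 2] pideal_Int_eqD[OF v] by (intro left_quotient_trans)
    then show ?thesis using range_op_V[OF g 2] range_op_V[OF f v] f by (simp add: T_mult)
  qed
qed

lemma V_nica_covariant: "nica_covariant rkhs V"
  unfolding nica_covariant_def
proof (intro allI conjI impI ballI)
  fix p q f assume f: "f \<in> hcarrier rkhs"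
  show "range_op rkhs V p (range_op rkhs V q f) = range_op rkhs V r f"
    if r: "pideal p \<inter> pideal q = pideal r" for r
  proof
    fix t
    show "range_op rkhs V p (range_op rkhs V q f) t = range_op rkhs V r f t"
      using range_op_V_comp[OF f, of p q t] range_op_V[OF f, of r t] range_op_V_disjoint[of r t f] r
      by (cases rule: pideal_Int_cases[of r t]) auto
  qed
  show "range_op rkhs V p (range_op rkhs V q f) = 0" if "pideal p \<inter> pideal q = {}"
    using range_op_V_comp(1)[OF f, of p q] that by auto
qed

theorem minimal_dilation: "minimal_isometric_nica_dilation H T rkhs (kvec 1) V"
  unfolding minimal_isometric_nica_dilation_def
proof (intro conjI allI ballI V_unital_rep V_nica_covariant rkhs_hilbert_space)
  \<comment> \<open>Here \<open>K(1,p) = T(p)\<close>, since \<open>p\<close> itself generates the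
    intersection. The case \<open>p = 1\<close> makes the embedding isometric; general
    \<open>p\<close> gives the compression.\<close>
  have kvec_ip: "rkhs_ip (kvec p h) (kvec 1 k) = ip (T p h) k" if "h \<in> carr" "k \<in> carr" for p h k
  proof -
    have "rkhs_ip (kvec p h) (kvec 1 k) = ip (regular_kernel H T 1 p h) k"
      using that by (simp add: rkhs_reproducing) (simp add: kvec_def)
    then show ?thesis using that by (simp add: regular_kernel_eq[of 1 p p])
  qed
  show emb: "isometric_embedding H rkhs (kvec 1)"
    unfolding isometric_embedding_def using kvec_ip[of _ _ 1]
    by (auto simp: kvec_add kvec_scale)
  show "K.nrm (V p f) = K.nrm f" if "f \<in> K.carr" for p f using that by (rule V_nrm)
  show "kvec 1 (T p h) = orth_proj rkhs (kvec 1 ` carr) (V p (kvec 1 h))" if h: "h \<in> carr" for p h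
    by (rule orth_proj_embedding_eqI[OF inner_product_space_axioms K.inner_product_space_axioms emb,
          symmetric]) (use h kvec_ip in \<open>auto simp: V_kvec\<close>)
  have "{V p (kvec 1 h) | p h. h \<in> carr} = {kvec p h | p h. h \<in> carr}"
    using V_kvec[of _ _ 1] by (intro Collect_cong) (metis mult.right_neutral)
  then show "K.M.mtopology closure_of module.span (hscale rkhs) {V p (kvec 1 h) | p h. h \<in> carr}
      = K.carr" using rkhs_span_dense by simp
qed

end

text \<open>The reproducing kernel space fixes the type \<open>'p \<Rightarrow> 'h\<close> for the
  dilation. The last implication shows that this restricts nothing: a dilation carried by any other
  type yields one there.\<close>

theorem theorem3p9:
  fixes H :: "'h::ab_group_add hspace"
    and T :: "'p::right_lcm_semigroup \<Rightarrow> 'h \<Rightarrow> 'h"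
  assumes "hilbert_space H"
    and "unital_contractive_rep H T"
  shows
    "(star_regular_dilation H T \<longleftrightarrow> has_minimal_isometric_nica_dilation TYPE('p \<Rightarrow> 'h) H T) \<and>
     (star_regular_dilation H T \<longleftrightarrow> (\<forall>F. finite F \<longrightarrow> positive_op H (Z_op H T F))) \<and>
     (has_minimal_isometric_nica_dilation TYPE('k::ab_group_add) H T \<longrightarrow>
        has_minimal_isometric_nica_dilation TYPE('p \<Rightarrow> 'h) H T)"
proof -
  interpret hilbert_space H by fact
  interpret contractive_rep H T by unfold_locales fact
  have dil: "has_minimal_isometric_nica_dilation TYPE('p \<Rightarrow> 'h) H T"
    if "star_regular_dilation H T"
  proof -
    interpret star_regular_rep H T by unfold_locales fact
    show ?thesis unfolding has_minimal_isometric_nica_dilation_def using minimal_dilation by blast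
  qed
  have reg: "star_regular_dilation H T"
    if "has_minimal_isometric_nica_dilation TYPE('p \<Rightarrow> 'h) H T"
    using that dilation_imp_star_regular unfolding has_minimal_isometric_nica_dilation_def by blast
  have reg': "star_regular_dilation H T"
    if "has_minimal_isometric_nica_dilation TYPE('k) H T"
    using that dilation_imp_star_regular unfolding has_minimal_isometric_nica_dilation_def by blast
  show ?thesis
    using dil reg reg' star_regular_imp_Z_positive Z_positive_imp_star_regular by blast
qed

end
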